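(* Let $\{S,T,E,N,\mathbf x\}$ be an admissible data set for the problem $\mathbf{AIP}_{\mathcal H(K_S)}$ (as defined in the context) satisfying $P:=M_{F^S}^{[*]}M_{F^S}\ge\mathbf x\mathbf x^*$, and assume that $$\Big(\bigcap_{k\ge1}\mathrm{Ran}\,(T^* )^k\Big)\cap\mathrm{Ker}\,T^*=\{0\}.$$ Then: (1) There is a unique Schur-class function $\mathcal E\in\mathcal S(\widetilde\Delta,\widetilde\Delta_* )$ such that $S=\mathcal R_\Sigma[\mathcal E]$, where $\mathcal R_\Sigma$ is the Redheffer transform constructed from $\{P,T,E,N\}$ as in the context. (2) Let $G(z)=\Sigma_{12}(z)(I-\mathcal E(z)\Sigma_{22}(z))^{-1}$, $\Gamma(z)=(C_1+G(z)\mathcal E(z)C_2)(I-zA)^{-1}$, and let $\widetilde{\mathbf x}\in\mathcal X_0=\overline{\mathrm{Ran}}\,P^{1/2}$ be the unique vector with $\mathbf x=P^{1/2}\widetilde{\mathbf x}$. Then the parametrization $$h\mapsto f,\qquad f(z)=\Gamma(z)\widetilde{\mathbf x}+G(z)h(z),\qquad h\in\mathcal H(K_{\mathcal E}),\ \|h\|_{\mathcal H(K_{\mathcal E})}\le\sqrt{1-\|\widetilde{\mathbf x}\|^2},$$ of the set of all solutions $f$ to the problem $\mathbf{AIP}_{\mathcal H(K_S)}$ is injective. That is, the operator $M_G:\mathcal H(K_{\mathcal E})\to\mathcal H(K_S)$ is isometric, so that in addition $$\|f\|^2_{\mathcal H(K_S)}=\|\widetilde{\mathbf x}\|^2_{\mathcal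 X_0}+\|h\|^2_{\mathcal H(K_{\mathcal E})}.$$
   Context: Notation. All spaces $\mathcal X,\mathcal U,\mathcal Y$ are complex Hilbert spaces; $\mathcal L(\mathcal U,\mathcal Y)$ is the space of bounded operators, $\mathcal L(\mathcal X)=\mathcal L(\mathcal X,\mathcal X)$; $\mathbb D$ is the open unit disk; $\mathrm{Hol}_{\mathcal Y}(\mathbb D)$ is the space of $\mathcal Y$-valued holomorphic functions on $\mathbb D$. The Schur class $\mathcal S(\mathcal U,\mathcal Y)$ is the set of analytic functions on $\mathbb D$ whose values are contractions in $\mathcal L(\mathcal U,\mathcal Y)$. For $S\in\mathcal S(\mathcal U,\mathcal Y)$, $\mathcal H(K_S)$ is the de Branges–Rovnyak space: the reproducing kernel Hilbert space of $\mathcal Y$-valued functions with kernel $K_S(z,\zeta)=\frac{I_{\mathcal Y}-S(z)S(\zeta)^*}{1-z\bar\zeta}$. For an operator $A$ into $\mathcal H(K_S)$, $A^{[*]}$ is the adjoint with respect to the inner product of $\mathcal H(K_S)$. $M_F$ denotes multiplication by $F$. For $\mathbf x\in\mathcal X$, $\mathbf x\mathbf x^*$ is the operator $y\mapsto\langle y,\mathbf x\rangle\mathbf x$. Admissible data and the problem. $(E,T)$ with $E\in\mathcal L(\mathcal X,\mathcal Y)$, $T\in\mathcal L(\mathcal X)$ is an analytic output pair if $\mathcal O_{E,T}:x\mapsto E(I-zT)^{-1}x=\sum_{n\ge0}z^nET^nx$ maps $\mathcal X$ into $\mathrm{Hol}_{\mathcal Y}(\mathbb D)$. A data set $\{S,T,E,N,\mathbf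 x\}$ with $S\in\mathcal S(\mathcal U,\mathcal Y)$, $T\in\mathcal L(\mathcal X)$, $E\in\mathcal L(\mathcal X,\mathcal Y)$, $N\in\mathcal L(\mathcal X,\mathcal U)$, $\mathbf x\in\mathcal X$ is $\mathbf{AIP}_{\mathcal H(K_S)}$-admissible if (i) $(E,T)$ and $(N,T)$ are analytic output pairs; (ii) with $F^S(z)=(E-S(z)N)(I-zT)^{-1}$, the operator $M_{F^S}:x\mapsto F^Sx$, i.e. $M_{F^S}=\mathcal O_{E,T}-M_S\mathcal O_{N,T}$, maps $\mathcal X$ into $\mathcal H(K_S)$; (iii) $P:=M_{F^S}^{[*]}M_{F^S}$ satisfies $P-T^*PT=E^*E-N^*N$. The problem $\mathbf{AIP}_{\mathcal H(K_S)}$: find all $f\in\mathcal H(K_S)$ with $M_{F^S}^{[*]}f=\mathbf x$ and $\|f\|_{\mathcal H(K_S)}\le1$. Construction of $\Sigma$ and $\mathcal R_\Sigma$. Put $\mathcal X_0=\overline{\mathrm{Ran}}\,P^{1/2}$; $P^{1/2}$ is regarded as an operator $\mathcal X\to\mathcal X_0$ or $\mathcal X_0\to\mathcal X$ as needed. The equation in (iii) yields a unique isometry $V$ from $\mathcal D_V=\overline{\mathrm{Ran}}\begin{bmatrix}P^{1/2}\\ N\end{bmatrix}\subseteq\mathcal X_0\oplus\mathcal U$ onto $\mathcal R_V=\overline{\mathrm{Ran}}\begin{bmatrix}P^{1/2}T\\ E\end{bmatrix}\subseteq\mathcal X_0\oplus\mathcal Y$ with $V\begin{bmatrix}P^{1/2}x\\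 Nx\end{bmatrix}=\begin{bmatrix}P^{1/2}Tx\\ Ex\end{bmatrix}$ for $x\in\mathcal X$. Let $\Delta=(\mathcal X_0\oplus\mathcal U)\ominus\mathcal D_V$, $\Delta_*=(\mathcal X_0\oplus\mathcal Y)\ominus\mathcal R_V$, and let $\mathbf i:\Delta\to\widetilde\Delta$, $\mathbf i_*:\Delta_*\to\widetilde\Delta_*$ be unitary maps onto isomorphic copies. The unitary operator $\mathbf U:\mathcal X_0\oplus\mathcal U\oplus\widetilde\Delta_*\to\mathcal X_0\oplus\mathcal Y\oplus\widetilde\Delta$ acts as $V$ from $\mathcal D_V$ onto $\mathcal R_V$, as $\mathbf i$ from $\Delta$ onto $\widetilde\Delta$, and as $\mathbf i_*^*$ from $\widetilde\Delta_*$ onto $\Delta_*$. Write it as $$\mathbf U=\begin{bmatrix}A&B_1&B_2\\ C_1&D_{11}&D_{12}\\ C_2&D_{21}&0\end{bmatrix},\qquad \Sigma(z)=\begin{bmatrix}\Sigma_{11}(z)&\Sigma_{12}(z)\\ \Sigma_{21}(z)&\Sigma_{22}(z)\end{bmatrix}=\begin{bmatrix}D_{11}&D_{12}\\ D_{21}&0\end{bmatrix}+z\begin{bmatrix}C_1\\ C_2\end{bmatrix}(I-zA)^{-1}\begin{bmatrix}B_1&B_2\end{bmatrix},$$ with $\Sigma(z):\mathcal U\oplus\widetilde\Delta_*\to\mathcal Y\oplus\widetilde\Delta$. For $\mathcal E\in\mathcal S(\widetilde\Delta,\widetilde\Delta_* )$ the Redheffer transform is $\mathcal R_\Sigma[\mathcal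 E]=\Sigma_{11}+\Sigma_{12}(I-\mathcal E\Sigma_{22})^{-1}\mathcal E\Sigma_{21}\in\mathcal S(\mathcal U,\mathcal Y)$. *)

theory Defs
  imports "HOL-Analysis.Analysis"
begin

section \<open>Complex Hilbert spaces\<close>

class complex_vector = real_vector +
  fixes scaleC :: "complex \<Rightarrow> 'a \<Rightarrow> 'a" (infixr "*\<^sub>C" 75)
  assumes scaleC_add_right: "c *\<^sub>C (x + y) = c *\<^sub>C x + c *\<^sub>C y"
    and scaleC_add_left: "(c + d) *\<^sub>C x = c *\<^sub>C x + d *\<^sub>C x"
    and scaleC_scaleC: "c *\<^sub>C d *\<^sub>C x = (c * d) *\<^sub>C x"
    and scaleC_one: "1 *\<^sub>C x = x"
    and scaleR_scaleC: "r *\<^sub>R x = complex_of_real r *\<^sub>C x"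

text \<open>The complex inner product is linear in the first argument. The real inner product, norm
  and topology of \<^class>\<open>real_inner\<close> are the ones it induces, so that
  \<open>norm x ^ 2 = Re (cinner x x)\<close>.\<close>

class complex_inner = complex_vector + real_inner +
  fixes cinner :: "'a \<Rightarrow> 'a \<Rightarrow> complex"
  assumes cinner_commute: "cinner y x = cnj (cinner x y)"
    and cinner_add_left: "cinner (x + y) z = cinner x z + cinner y z"
    and cinner_scaleC_left: "cinner (c *\<^sub>C x) y = c * cinner x y"
    and inner_eq_Re_cinner: "inner x y = Re (cinner x y)"

class chilbert_space = complex_inner + complete_space

instantiation complex :: chilbert_space
begin

definition scaleC_complex :: "complex \<Rightarrow> complex \<Rightarrow> complex" where
  "scaleC_complex c x = c * x"

definition cinner_complex :: "complex \<Rightarrow> complex \<Rightarrow> complex" where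
  "cinner_complex x y = x * cnj y"

instance
  by standard (simp_all add: scaleC_complex_def cinner_complex_def algebra_simps
      scaleR_conv_of_real inner_complex_def)

end

text \<open>The Hilbert space direct sum; its norm is the library's norm on product types.\<close>

instantiation prod :: (chilbert_space, chilbert_space) chilbert_space
begin

definition scaleC_prod :: "complex \<Rightarrow> 'a \<times> 'b \<Rightarrow> 'a \<times> 'b" where
  "scaleC_prod c p = (c *\<^sub>C fst p, c *\<^sub>C snd p)"

definition cinner_prod :: "'a \<times> 'b \<Rightarrow> 'a \<times> 'b \<Rightarrow> complex" where
  "cinner_prod p q = cinner (fst p) (fst q) + cinner (snd p) (snd q)"

instance
proof
  fix c d :: complex and r :: real and x y z :: "'a \<times> 'b"
  show "c *\<^sub>C (x + y) = c *\<^sub>C x + c *\<^sub>C y"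
    by (simp add: scaleC_prod_def scaleC_add_right)
  show "(c + d) *\<^sub>C x = c *\<^sub>C x + d *\<^sub>C x"
    by (simp add: scaleC_prod_def scaleC_add_left)
  show "c *\<^sub>C d *\<^sub>C x = (c * d) *\<^sub>C x"
    by (simp add: scaleC_prod_def scaleC_scaleC)
  show "1 *\<^sub>C x = x"
    by (simp add: scaleC_prod_def scaleC_one)
  show "r *\<^sub>R x = complex_of_real r *\<^sub>C x"
    by (simp add: scaleC_prod_def scaleR_scaleC scaleR_prod_def)
  show "cinner y x = cnj (cinner x y)"
    by (simp add: cinner_prod_def cinner_commute[of "fst y"] cinner_commute[of "snd y"])
  show "cinner (x + y) z = cinner x z + cinner y z"
    by (simp add: cinner_prod_def cinner_add_left)
  show "cinner (c *\<^sub>C x) y = c * cinner x y"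
    by (simp add: cinner_prod_def scaleC_prod_def cinner_scaleC_left distrib_left)
  show "inner x y = Re (cinner x y)"
    by (simp add: cinner_prod_def inner_prod_def inner_eq_Re_cinner)
qed

end

section \<open>Operators\<close>

definition bounded_clinear :: "('a::chilbert_space \<Rightarrow> 'b::chilbert_space) \<Rightarrow> bool" where
  "bounded_clinear f \<longleftrightarrow> bounded_linear f \<and> (\<forall>c x. f (c *\<^sub>C x) = c *\<^sub>C f x)"

definition cadjoint ::
  "('a::chilbert_space \<Rightarrow> 'b::chilbert_space) \<Rightarrow> 'b \<Rightarrow> 'a" where
  "cadjoint f = (THE g. \<forall>x y. cinner (f x) y = cinner x (g y))"

definition positive_op :: "('a::chilbert_space \<Rightarrow> 'a) \<Rightarrow> bool" where
  "positive_op f \<longleftrightarrow>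
     bounded_clinear f \<and> (\<forall>x. Im (cinner (f x) x) = 0 \<and> 0 \<le> Re (cinner (f x) x))"

text \<open>\<open>is_psqrt R P\<close>: \<open>R\<close> is the (unique) positive square root of \<open>P\<close>.\<close>

definition is_psqrt :: "('a::chilbert_space \<Rightarrow> 'a) \<Rightarrow> ('a \<Rightarrow> 'a) \<Rightarrow> bool" where
  "is_psqrt R P \<longleftrightarrow> positive_op R \<and> R \<circ> R = P"

text \<open>Here \<open>A\<close> and \<open>B\<close> are linear subspaces; nothing is said about \<open>f\<close> outside \<open>A\<close>.\<close>

definition unitary_between ::
  "'a::chilbert_space set \<Rightarrow> 'b::chilbert_space set \<Rightarrow> ('a \<Rightarrow> 'b) \<Rightarrow> bool" where
  "unitary_between A B f \<longleftrightarrow>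
     f ` A = B \<and>
     (\<forall>x\<in>A. \<forall>y\<in>A. f (x + y) = f x + f y) \<and>
     (\<forall>c. \<forall>x\<in>A. f (c *\<^sub>C x) = c *\<^sub>C f x) \<and>
     (\<forall>x\<in>A. \<forall>y\<in>A. cinner (f x) (f y) = cinner x y)"

definition orth_minus ::
  "'a::chilbert_space set \<Rightarrow> 'a set \<Rightarrow> 'a set" (infixl "\<ominus>" 65) where
  "A \<ominus> B = {x \<in> A. \<forall>y\<in>B. cinner x y = 0}"

section \<open>Functions on the unit disk\<close>

abbreviation disk :: "complex set" ("\<bbbD>") where "\<bbbD> \<equiv> ball 0 1"

definition holomorphic_disk :: "(complex \<Rightarrow> 'y::chilbert_space) \<Rightarrow> bool" where
  "holomorphic_disk f \<longleftrightarrow>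
     (\<forall>z\<in>\<bbbD>. \<exists>l. ((\<lambda>w. (1 / (w - z)) *\<^sub>C (f w - f z)) \<longlongrightarrow> l) (at z))"

text \<open>Holomorphy of an operator valued function: the difference quotients converge in
  operator norm.\<close>

definition op_holomorphic_disk ::
  "(complex \<Rightarrow> 'u::chilbert_space \<Rightarrow> 'y::chilbert_space) \<Rightarrow> bool" where
  "op_holomorphic_disk S \<longleftrightarrow>
     (\<forall>z\<in>\<bbbD>. \<exists>L. bounded_clinear L \<and>
        ((\<lambda>w. onorm (\<lambda>u. (1 / (w - z)) *\<^sub>C (S w u - S z u) - L u)) \<longlongrightarrow> 0) (at z))"

text \<open>Only the values on the disk matter for membership in the Schur class, so two of its
  elements are to be identified when they agree on the disk.\<close>

definition schur_class ::
  "(complex \<Rightarrow> 'u::chilbert_space \<Rightarrow> 'y::chilbert_space) set" where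
  "schur_class = {S. (\<forall>z\<in>\<bbbD>. bounded_clinear (S z) \<and> (\<forall>u. norm (S z u) \<le> norm u)) \<and>
                     op_holomorphic_disk S}"

section \<open>Reproducing kernel Hilbert spaces on the disk\<close>

text \<open>A Hilbert space of functions on the disk is given by its set of elements \<open>H\<close> and its inner
  product \<open>ip\<close> (relevant only on \<open>H\<close>). Functions on the disk are represented by functions that
  vanish off the disk, so that equality in \<open>H\<close> is equality of functions.\<close>

definition on_disk :: "(complex \<Rightarrow> 'y::chilbert_space) \<Rightarrow> complex \<Rightarrow> 'y" where
  "on_disk f = (\<lambda>z. if z \<in> \<bbbD> then f z else 0)"

definition rk_norm ::
  "((complex \<Rightarrow> 'y::chilbert_space) \<Rightarrow> (complex \<Rightarrow> 'y) \<Rightarrow> complex) \<Rightarrow>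
   (complex \<Rightarrow> 'y) \<Rightarrow> real" where
  "rk_norm ip f = sqrt (Re (ip f f))"

text \<open>\<open>is_rkhs K H ip\<close>: \<open>(H, ip)\<close> is the (unique) Hilbert space of functions on the disk
  with reproducing kernel \<open>K\<close>.\<close>

definition is_rkhs ::
  "(complex \<Rightarrow> complex \<Rightarrow> 'y::chilbert_space \<Rightarrow> 'y) \<Rightarrow>
   (complex \<Rightarrow> 'y) set \<Rightarrow>
   ((complex \<Rightarrow> 'y) \<Rightarrow> (complex \<Rightarrow> 'y) \<Rightarrow> complex) \<Rightarrow> bool" where
  "is_rkhs K H ip \<longleftrightarrow>
     (\<forall>f\<in>H. \<forall>z. z \<notin> \<bbbD> \<longrightarrow> f z = 0) \<and>
     (\<lambda>z. 0) \<in> H \<and>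
     (\<forall>f\<in>H. \<forall>g\<in>H. (\<lambda>z. f z + g z) \<in> H) \<and>
     (\<forall>c. \<forall>f\<in>H. (\<lambda>z. c *\<^sub>C f z) \<in> H) \<and>
     (\<forall>f\<in>H. \<forall>g\<in>H. \<forall>h\<in>H. ip (\<lambda>z. f z + g z) h = ip f h + ip g h) \<and>
     (\<forall>c. \<forall>f\<in>H. \<forall>h\<in>H. ip (\<lambda>z. c *\<^sub>C f z) h = c * ip f h) \<and>
     (\<forall>f\<in>H. \<forall>g\<in>H. ip g f = cnj (ip f g)) \<and>
     (\<forall>f\<in>H. f \<noteq> (\<lambda>z. 0) \<longrightarrow> 0 < Re (ip f f)) \<and>
     (\<forall>F :: nat \<Rightarrow> complex \<Rightarrow> 'y.
        (\<forall>n. F n \<in> H) \<and>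
        (\<forall>e>0. \<exists>M. \<forall>m\<ge>M. \<forall>n\<ge>M. rk_norm ip (\<lambda>z. F m z - F n z) < e) \<longrightarrow>
        (\<exists>f\<in>H. (\<lambda>n. rk_norm ip (\<lambda>z. F n z - f z)) \<longlonglongrightarrow> 0)) \<and>
     (\<forall>\<zeta>\<in>\<bbbD>. \<forall>y. on_disk (\<lambda>z. K z \<zeta> y) \<in> H \<and>
        (\<forall>f\<in>H. ip f (on_disk (\<lambda>z. K z \<zeta> y)) = cinner (f \<zeta>) y))"

text \<open>The de Branges--Rovnyak kernel \<open>K\<^sub>S\<close>.\<close>

definition dBR_kernel ::
  "(complex \<Rightarrow> 'u::chilbert_space \<Rightarrow> 'y::chilbert_space) \<Rightarrow>
   complex \<Rightarrow> complex \<Rightarrow> 'y \<Rightarrow> 'y" where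
  "dBR_kernel S z \<zeta> y = (1 / (1 - z * cnj \<zeta>)) *\<^sub>C (y - S z (cadjoint (S \<zeta>) y))"

text \<open>The adjoint of an operator \<open>M\<close> from \<open>'x\<close> into a function space with inner product
  \<open>ip\<close>.\<close>

definition rk_adjoint ::
  "((complex \<Rightarrow> 'y::chilbert_space) \<Rightarrow> (complex \<Rightarrow> 'y) \<Rightarrow> complex) \<Rightarrow>
   ('x::chilbert_space \<Rightarrow> complex \<Rightarrow> 'y) \<Rightarrow> (complex \<Rightarrow> 'y) \<Rightarrow> 'x" where
  "rk_adjoint ip M f = (THE v. \<forall>x. ip (M x) f = cinner x v)"

section \<open>The interpolation problem\<close>

definition obs_op ::
  "('x::chilbert_space \<Rightarrow> 'y::chilbert_space) \<Rightarrow> ('x \<Rightarrow> 'x) \<Rightarrow> 'x \<Rightarrow> complex \<Rightarrow> 'y" where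
  "obs_op E T x = on_disk (\<lambda>z. \<Sum>n. z ^ n *\<^sub>C E ((T ^^ n) x))"

definition analytic_output_pair ::
  "('x::chilbert_space \<Rightarrow> 'y::chilbert_space) \<Rightarrow> ('x \<Rightarrow> 'x) \<Rightarrow> bool" where
  "analytic_output_pair E T \<longleftrightarrow>
     (\<forall>x. (\<forall>z\<in>\<bbbD>. summable (\<lambda>n. z ^ n *\<^sub>C E ((T ^^ n) x))) \<and>
          holomorphic_disk (obs_op E T x))"

text \<open>The operator \<open>M\<^bsub>F\<^esub>\<close> for \<open>F = F\<^sup>S\<close>; since \<open>I - z T\<close> need not be invertible,
  \<open>(E - S(z) N) (I - z T)\<^sup>-\<^sup>1 x\<close> is read through the power series.\<close>

definition M_F ::
  "(complex \<Rightarrow> 'u::chilbert_space \<Rightarrow> 'y::chilbert_space) \<Rightarrow>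
   ('x::chilbert_space \<Rightarrow> 'x) \<Rightarrow> ('x \<Rightarrow> 'y) \<Rightarrow> ('x \<Rightarrow> 'u) \<Rightarrow> 'x \<Rightarrow> complex \<Rightarrow> 'y" where
  "M_F S T E N x = on_disk (\<lambda>z. obs_op E T x z - S z (obs_op N T x z))"

definition gram_op ::
  "((complex \<Rightarrow> 'y::chilbert_space) \<Rightarrow> (complex \<Rightarrow> 'y) \<Rightarrow> complex) \<Rightarrow>
   (complex \<Rightarrow> 'u::chilbert_space \<Rightarrow> 'y) \<Rightarrow>
   ('x::chilbert_space \<Rightarrow> 'x) \<Rightarrow> ('x \<Rightarrow> 'y) \<Rightarrow> ('x \<Rightarrow> 'u) \<Rightarrow> 'x \<Rightarrow> 'x" where
  "gram_op ip S T E N = rk_adjoint ip (M_F S T E N) \<circ> M_F S T E N"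

text \<open>Here \<open>(H, ip)\<close> is the space \<open>H(K\<^sub>S)\<close>. The last item \<open>x\<close> of the data set is an arbitrary vector
  and hence not mentioned.\<close>

definition AIP_admissible ::
  "(complex \<Rightarrow> 'y::chilbert_space) set \<Rightarrow>
   ((complex \<Rightarrow> 'y) \<Rightarrow> (complex \<Rightarrow> 'y) \<Rightarrow> complex) \<Rightarrow>
   (complex \<Rightarrow> 'u::chilbert_space \<Rightarrow> 'y) \<Rightarrow>
   ('x::chilbert_space \<Rightarrow> 'x) \<Rightarrow> ('x \<Rightarrow> 'y) \<Rightarrow> ('x \<Rightarrow> 'u) \<Rightarrow> bool" where
  "AIP_admissible H ip S T E N \<longleftrightarrow>
     S \<in> schur_class \<and> bounded_clinear T \<and> bounded_clinear E \<and> bounded_clinear N \<and>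
     analytic_output_pair E T \<and> analytic_output_pair N T \<and>
     range (M_F S T E N) \<subseteq> H \<and>
     (\<forall>x. gram_op ip S T E N x - cadjoint T (gram_op ip S T E N (T x)) =
          cadjoint E (E x) - cadjoint N (N x))"

definition AIP_solutions ::
  "(complex \<Rightarrow> 'y::chilbert_space) set \<Rightarrow>
   ((complex \<Rightarrow> 'y) \<Rightarrow> (complex \<Rightarrow> 'y) \<Rightarrow> complex) \<Rightarrow>
   (complex \<Rightarrow> 'u::chilbert_space \<Rightarrow> 'y) \<Rightarrow>
   ('x::chilbert_space \<Rightarrow> 'x) \<Rightarrow> ('x \<Rightarrow> 'y) \<Rightarrow> ('x \<Rightarrow> 'u) \<Rightarrow> 'x \<Rightarrow>
   (complex \<Rightarrow> 'y) set" where
  "AIP_solutions H ip S T E N x =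
     {f \<in> H. rk_adjoint ip (M_F S T E N) f = x \<and> rk_norm ip f \<le> 1}"

section \<open>The unitary colligation and the Redheffer transform\<close>

text \<open>In this section \<open>R\<close> stands for \<open>P\<^bsup>1/2\<^esup>\<close>.\<close>

definition X0 :: "('x::chilbert_space \<Rightarrow> 'x) \<Rightarrow> 'x set" where
  "X0 R = closure (range R)"

definition DV ::
  "('x::chilbert_space \<Rightarrow> 'x) \<Rightarrow> ('x \<Rightarrow> 'u::chilbert_space) \<Rightarrow> ('x \<times> 'u) set" where
  "DV R N = closure (range (\<lambda>x. (R x, N x)))"

definition RV ::
  "('x::chilbert_space \<Rightarrow> 'x) \<Rightarrow> ('x \<Rightarrow> 'x) \<Rightarrow> ('x \<Rightarrow> 'y::chilbert_space) \<Rightarrow> ('x \<times> 'y) set" where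
  "RV R T E = closure (range (\<lambda>x. (R (T x), E x)))"

definition Delta ::
  "('x::chilbert_space \<Rightarrow> 'x) \<Rightarrow> ('x \<Rightarrow> 'u::chilbert_space) \<Rightarrow> ('x \<times> 'u) set" where
  "Delta R N = (X0 R \<times> UNIV) \<ominus> DV R N"

definition Delta_star ::
  "('x::chilbert_space \<Rightarrow> 'x) \<Rightarrow> ('x \<Rightarrow> 'x) \<Rightarrow> ('x \<Rightarrow> 'y::chilbert_space) \<Rightarrow> ('x \<times> 'y) set" where
  "Delta_star R T E = (X0 R \<times> UNIV) \<ominus> RV R T E"

definition is_isometry_V ::
  "('x::chilbert_space \<Rightarrow> 'x) \<Rightarrow> ('x \<Rightarrow> 'x) \<Rightarrow> ('x \<Rightarrow> 'y::chilbert_space) \<Rightarrow>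
   ('x \<Rightarrow> 'u::chilbert_space) \<Rightarrow> ('x \<times> 'u \<Rightarrow> 'x \<times> 'y) \<Rightarrow> bool" where
  "is_isometry_V R T E N V \<longleftrightarrow>
     unitary_between (DV R N) (RV R T E) V \<and> (\<forall>x. V (R x, N x) = (R (T x), E x))"

text \<open>The spaces \<open>X\<^sub>0 \<oplus> U \<oplus> \<Delta>'\<^sub>*\<close> and \<open>X\<^sub>0 \<oplus> Y \<oplus> \<Delta>'\<close>, with \<open>\<Delta>'\<close> and \<open>\<Delta>'\<^sub>*\<close> the isomorphic copies
  of \<open>\<Delta>\<close> and \<open>\<Delta>\<^sub>*\<close>, are subspaces of the (right nested) product types. In the last clause, the
  image \<open>q\<close> of \<open>j q\<close> is the value of \<open>j\<^sup>*\<close> at \<open>j q\<close>.\<close>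

definition is_unitary_U ::
  "('x::chilbert_space \<Rightarrow> 'x) \<Rightarrow> ('x \<Rightarrow> 'x) \<Rightarrow> ('x \<Rightarrow> 'y::chilbert_space) \<Rightarrow>
   ('x \<Rightarrow> 'u::chilbert_space) \<Rightarrow> ('x \<times> 'u \<Rightarrow> 'x \<times> 'y) \<Rightarrow>
   ('x \<times> 'u \<Rightarrow> 'd::chilbert_space) \<Rightarrow> ('x \<times> 'y \<Rightarrow> 'e::chilbert_space) \<Rightarrow>
   ('x \<times> 'u \<times> 'e \<Rightarrow> 'x \<times> 'y \<times> 'd) \<Rightarrow> bool" where
  "is_unitary_U R T E N V i j U \<longleftrightarrow>
     unitary_between (X0 R \<times> UNIV) (X0 R \<times> UNIV) U \<and>
     (\<forall>p\<in>DV R N. U (fst p, snd p, 0) = (fst (V p), snd (V p), 0)) \<and>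
     (\<forall>p\<in>Delta R N. U (fst p, snd p, 0) = (0, 0, i p)) \<and>
     (\<forall>q\<in>Delta_star R T E. U (0, 0, j q) = (fst q, snd q, 0))"

context
  fixes U :: "'x::chilbert_space \<times> 'u::chilbert_space \<times> 'e::chilbert_space \<Rightarrow>
              'x \<times> 'y::chilbert_space \<times> 'd::chilbert_space"
begin

definition blk_A :: "'x \<Rightarrow> 'x" where "blk_A a = fst (U (a, 0, 0))"
definition blk_B1 :: "'u \<Rightarrow> 'x" where "blk_B1 u = fst (U (0, u, 0))"
definition blk_B2 :: "'e \<Rightarrow> 'x" where "blk_B2 e = fst (U (0, 0, e))"
definition blk_C1 :: "'x \<Rightarrow> 'y" where "blk_C1 a = fst (snd (U (a, 0, 0)))"
definition blk_D11 :: "'u \<Rightarrow> 'y" where "blk_D11 u = fst (snd (U (0, u, 0)))"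
definition blk_D12 :: "'e \<Rightarrow> 'y" where "blk_D12 e = fst (snd (U (0, 0, e)))"
definition blk_C2 :: "'x \<Rightarrow> 'd" where "blk_C2 a = snd (snd (U (a, 0, 0)))"
definition blk_D21 :: "'u \<Rightarrow> 'd" where "blk_D21 u = snd (snd (U (0, u, 0)))"

text \<open>\<open>(I - z A)\<^sup>-\<^sup>1\<close>, the inverse being taken on the closed subspace \<open>X\<close> (which will be \<open>X\<^sub>0\<close>).\<close>

definition resolvent :: "'x set \<Rightarrow> complex \<Rightarrow> 'x \<Rightarrow> 'x" where
  "resolvent X z = inv_into X (\<lambda>a. a - z *\<^sub>C blk_A a)"

definition Sigma11 :: "'x set \<Rightarrow> complex \<Rightarrow> 'u \<Rightarrow> 'y" where
  "Sigma11 X z u = blk_D11 u + z *\<^sub>C blk_C1 (resolvent X z (blk_B1 u))"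

definition Sigma12 :: "'x set \<Rightarrow> complex \<Rightarrow> 'e \<Rightarrow> 'y" where
  "Sigma12 X z e = blk_D12 e + z *\<^sub>C blk_C1 (resolvent X z (blk_B2 e))"

definition Sigma21 :: "'x set \<Rightarrow> complex \<Rightarrow> 'u \<Rightarrow> 'd" where
  "Sigma21 X z u = blk_D21 u + z *\<^sub>C blk_C2 (resolvent X z (blk_B1 u))"

definition Sigma22 :: "'x set \<Rightarrow> complex \<Rightarrow> 'e \<Rightarrow> 'd" where
  "Sigma22 X z e = z *\<^sub>C blk_C2 (resolvent X z (blk_B2 e))"

definition G_fun :: "'x set \<Rightarrow> (complex \<Rightarrow> 'd \<Rightarrow> 'e) \<Rightarrow> complex \<Rightarrow> 'e \<Rightarrow> 'y" where
  "G_fun X \<E> z e = Sigma12 X z (inv (\<lambda>e'. e' - \<E> z (Sigma22 X z e')) e)"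

definition redheffer :: "'x set \<Rightarrow> (complex \<Rightarrow> 'd \<Rightarrow> 'e) \<Rightarrow> complex \<Rightarrow> 'u \<Rightarrow> 'y" where
  "redheffer X \<E> z u =
     Sigma11 X z u +
     Sigma12 X z (inv (\<lambda>e'. e' - \<E> z (Sigma22 X z e')) (\<E> z (Sigma21 X z u)))"

definition Gamma_fun :: "'x set \<Rightarrow> (complex \<Rightarrow> 'd \<Rightarrow> 'e) \<Rightarrow> complex \<Rightarrow> 'x \<Rightarrow> 'y" where
  "Gamma_fun X \<E> z a =
     blk_C1 (resolvent X z a) + G_fun X \<E> z (\<E> z (blk_C2 (resolvent X z a)))"

end

end

theory Submission
  imports Defs "HOL-Library.Function_Algebras" "HOL-Complex_Analysis.Complex_Analysis"
begin

text \<open>On \<open>H(K\<^sub>S)\<close> the backward shift is a coisometric colligation \<open>W\<close> with transfer function \<open>S\<close>: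
  it takes \<open>(f, u)\<close> to \<open>(g, y)\<close> when \<open>z g(z) + y = f(z) + S(z) u\<close>. It maps \<open>(F\<^sup>S x, N x)\<close> to
  \<open>(F\<^sup>S T x, E x)\<close>, and \<open>P\<^bsup>1/2\<^esup> x \<mapsto> F\<^sup>S x\<close> extends to an isometry \<open>J\<close> on \<open>X\<^sub>0\<close>, so \<open>W\<close> extends
  the isometry \<open>V\<close>. Being a contraction, \<open>W\<close> is the direct sum of \<open>V\<close> and a coisometric colligation
  with state space \<open>H(K\<^sub>S) \<ominus> J X\<^sub>0\<close>, input \<open>\<Delta>\<close> and output \<open>\<Delta>\<^sub>*\<close>. Its transfer function \<open>\<E>\<close> is of Schur
  class, and coupling it with \<open>U\<close> gives back \<open>W\<close>, whence \<open>S = R\<^sub>\<Sigma>[\<E>]\<close>, \<open>J a = \<Gamma> a\<close>, and \<open>k = G h\<close>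
  where \<open>h\<close> is the image of \<open>k \<in> H(K\<^sub>S) \<ominus> J X\<^sub>0\<close> under the observability map of the second summand.
  That map is injective and its colligation is coisometric, so it is unitary onto \<open>H(K\<^sub>\<E>)\<close>; the
  parametrization of the solutions and the norm identity are the orthogonal decomposition
  \<open>f = J a + k\<close>.

  If \<open>S = R\<^sub>\<Sigma>[\<E>] = R\<^sub>\<Sigma>[\<E>']\<close>, the difference of the states of the two feedback loops yields
  vectors \<open>y(z)\<close>, analytic in \<open>z\<close>, with \<open>T\<^sup>* y(z) = z y(z)\<close>; the condition on \<open>T\<^sup>*\<close> forces
  \<open>y = 0\<close>. As \<open>\<Sigma>\<^sub>2\<^sub>1(z)\<close> has dense range for small \<open>z\<close>, \<open>\<E>\<close> and \<open>\<E>'\<close> agree near 0 and hence on the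
  disk.\<close>

section \<open>Complex inner product spaces\<close>

text \<open>H(K_S) and H(K_\<E>) are sets of functions with an inner product given from outside, and
  \<E> is built on a subspace of H(K_S). Colligations are therefore linear relations on carriers,
  and feedback loops are solved by fixed points. One device produces the maps between these spaces:
  two families with equal Gram matrices. It gives the backward shift (from the kernel identity), the
  isometry \<open>J\<close> (from P being the square of \<open>R\<close>) and the unitarity of the
  observability map.

  The splitting of W rests on one fact: a contraction that preserves the norm on a subspace sends
  the orthogonal complement into the complement of the image. So the contractivity of the shift
  matters as much as its existence; both come out of the same Gram transfer.

  In the uniqueness part, the equation for y(z) arises because U is unitary and the interpolation
  data are trajectories of U without signal on the ports closed by the load. Both loops give the
  same output in Y, so pairing their difference with the data leaves only states; y(z) is
  \<open>R\<close> applied to the difference of the states.\<close>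

lemma scaleC_zero_left [simp]: "0 *\<^sub>C (x::'a::complex_vector) = 0"
  using scaleC_add_left[of 0 0 x] by simp

lemma scaleC_zero_right [simp]: "c *\<^sub>C (0::'a::complex_vector) = 0"
  using scaleC_add_right[of c "0::'a" 0] by simp

lemma scaleC_one' [simp]: "1 *\<^sub>C (x::'a::complex_vector) = x"
  by (rule scaleC_one)

lemma scaleC_minus_right [simp]: "c *\<^sub>C (- x) = - (c *\<^sub>C (x::'a::complex_vector))"
  using scaleC_add_right[of c x "- x"] by (simp add: eq_neg_iff_add_eq_0 add.commute)

lemma scaleC_minus_left: "(- c) *\<^sub>C x = - (c *\<^sub>C (x::'a::complex_vector))"
  using scaleC_add_left[of "- c" c x] by (simp add: eq_neg_iff_add_eq_0)

lemma scaleC_diff_right: "c *\<^sub>C (x - y) = c *\<^sub>C x - c *\<^sub>C (y::'a::complex_vector)"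
  using scaleC_add_right[of c x "- y"] by simp

lemma scaleC_diff_left: "(c - d) *\<^sub>C x = c *\<^sub>C x - d *\<^sub>C (x::'a::complex_vector)"
  using scaleC_add_left[of c "- d" x] by (simp add: scaleC_minus_left)

lemma scaleC_minus_one: "(- 1) *\<^sub>C x = - (x::'a::complex_vector)"
  by (simp add: scaleC_minus_left)

lemma scaleC_cancel:
  assumes "c \<noteq> 0" "c *\<^sub>C x = c *\<^sub>C (y::'a::complex_vector)" shows "x = y"
proof -
  have "(1 / c) *\<^sub>C c *\<^sub>C x = (1 / c) *\<^sub>C c *\<^sub>C y" using assms by simp
  then have "(1 / c * c) *\<^sub>C x = (1 / c * c) *\<^sub>C y" by (simp only: scaleC_scaleC)
  then show ?thesis using assms(1) by simp
qed

lemmas scaleC_algebra = scaleC_add_right scaleC_add_left scaleC_diff_right scaleC_diff_left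
  scaleC_scaleC scaleC_minus_left

lemma cinner_add_right: "cinner x (y + z) = cinner x y + cinner (x::'a::complex_inner) z"
  by (metis cinner_commute cinner_add_left complex_cnj_add)

lemma cinner_scaleC_right: "cinner x (c *\<^sub>C y) = cnj c * cinner (x::'a::complex_inner) y"
  by (metis cinner_commute cinner_scaleC_left complex_cnj_mult)

lemma cinner_zero_left [simp]: "cinner 0 (x::'a::complex_inner) = 0"
  using cinner_scaleC_left[of 0 x x] by simp

lemma cinner_zero_right [simp]: "cinner (x::'a::complex_inner) 0 = 0"
  using cinner_scaleC_right[of x 0 x] by simp

lemma cinner_minus_left [simp]: "cinner (- x) (y::'a::complex_inner) = - cinner x y"
  using cinner_scaleC_left[of "-1" x y] by (simp add: scaleC_minus_one)

lemma cinner_minus_right [simp]: "cinner x (- y::'a::complex_inner) = - cinner x y"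
  using cinner_scaleC_right[of x "-1" y] by (simp add: scaleC_minus_one)

lemma cinner_diff_left: "cinner (x - y) (z::'a::complex_inner) = cinner x z - cinner y z"
  using cinner_add_left[of x "- y" z] by simp

lemma cinner_diff_right: "cinner x (y - z) = cinner x y - cinner (x::'a::complex_inner) z"
  using cinner_add_right[of x y "- z"] by simp

lemmas cinner_algebra = cinner_add_left cinner_add_right cinner_diff_left cinner_diff_right
  cinner_scaleC_left cinner_scaleC_right

lemma cinner_self: "cinner x x = of_real ((norm (x::'a::complex_inner))\<^sup>2)"
proof (rule complex_eqI)
  show "Re (cinner x x) = Re (of_real ((norm x)\<^sup>2))"
    by (simp add: inner_eq_Re_cinner[symmetric] dot_square_norm)
  have "Im (cinner x x) = Im (cnj (cinner x x))" using cinner_commute[of x x] by simp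
  then show "Im (cinner x x) = Im (of_real ((norm x)\<^sup>2))" by simp
qed

lemma norm_scaleC: "norm (c *\<^sub>C x) = cmod c * norm (x::'a::complex_inner)"
proof -
  have "of_real ((norm (c *\<^sub>C x))\<^sup>2) = (c * cnj c) * cinner x x"
    unfolding cinner_self[symmetric] by (simp add: cinner_algebra mult.assoc)
  also have "\<dots> = of_real ((cmod c * norm x)\<^sup>2)"
    by (simp add: cinner_self complex_norm_square[symmetric] power_mult_distrib)
  finally have "(norm (c *\<^sub>C x))\<^sup>2 = (cmod c * norm x)\<^sup>2" using of_real_eq_iff by blast
  then show ?thesis by (simp add: power2_eq_iff_nonneg)
qed

lemma cinner_extensionality:
  assumes "\<And>y. cinner x y = cinner x' (y::'a::complex_inner)" shows "x = x'"
proof -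
  have "cinner (x - x') (x - x') = 0" using assms by (simp add: cinner_algebra)
  then show ?thesis by (simp add: cinner_self)
qed

lemma cinner_extensionality_right:
  assumes "\<And>y. cinner y x = cinner (y::'a::complex_inner) x'" shows "x = x'"
  by (rule cinner_extensionality) (metis assms cinner_commute)

lemma cinner_cauchy: "cmod (cinner x y) \<le> norm x * norm (y::'a::complex_inner)"
proof -
  obtain t where t: "cmod t = 1" "of_real (cmod (cinner x y)) = t * cinner x y"
  proof (cases "cinner x y = 0")
    case True then show ?thesis by (intro that[of 1]) auto
  next
    case False
    then show ?thesis
      by (intro that[of "of_real (cmod (cinner x y)) / cinner x y"]) (auto simp: norm_divide)
  qed
  have "cmod (cinner x y) = Re (cinner (t *\<^sub>C x) y)"
    by (simp add: cinner_algebra t(2)[symmetric])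
  also have "\<dots> \<le> norm (t *\<^sub>C x) * norm y"
    unfolding inner_eq_Re_cinner[symmetric] by (rule norm_cauchy_schwarz)
  finally show ?thesis using t by (simp add: norm_scaleC)
qed

lemma bounded_bilinear_cinner: "bounded_bilinear (cinner :: 'a::complex_inner \<Rightarrow> 'a \<Rightarrow> complex)"
proof
  show "\<exists>K. \<forall>a b. norm (cinner a (b::'a)) \<le> norm a * norm b * K"
    by (intro exI[of _ 1]) (simp add: cinner_cauchy)
qed (auto simp: cinner_algebra scaleR_scaleC[where 'a='a] scaleR_conv_of_real)

lemma bounded_linear_scaleC: "bounded_linear (\<lambda>x::'a::complex_inner. c *\<^sub>C x)"
proof (rule bounded_linear_intro[of _ "cmod c"])
  show "c *\<^sub>C r *\<^sub>R x = r *\<^sub>R c *\<^sub>C x" for r and x :: 'a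
    by (simp add: scaleR_scaleC scaleC_scaleC mult.commute)
qed (auto simp: scaleC_add_right norm_scaleC mult.commute)

lemmas tendsto_cinner = bounded_bilinear.tendsto[OF bounded_bilinear_cinner]
lemmas tendsto_scaleC = bounded_linear.tendsto[OF bounded_linear_scaleC]

lemma cinner_prod_simp [simp]:
  "cinner (a, b) (c, d) = cinner a c + cinner (b::'b::chilbert_space) (d::'b)"
  for a c :: "'a::chilbert_space"
  by (simp add: cinner_prod_def)

lemma scaleC_prod_simp [simp]:
  "c *\<^sub>C (a, b) = (c *\<^sub>C a, c *\<^sub>C (b::'b::chilbert_space))" for a :: "'a::chilbert_space"
  by (simp add: scaleC_prod_def)

lemma norm_Pair_square: "(norm (a, b))\<^sup>2 = (norm a)\<^sup>2 + (norm b)\<^sup>2"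
  for a :: "'a::real_normed_vector" and b :: "'b::real_normed_vector"
  by (simp add: norm_prod_def)

text \<open>Functions must form a complex vector space before a set of functions such as H(K_S) can
  be the carrier of an \<open>hspace\<close>.\<close>

instantiation "fun" :: (type, complex_vector) complex_vector
begin

definition scaleR_fun :: "real \<Rightarrow> ('a \<Rightarrow> 'b) \<Rightarrow> 'a \<Rightarrow> 'b" where
  "scaleR_fun r f = (\<lambda>x. r *\<^sub>R f x)"

definition scaleC_fun :: "complex \<Rightarrow> ('a \<Rightarrow> 'b) \<Rightarrow> 'a \<Rightarrow> 'b" where
  "scaleC_fun c f = (\<lambda>x. c *\<^sub>C f x)"

instance
  by standard
    (auto simp: fun_eq_iff scaleR_fun_def scaleC_fun_def scaleR_scaleC
      scaleC_algebra algebra_simps)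

end

lemma scaleC_fun_apply [simp]: "(c *\<^sub>C f) x = c *\<^sub>C f x"
  by (simp add: scaleC_fun_def)

text \<open>The product type carries complex vector space operations only for arguments of class
  \<^class>\<open>chilbert_space\<close>, to which function types do not belong.\<close>

datatype ('a, 'b) dsum = DSum (dfst: 'a) (dsnd: 'b)

instantiation dsum :: (complex_vector, complex_vector) complex_vector
begin

definition "zero_dsum = DSum 0 0"
definition "plus_dsum p q = DSum (dfst p + dfst q) (dsnd p + dsnd q)"
definition "minus_dsum p q = DSum (dfst p - dfst q) (dsnd p - dsnd q)"
definition "uminus_dsum p = DSum (- dfst p) (- dsnd p)"
definition "scaleR_dsum r p = DSum (r *\<^sub>R dfst p) (r *\<^sub>R dsnd p)"
definition "scaleC_dsum c p = DSum (c *\<^sub>C dfst p) (c *\<^sub>C dsnd p)"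

instance
  by standard
    (auto simp: zero_dsum_def plus_dsum_def minus_dsum_def uminus_dsum_def scaleR_dsum_def
      scaleC_dsum_def scaleR_scaleC scaleC_algebra algebra_simps dsum.expand)

end

lemma dsum_sel [simp]:
  "dfst (p + q) = dfst p + dfst q" "dsnd (p + q) = dsnd p + dsnd q"
  "dfst (p - q) = dfst p - dfst q" "dsnd (p - q) = dsnd p - dsnd q"
  "dfst (c *\<^sub>C p) = c *\<^sub>C dfst p" "dsnd (c *\<^sub>C p) = c *\<^sub>C dsnd p"
  "dfst 0 = 0" "dsnd 0 = 0"
  by (simp_all add: zero_dsum_def plus_dsum_def minus_dsum_def scaleC_dsum_def)

section \<open>Hilbert spaces given by a carrier\<close>

text \<open>The function spaces, their orthogonal complements and closed subspaces of a type all
  occur as sets with an inner product, so Hilbert space theory is developed relative to a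
  carrier.\<close>

locale hspace =
  fixes H :: "'h::complex_vector set" and ip :: "'h \<Rightarrow> 'h \<Rightarrow> complex"
  assumes zero_mem [simp]: "0 \<in> H"
    and add_mem: "f \<in> H \<Longrightarrow> g \<in> H \<Longrightarrow> f + g \<in> H"
    and scale_mem: "f \<in> H \<Longrightarrow> c *\<^sub>C f \<in> H"
    and ip_add_left: "f \<in> H \<Longrightarrow> g \<in> H \<Longrightarrow> h \<in> H \<Longrightarrow> ip (f + g) h = ip f h + ip g h"
    and ip_scale_left: "f \<in> H \<Longrightarrow> h \<in> H \<Longrightarrow> ip (c *\<^sub>C f) h = c * ip f h"
    and ip_commute: "f \<in> H \<Longrightarrow> g \<in> H \<Longrightarrow> ip g f = cnj (ip f g)"
    and ip_pos: "f \<in> H \<Longrightarrow> f \<noteq> 0 \<Longrightarrow> 0 < Re (ip f f)"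
    and complete: "(\<And>n. F n \<in> H) \<Longrightarrow>
      (\<forall>e>0. \<exists>M. \<forall>m\<ge>M. \<forall>n\<ge>M. sqrt (Re (ip (F m - F n) (F m - F n))) < e) \<Longrightarrow>
      \<exists>f\<in>H. (\<lambda>n::nat. sqrt (Re (ip (F n - f) (F n - f)))) \<longlonglongrightarrow> 0"
begin

definition nm :: "'h \<Rightarrow> real" where "nm f = sqrt (Re (ip f f))"

lemma minus_mem: "f \<in> H \<Longrightarrow> - f \<in> H"
  using scale_mem[of f "-1"] by (simp add: scaleC_minus_one)

lemma diff_mem: "f \<in> H \<Longrightarrow> g \<in> H \<Longrightarrow> f - g \<in> H"
  using add_mem[of f "- g"] minus_mem by simp

lemmas mem = add_mem diff_mem scale_mem minus_mem

lemma ip_add_right: "f \<in> H \<Longrightarrow> g \<in> H \<Longrightarrow> h \<in> H \<Longrightarrow> ip h (f + g) = ip h f + ip h g"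
  by (metis add_mem complex_cnj_add ip_add_left ip_commute)

lemma ip_scale_right: "f \<in> H \<Longrightarrow> h \<in> H \<Longrightarrow> ip h (c *\<^sub>C f) = cnj c * ip h f"
  by (metis scale_mem complex_cnj_mult ip_scale_left ip_commute)

lemma ip_minus_left: "f \<in> H \<Longrightarrow> h \<in> H \<Longrightarrow> ip (- f) h = - ip f h"
  using ip_scale_left[of f h "-1"] by (simp add: scaleC_minus_one)

lemma ip_minus_right: "f \<in> H \<Longrightarrow> h \<in> H \<Longrightarrow> ip h (- f) = - ip h f"
  using ip_scale_right[of f h "-1"] by (simp add: scaleC_minus_one)

lemma ip_diff_left: "f \<in> H \<Longrightarrow> g \<in> H \<Longrightarrow> h \<in> H \<Longrightarrow> ip (f - g) h = ip f h - ip g h"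
  using ip_add_left[of f "- g" h] by (simp add: minus_mem ip_minus_left)

lemma ip_diff_right: "f \<in> H \<Longrightarrow> g \<in> H \<Longrightarrow> h \<in> H \<Longrightarrow> ip h (f - g) = ip h f - ip h g"
  using ip_add_right[of f "- g" h] by (simp add: minus_mem ip_minus_right)

lemma ip_zero [simp]: "f \<in> H \<Longrightarrow> ip 0 f = 0" "f \<in> H \<Longrightarrow> ip f 0 = 0"
  using ip_scale_left[of 0 f 0] ip_scale_right[of 0 f 0] by auto

lemmas ip_algebra = ip_add_left ip_add_right ip_diff_left ip_diff_right ip_scale_left ip_scale_right

lemma Re_ip_nonneg: "f \<in> H \<Longrightarrow> 0 \<le> Re (ip f f)"
  using ip_pos[of f] by (cases "f = 0") auto

lemma nm_nonneg [simp]: "f \<in> H \<Longrightarrow> 0 \<le> nm f"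
  by (simp add: nm_def Re_ip_nonneg)

lemma ip_self: "f \<in> H \<Longrightarrow> ip f f = of_real ((nm f)\<^sup>2)"
proof -
  assume f: "f \<in> H"
  have "Im (ip f f) = 0" using ip_commute[OF f f] by (metis complex_cnj_cancel_iff Im_complex_of_real
        Reals_cnj_iff complex_is_Real_iff)
  then show ?thesis using f by (simp add: nm_def Re_ip_nonneg complex_eq_iff)
qed

lemma nm_sq: "f \<in> H \<Longrightarrow> (nm f)\<^sup>2 = Re (ip f f)"
  by (simp add: ip_self)

lemma nm_zero [simp]: "nm 0 = 0"
  by (simp add: nm_def)

lemma nm_eq_0: "f \<in> H \<Longrightarrow> nm f = 0 \<longleftrightarrow> f = 0"
  using ip_pos[of f] by (cases "f = 0") (auto simp: nm_def)

lemma nm_scale: "f \<in> H \<Longrightarrow> nm (c *\<^sub>C f) = cmod c * nm f"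
proof -
  assume f: "f \<in> H"
  have "of_real ((nm (c *\<^sub>C f))\<^sup>2) = (c * cnj c) * ip f f"
    using f by (simp only: ip_self[symmetric] mem) (simp add: mem ip_algebra)
  also have "\<dots> = of_real ((cmod c * nm f)\<^sup>2)"
    using f by (simp add: ip_self complex_norm_square[symmetric] power_mult_distrib)
  finally have "(nm (c *\<^sub>C f))\<^sup>2 = (cmod c * nm f)\<^sup>2" using of_real_eq_iff by blast
  then show ?thesis using f by (simp add: power2_eq_iff_nonneg mem)
qed

lemma nm_minus_commute: "f \<in> H \<Longrightarrow> g \<in> H \<Longrightarrow> nm (f - g) = nm (g - f)"
  using nm_scale[of "f - g" "-1"] by (simp add: scaleC_minus_one mem)

lemma nm_add_sq:
  "f \<in> H \<Longrightarrow> g \<in> H \<Longrightarrow> (nm (f + g))\<^sup>2 = (nm f)\<^sup>2 + (nm g)\<^sup>2 + 2 * Re (ip f g)"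
  using ip_commute[of f g] by (simp add: nm_sq mem ip_algebra)

lemma nm_diff_sq:
  "f \<in> H \<Longrightarrow> g \<in> H \<Longrightarrow> (nm (f - g))\<^sup>2 = (nm f)\<^sup>2 + (nm g)\<^sup>2 - 2 * Re (ip f g)"
  using ip_commute[of f g] by (simp add: nm_sq mem ip_algebra)

lemma cauchy_schwarz: "f \<in> H \<Longrightarrow> g \<in> H \<Longrightarrow> cmod (ip f g) \<le> nm f * nm g"
proof (cases "g = 0")
  case False
  assume f: "f \<in> H" and g: "g \<in> H"
  \<comment> \<open>The multiple of \<open>g\<close> closest to \<open>f\<close>.\<close>
  define c where "c = ip f g / of_real ((nm g)\<^sup>2)"
  have ng: "nm g > 0" using False g nm_eq_0[of g] nm_nonneg[OF g] by linarith
  have "0 \<le> (nm (f - c *\<^sub>C g))\<^sup>2" by simp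
  also have "\<dots> = (nm f)\<^sup>2 + (cmod c * nm g)\<^sup>2 - 2 * Re (cnj c * ip f g)"
    using f g by (simp add: nm_diff_sq mem ip_algebra nm_scale)
  also have "cnj c * ip f g = of_real ((cmod (ip f g))\<^sup>2 / (nm g)\<^sup>2)"
    by (simp add: c_def complex_norm_square[symmetric] mult.commute[of "cnj _"])
  also have "(cmod c * nm g)\<^sup>2 = (cmod (ip f g))\<^sup>2 / (nm g)\<^sup>2"
    using ng by (simp add: c_def norm_divide norm_mult power2_eq_square)
  finally have "(cmod (ip f g))\<^sup>2 / (nm g)\<^sup>2 \<le> (nm f)\<^sup>2"
    by (simp only: Re_complex_of_real)
  then have "(cmod (ip f g))\<^sup>2 \<le> (nm f * nm g)\<^sup>2"
    using ng by (simp add: field_simps)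
  then show ?thesis using f g by (simp add: power2_le_iff_abs_le)
qed simp

lemma nm_triangle: "f \<in> H \<Longrightarrow> g \<in> H \<Longrightarrow> nm (f + g) \<le> nm f + nm g"
proof -
  assume f: "f \<in> H" and g: "g \<in> H"
  have "(nm (f + g))\<^sup>2 \<le> (nm f + nm g)\<^sup>2"
    using cauchy_schwarz[OF f g] complex_Re_le_cmod[of "ip f g"]
    by (simp add: nm_add_sq f g power2_sum)
  then show ?thesis using f g by (simp add: power2_le_iff_abs_le)
qed

lemma nm_triangle_diff: "f \<in> H \<Longrightarrow> g \<in> H \<Longrightarrow> h \<in> H \<Longrightarrow> nm (f - h) \<le> nm (f - g) + nm (g - h)"
  using nm_triangle[of "f - g" "g - h"] by (simp add: mem)

lemma complete':
  assumes "\<And>n. F n \<in> H" "\<And>e. e > 0 \<Longrightarrow> \<exists>M. \<forall>m\<ge>M. \<forall>n\<ge>M. nm (F m - F n) < e"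
  shows "\<exists>f\<in>H. (\<lambda>n::nat. nm (F n - f)) \<longlonglongrightarrow> 0"
  using complete[of F] assms unfolding nm_def by blast

lemma ip_tendsto:
  assumes "\<And>n. F n \<in> H" "f \<in> H" "g \<in> H" "(\<lambda>n::nat. nm (F n - f)) \<longlonglongrightarrow> 0"
  shows "(\<lambda>n. ip (F n) g) \<longlonglongrightarrow> ip f g"
proof -
  have 1: "(\<lambda>n. nm (F n - f) * nm g) \<longlonglongrightarrow> 0" using tendsto_mult_left_zero[OF assms(4)] .
  have 2: "\<forall>n. cmod (ip (F n) g - ip f g) \<le> nm (F n - f) * nm g"
    using cauchy_schwarz[of "F _ - f" g] assms(1-3) by (simp add: mem ip_diff_left)
  have "(\<lambda>n. ip (F n) g - ip f g) \<longlonglongrightarrow> 0"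
    by (rule Lim_null_comparison[OF always_eventually[OF 2] 1])
  then show ?thesis by (rule LIM_zero_cancel)
qed

text \<open>The Riesz theorem for a functional given as a linear relation, so that neither
  well-definedness nor closedness of the domain has to be checked first. The representing vector
  is the limit of any minimizing sequence of \<open>\<parallel>q\<parallel>\<^sup>2 - 2 Re c\<close>.\<close>

lemma riesz_relation:
  assumes Z: "\<And>q c. (q, c) \<in> Z \<Longrightarrow> q \<in> H" and ne: "(0, 0) \<in> Z"
    and add: "\<And>q c q' c'. (q, c) \<in> Z \<Longrightarrow> (q', c') \<in> Z \<Longrightarrow> (q + q', c + c') \<in> Z"
    and scale: "\<And>q c a. (q, c) \<in> Z \<Longrightarrow> (a *\<^sub>C q, a * c) \<in> Z"
    and bound: "\<And>q c. (q, c) \<in> Z \<Longrightarrow> cmod c \<le> B * nm q" and B: "0 \<le> B"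
  obtains g where "g \<in> H" "nm g \<le> B" "\<And>q c. (q, c) \<in> Z \<Longrightarrow> ip q g = c"
    "\<And>f. f \<in> H \<Longrightarrow> (\<And>q c. (q, c) \<in> Z \<Longrightarrow> ip f q = 0) \<Longrightarrow> ip f g = 0"
proof -
  define \<phi> where "\<phi> = (\<lambda>(q, c). (nm q)\<^sup>2 - 2 * Re c)"
  have low: "- B\<^sup>2 \<le> \<phi> z" if "z \<in> Z" for z
  proof -
    obtain q c where z: "z = (q, c)" by (cases z)
    have "Re c \<le> B * nm q" using bound[of q c] that z complex_Re_le_cmod[of c] by auto
    moreover have "0 \<le> (nm q - B)\<^sup>2" by simp
    ultimately show ?thesis by (simp add: z \<phi>_def power2_diff algebra_simps)
  qed
  define m where "m = Inf (\<phi> ` Z)"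
  have bdd: "bdd_below (\<phi> ` Z)" using low by (intro bdd_belowI2)
  have m: "m \<le> \<phi> z" if "z \<in> Z" for z unfolding m_def using bdd that by (rule cINF_lower)
  have "\<exists>z\<in>Z. \<phi> z < m + 1 / real (Suc n)" for n
    using cInf_lessD[of "\<phi> ` Z" "m + 1 / real (Suc n)"] ne by (auto simp: m_def)
  then obtain z where z: "\<And>n. z n \<in> Z" "\<And>n. \<phi> (z n) < m + 1 / real (Suc n)" by metis
  define Q C where "Q n = fst (z n)" and "C n = snd (z n)" for n
  have zn: "z n = (Q n, C n)" for n by (simp add: Q_def C_def)
  have Q: "Q n \<in> H" for n using Z[of "Q n" "C n"] z(1)[of n] by (simp add: zn)
  \<comment> \<open>The midpoint of two elements of \<open>Z\<close> lies in \<open>Z\<close>, so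
    its value is at least \<open>m\<close>; the parallelogram law turns this into a bound on the
    distance.\<close>
  have par: "(nm (Q k - Q n))\<^sup>2 \<le> 2 * (1 / real (Suc k) + 1 / real (Suc n))" for k n
  proof -
    have "((1/2) *\<^sub>C (Q k + Q n), (1/2) * (C k + C n)) \<in> Z"
      using z(1)[of k] z(1)[of n] by (intro scale add) (auto simp: zn)
    then have "m \<le> (nm ((1/2) *\<^sub>C (Q k + Q n)))\<^sup>2 - Re (C k + C n)"
      using m[of "((1/2) *\<^sub>C (Q k + Q n), (1/2) * (C k + C n))"] by (simp add: \<phi>_def add_divide_distrib)
    also have "(nm ((1/2) *\<^sub>C (Q k + Q n)))\<^sup>2 = (nm (Q k + Q n))\<^sup>2 / 4"
      using Q by (simp add: nm_scale mem power_mult_distrib power2_eq_square norm_divide)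
    finally have "4 * m \<le> (nm (Q k + Q n))\<^sup>2 - 4 * Re (C k + C n)" by simp
    moreover have "(nm (Q k + Q n))\<^sup>2 + (nm (Q k - Q n))\<^sup>2 = 2 * (nm (Q k))\<^sup>2 + 2 * (nm (Q n))\<^sup>2"
      using Q by (simp add: nm_add_sq nm_diff_sq)
    moreover have "(nm (Q k))\<^sup>2 - 2 * Re (C k) < m + 1 / real (Suc k)"
      "(nm (Q n))\<^sup>2 - 2 * Re (C n) < m + 1 / real (Suc n)"
      using z(2)[of k] z(2)[of n] by (auto simp: zn \<phi>_def)
    ultimately show ?thesis by (simp add: algebra_simps)
  qed
  have "\<exists>M. \<forall>k\<ge>M. \<forall>n\<ge>M. nm (Q k - Q n) < e" if e: "e > 0" for e
  proof -
    obtain M where M: "4 / e\<^sup>2 < real (Suc M)" by (meson lt_ex reals_Archimedean2 less_trans of_nat_less_iff lessI)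
    have "nm (Q k - Q n) < e" if "k \<ge> M" "n \<ge> M" for k n
    proof -
      have "1 / real (Suc k) \<le> 1 / real (Suc M)" "1 / real (Suc n) \<le> 1 / real (Suc M)"
        using that by (auto simp: field_simps)
      then have "2 * (1 / real (Suc k) + 1 / real (Suc n)) \<le> 2 * (1 / real (Suc M) + 1 / real (Suc M))"
        by (intro mult_left_mono add_mono) auto
      then have "(nm (Q k - Q n))\<^sup>2 \<le> 4 * (1 / real (Suc M))"
        using order_trans[OF par[of k n]] by simp
      also have "\<dots> < e\<^sup>2" using M e by (simp add: field_simps)
      finally show ?thesis using e by (simp add: power2_less_imp_less)
    qed
    then show ?thesis by blast
  qed
  then obtain g where g: "g \<in> H" "(\<lambda>n. nm (Q n - g)) \<longlonglongrightarrow> 0"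
    using complete'[of Q] Q by blast
  have Re_eq: "Re (ip g q) = Re c" if qc: "(q, c) \<in> Z" for q c
  proof -
    have q: "q \<in> H" using Z qc .
    \<comment> \<open>First variation: moving \<open>Q n\<close> by \<open>t q\<close> cannot push
      the value below \<open>m\<close>. In the limit this is a quadratic inequality in
      \<open>t\<close> without constant term, so its linear coefficient has to vanish.\<close>
    have key: "0 \<le> 2 * t * (Re (ip g q) - Re c) + t\<^sup>2 * (nm q)\<^sup>2" for t :: real
    proof -
      have 1: "0 \<le> 1 / real (Suc n) + (2 * t * (Re (ip (Q n) q) - Re c) + t\<^sup>2 * (nm q)\<^sup>2)" for n
      proof -
        have "(Q n + of_real t *\<^sub>C q, C n + of_real t * c) \<in> Z"
          using z(1)[of n] qc by (intro add scale) (auto simp: zn)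
        then have "m \<le> (nm (Q n + of_real t *\<^sub>C q))\<^sup>2 - 2 * Re (C n + of_real t * c)"
          using m by (fastforce simp: \<phi>_def)
        also have "\<dots> = \<phi> (z n) + (2 * t * (Re (ip (Q n) q) - Re c) + t\<^sup>2 * (nm q)\<^sup>2)"
          using Q q by (simp add: zn \<phi>_def nm_add_sq mem nm_scale ip_algebra power_mult_distrib
              algebra_simps)
        finally show ?thesis using z(2)[of n] by linarith
      qed
      have "(\<lambda>n. 1 / real (Suc n) + (2 * t * (Re (ip (Q n) q) - Re c) + t\<^sup>2 * (nm q)\<^sup>2))
        \<longlonglongrightarrow> 0 + (2 * t * (Re (ip g q) - Re c) + t\<^sup>2 * (nm q)\<^sup>2)"
        using ip_tendsto[OF Q g(1) q g(2)]
        by (intro tendsto_intros LIMSEQ_Suc[OF lim_1_over_n])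
      from LIMSEQ_le_const[OF this] show ?thesis using 1 by auto
    qed
    define d where "d = Re (ip g q) - Re c"
    have "d = 0"
    proof (rule ccontr)
      assume d: "d \<noteq> 0"
      \<comment> \<open>Since \<open>s\<close> exceeds the leading coefficient,
        \<open>t = - d / s\<close> makes the quadratic negative; the summand 1 keeps
        \<open>s\<close> positive when \<open>q = 0\<close>.\<close>
      define s where "s = 1 + (nm q)\<^sup>2"
      have s: "s > 0" "(nm q)\<^sup>2 < s" by (auto simp: s_def add_pos_nonneg)
      have "0 \<le> 2 * (- d / s) * d + (- d / s)\<^sup>2 * (nm q)\<^sup>2" using key[of "- d / s"] by (simp add: d_def)
      also have "\<dots> = (d\<^sup>2 / s) * ((nm q)\<^sup>2 / s - 2)"
        using s by (simp add: power2_eq_square field_simps)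
      also have "\<dots> < 0" using d s by (intro mult_pos_neg) (auto simp: field_simps)
      finally show False by simp
    qed
    then show ?thesis by (simp add: d_def)
  qed
  \<comment> \<open>Only real parts have been compared; applying the result to \<i> times
    \<open>q\<close> supplies the imaginary part.\<close>
  have eq: "ip q g = c" if qc: "(q, c) \<in> Z" for q c
  proof -
    have q: "q \<in> H" using Z qc .
    have "Im (ip g q) = - Im c"
      using Re_eq[OF scale[OF qc, of \<i>]] q g by (simp add: ip_algebra)
    then show ?thesis using Re_eq[OF qc] ip_commute[OF g(1) q] by (simp add: complex_eq_iff)
  qed
  have orth: "ip f g = 0" if f: "f \<in> H" "\<And>q c. (q, c) \<in> Z \<Longrightarrow> ip f q = 0" for f
  proof -
    have "ip (Q n) f = 0" for n
      using f(2)[of "Q n" "C n"] z(1)[of n] ip_commute[OF f(1) Q[of n]] by (simp add: zn)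
    then have "(\<lambda>n. 0) \<longlonglongrightarrow> ip g f" using ip_tendsto[OF Q g(1) f(1) g(2)] by simp
    then have "ip g f = 0" by (simp add: LIMSEQ_const_iff)
    then show ?thesis using ip_commute[OF g(1) f(1)] by simp
  qed
  have "nm g \<le> B"
  proof -
    \<comment> \<open>\<open>ip (Q n) g\<close> is \<open>C n\<close>, which \<open>bound\<close>
      controls by \<open>nm (Q n)\<close>; the limit leaves
      \<open>nm g * nm g \<le> B * nm g\<close>.\<close>
    have 1: "(nm g)\<^sup>2 \<le> B * nm (Q n - g) + B * nm g + nm (Q n - g) * nm g" for n
    proof -
      have "(nm g)\<^sup>2 = Re (ip (Q n) g) - Re (ip (Q n - g) g)"
        using Q g by (simp add: nm_sq ip_algebra)
      also have "\<dots> \<le> B * nm (Q n) + nm (Q n - g) * nm g"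
        using bound[of "Q n" "C n"] z(1)[of n] eq[of "Q n" "C n"] complex_Re_le_cmod[of "ip (Q n) g"]
          cauchy_schwarz[of "Q n - g" g] abs_Re_le_cmod[of "ip (Q n - g) g"] Q g
        by (simp add: zn mem)
      also have "B * nm (Q n) \<le> B * (nm (Q n - g) + nm g)"
        using nm_triangle[of "Q n - g" g] Q g B by (intro mult_left_mono) (simp_all add: mem)
      finally show ?thesis by (simp add: algebra_simps)
    qed
    have "(\<lambda>n. B * nm (Q n - g) + B * nm g + nm (Q n - g) * nm g) \<longlonglongrightarrow> B * 0 + B * nm g + 0 * nm g"
      by (intro tendsto_intros g(2))
    from LIMSEQ_le_const[OF this, of "(nm g)\<^sup>2"] have "nm g * nm g \<le> B * nm g"
      using 1 by (auto simp: power2_eq_square)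
    then show ?thesis using B nm_nonneg[OF g(1)] by (cases "nm g = 0") auto
  qed
  then show ?thesis using that g(1) eq orth by blast
qed

lemma riesz:
  assumes "\<And>f g. f \<in> H \<Longrightarrow> g \<in> H \<Longrightarrow> \<phi> (f + g) = \<phi> f + \<phi> g"
    "\<And>f c. f \<in> H \<Longrightarrow> \<phi> (c *\<^sub>C f) = c * \<phi> f" "\<And>f. f \<in> H \<Longrightarrow> cmod (\<phi> f) \<le> B * nm f" "0 \<le> B"
  obtains g where "g \<in> H" "\<And>f. f \<in> H \<Longrightarrow> ip f g = \<phi> f" "nm g \<le> B"
proof -
  have \<phi>0: "\<phi> 0 = 0" using assms(2)[of 0 0] by simp
  show ?thesis
    by (rule riesz_relation[of "(\<lambda>f. (f, \<phi> f)) ` H" B]) (use assms \<phi>0 that in \<open>auto simp: image_iff mem\<close>)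
qed

lemma banach_fixpoint:
  assumes A: "\<And>f. f \<in> H \<Longrightarrow> A f \<in> H" and r: "0 \<le> r" "r < 1"
    and lip: "\<And>f g. f \<in> H \<Longrightarrow> g \<in> H \<Longrightarrow> nm (A f - A g) \<le> r * nm (f - g)"
  obtains f where "f \<in> H" "A f = f"
proof -
  define F where "F n = (A ^^ n) 0" for n
  have F: "F n \<in> H" for n by (induction n) (auto simp: F_def A)
  have FS: "F (Suc n) = A (F n)" for n by (simp add: F_def)
  have 1: "nm (F (Suc n) - F n) \<le> r ^ n * nm (F 1)" for n
  proof (induction n)
    case 0 then show ?case by (simp add: F_def)
  next
    case (Suc n)
    have "nm (F (Suc (Suc n)) - F (Suc n)) \<le> r * nm (F (Suc n) - F n)"
      unfolding FS by (intro lip F[unfolded FS] A F)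
    also have "\<dots> \<le> r * (r ^ n * nm (F 1))" by (rule mult_left_mono[OF Suc r(1)])
    finally show ?case by simp
  qed
  define K where "K = nm (F 1) / (1 - r)"
  have K: "0 \<le> K" using r F by (simp add: K_def)
  \<comment> \<open>\<open>K\<close> is the sum of the geometric series of step lengths; keeping the
    factor \<open>1 - r ^ k\<close> of the partial sum makes the induction close.\<close>
  have 2: "nm (F (n + k) - F n) \<le> r ^ n * (1 - r ^ k) * K" for n k
  proof (induction k)
    case 0 then show ?case by simp
  next
    case (Suc k)
    have "nm (F (n + Suc k) - F n) \<le> nm (F (Suc (n + k)) - F (n + k)) + nm (F (n + k) - F n)"
      using nm_triangle_diff[OF F F F] by simp
    also have "\<dots> \<le> r ^ (n + k) * nm (F 1) + r ^ n * (1 - r ^ k) * K" using 1 Suc add_mono by blast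
    also have "nm (F 1) = (1 - r) * K" using r by (simp add: K_def)
    finally show ?case by (simp add: algebra_simps power_add)
  qed
  have 3: "nm (F m - F n) \<le> r ^ min m n * K" for m n
  proof -
    have "nm (F (n + k) - F n) \<le> r ^ n * K" for n k
    proof -
      have "r ^ n * (1 - r ^ k) \<le> r ^ n * 1" using r by (intro mult_left_mono) auto
      then have "r ^ n * (1 - r ^ k) * K \<le> r ^ n * K" using K by (intro mult_right_mono) auto
      then show ?thesis using 2[of n k] by linarith
    qed
    from this[of n "m - n"] this[of m "n - m"] show ?thesis
      using nm_minus_commute[OF F F, of m n] by (cases "n \<le> m") (auto simp: min_def)
  qed
  have "\<exists>M. \<forall>m\<ge>M. \<forall>n\<ge>M. nm (F m - F n) < e" if e: "e > 0" for e
  proof -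
    obtain M where M: "r ^ M * (K + 1) < e"
    proof -
      have "(\<lambda>n. r ^ n * (K + 1)) \<longlonglongrightarrow> 0 * (K + 1)"
        using r by (intro tendsto_intros LIMSEQ_realpow_zero) auto
      then have "eventually (\<lambda>n. r ^ n * (K + 1) < e) sequentially"
        using e order_tendstoD(2) by fastforce
      then show ?thesis using that by (auto simp: eventually_sequentially)
    qed
    have "nm (F m - F n) < e" if "m \<ge> M" "n \<ge> M" for m n
    proof -
      have "r ^ min m n \<le> r ^ M" using that r by (intro power_decreasing) auto
      then have "r ^ min m n * K \<le> r ^ M * (K + 1)" using K r by (intro mult_mono) auto
      then show ?thesis using 3[of m n] M by linarith
    qed
    then show ?thesis by blast
  qed
  then obtain f where f: "f \<in> H" "(\<lambda>n. nm (F n - f)) \<longlonglongrightarrow> 0" using complete'[of F] F by blast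
  have 4: "nm (A f - f) \<le> r * nm (F n - f) + nm (F (Suc n) - f)" for n
    using nm_triangle_diff[of "A f" "F (Suc n)" f] lip[OF F f(1), of n] F f
      nm_minus_commute[of "A f" "A (F n)"] by (simp add: A FS)
  have "(\<lambda>n. r * nm (F n - f) + nm (F (Suc n) - f)) \<longlonglongrightarrow> r * 0 + 0"
    by (intro tendsto_intros f(2) LIMSEQ_Suc[OF f(2)])
  from LIMSEQ_le_const[OF this, of "nm (A f - f)"] have "nm (A f - f) \<le> 0" using 4 by auto
  then have "A f = f" using nm_nonneg[of "A f - f"] nm_eq_0[of "A f - f"] A[of f] f(1)
    by (simp add: diff_mem antisym)
  then show ?thesis using that f by blast
qed

end

text \<open>Pairs of finite linear combinations with the same coefficients: the graph of the linear
  map from \<open>\<kappa>1 i\<close> to \<open>\<kappa>2 i\<close> before it is known to be well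
  defined. For equal families it is the diagonal of the span.\<close>

inductive_set lin_pairs :: "('i \<Rightarrow> 'a::complex_vector) \<Rightarrow> ('i \<Rightarrow> 'b::complex_vector) \<Rightarrow> ('a \<times> 'b) set"
  for \<kappa>1 \<kappa>2 where
  zero: "(0, 0) \<in> lin_pairs \<kappa>1 \<kappa>2"
| step: "(p, q) \<in> lin_pairs \<kappa>1 \<kappa>2 \<Longrightarrow> (p + a *\<^sub>C \<kappa>1 i, q + a *\<^sub>C \<kappa>2 i) \<in> lin_pairs \<kappa>1 \<kappa>2"

lemma lin_pairs_gen: "(\<kappa>1 i, \<kappa>2 i) \<in> lin_pairs \<kappa>1 \<kappa>2"
  using lin_pairs.step[OF lin_pairs.zero, where a = 1] by simp

lemma lin_pairs_add:
  assumes "(p, q) \<in> lin_pairs \<kappa>1 \<kappa>2" "(p', q') \<in> lin_pairs \<kappa>1 \<kappa>2"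
  shows "(p + p', q + q') \<in> lin_pairs \<kappa>1 \<kappa>2"
  using assms(2)
proof induction
  case zero then show ?case using assms(1) by simp
next
  case (step p' q' a i)
  from lin_pairs.step[OF step.IH, of a i] show ?case by (simp add: add.assoc)
qed

lemma lin_pairs_scale:
  assumes "(p, q) \<in> lin_pairs \<kappa>1 \<kappa>2" shows "(c *\<^sub>C p, c *\<^sub>C q) \<in> lin_pairs \<kappa>1 \<kappa>2"
  using assms
proof induction
  case zero then show ?case by (simp add: lin_pairs.zero)
next
  case (step p q a i)
  from lin_pairs.step[OF step.IH, of "c * a" i] show ?case
    by (simp add: scaleC_add_right scaleC_scaleC)
qed

text \<open>Two families with the same Gram matrix are related by a partial isometry, which maps \<open>f\<close>
  to the element \<open>g\<close> of the closed span of the second family.\<close>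

lemma gram_transfer:
  fixes \<kappa>1 :: "'i \<Rightarrow> 'a::complex_vector" and \<kappa>2 :: "'i \<Rightarrow> 'b::complex_vector"
  assumes H1: "hspace H1 ip1" and H2: "hspace H2 ip2"
    and \<kappa>1: "\<And>i. \<kappa>1 i \<in> H1" and \<kappa>2: "\<And>i. \<kappa>2 i \<in> H2"
    and gram: "\<And>i k. ip1 (\<kappa>1 i) (\<kappa>1 k) = ip2 (\<kappa>2 i) (\<kappa>2 k)"
    and f: "f \<in> H1"
  obtains g where "g \<in> H2" "hspace.nm ip2 g \<le> hspace.nm ip1 f"
    "\<And>i. ip2 g (\<kappa>2 i) = ip1 f (\<kappa>1 i)"
    "\<And>h. h \<in> H2 \<Longrightarrow> (\<And>i. ip2 h (\<kappa>2 i) = 0) \<Longrightarrow> ip2 h g = 0"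
proof -
  interpret A: hspace H1 ip1 by (rule H1)
  interpret B: hspace H2 ip2 by (rule H2)
  define L where "L = lin_pairs \<kappa>1 \<kappa>2"
  have mem: "p \<in> H1 \<and> q \<in> H2" if "(p, q) \<in> L" for p q
    using that unfolding L_def by induction (auto simp: A.mem B.mem \<kappa>1 \<kappa>2)
  have g1: "ip1 p (\<kappa>1 k) = ip2 q (\<kappa>2 k)" if "(p, q) \<in> L" for p q k
    using that unfolding L_def
  proof induction
    case zero then show ?case by (simp add: \<kappa>1 \<kappa>2)
  next
    case (step p q a i)
    then show ?case using mem[unfolded L_def, of p q]
      by (simp add: A.ip_algebra B.ip_algebra A.mem B.mem \<kappa>1 \<kappa>2 gram)
  qed
  have g2: "ip1 p p' = ip2 q q'" if "(p, q) \<in> L" "(p', q') \<in> L" for p q p' q'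
    using that(2) unfolding L_def
  proof induction
    case zero then show ?case using mem[OF that(1)] by simp
  next
    case (step p' q' a i)
    then show ?case using mem[unfolded L_def, of p' q'] mem[OF that(1)] g1[OF that(1), of i]
      by (simp add: A.ip_algebra B.ip_algebra A.mem B.mem \<kappa>1 \<kappa>2)
  qed
  \<comment> \<open>The functional sends a combination of the second family to the product of
    \<open>f\<close> with the same combination of the first. Equal Gram matrices make
    \<open>p\<close> and \<open>q\<close> equally long, which gives the bound needed for the Riesz
    theorem.\<close>
  define Z where "Z = {(q, ip1 p f) | p q. (p, q) \<in> L}"
  obtain g where g: "g \<in> H2" "B.nm g \<le> A.nm f" "\<And>q c. (q, c) \<in> Z \<Longrightarrow> ip2 q g = c"
    "\<And>h. h \<in> H2 \<Longrightarrow> (\<And>q c. (q, c) \<in> Z \<Longrightarrow> ip2 h q = 0) \<Longrightarrow> ip2 h g = 0"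
  proof (rule B.riesz_relation[of Z "A.nm f"])
    show "q \<in> H2" if "(q, c) \<in> Z" for q c using that mem by (auto simp: Z_def)
    show "(0, 0) \<in> Z" using f by (auto simp: Z_def L_def intro!: exI[of _ 0] lin_pairs.zero)
    show "(q + q', c + c') \<in> Z" if qc: "(q, c) \<in> Z" "(q', c') \<in> Z" for q c q' c'
    proof -
      obtain p p' where p: "(p, q) \<in> L" "c = ip1 p f" "(p', q') \<in> L" "c' = ip1 p' f"
        using qc by (auto simp: Z_def)
      then have "(p + p', q + q') \<in> L" unfolding L_def by (intro lin_pairs_add)
      moreover have "c + c' = ip1 (p + p') f" using p mem f by (simp add: A.ip_algebra)
      ultimately show ?thesis by (auto simp: Z_def)
    qed
    show "(a *\<^sub>C q, a * c) \<in> Z" if qc: "(q, c) \<in> Z" for q c a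
    proof -
      obtain p where p: "(p, q) \<in> L" "c = ip1 p f" using qc by (auto simp: Z_def)
      then have "(a *\<^sub>C p, a *\<^sub>C q) \<in> L" unfolding L_def by (intro lin_pairs_scale)
      moreover have "a * c = ip1 (a *\<^sub>C p) f" using p mem f by (simp add: A.ip_algebra)
      ultimately show ?thesis by (auto simp: Z_def)
    qed
    show "cmod c \<le> A.nm f * B.nm q" if qc: "(q, c) \<in> Z" for q c
    proof -
      obtain p where p: "(p, q) \<in> L" "c = ip1 p f" using qc by (auto simp: Z_def)
      have "A.nm p = B.nm q" using g2[OF p(1) p(1)] by (simp add: A.nm_def B.nm_def)
      then show ?thesis using A.cauchy_schwarz[of p f] p mem f by (simp add: mult.commute)
    qed
    show "0 \<le> A.nm f" using f by simp
  qed blast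
  show ?thesis
  proof (rule that[OF g(1,2)])
    show "ip2 g (\<kappa>2 i) = ip1 f (\<kappa>1 i)" for i
    proof -
      have "(\<kappa>2 i, ip1 (\<kappa>1 i) f) \<in> Z" unfolding Z_def L_def using lin_pairs_gen[of \<kappa>1 i \<kappa>2] by auto
      from g(3)[OF this] show ?thesis
        by (simp add: A.ip_commute[OF \<kappa>1 f, of i] B.ip_commute[OF \<kappa>2 g(1), of i])
    qed
    show "ip2 h g = 0" if h: "h \<in> H2" "\<And>i. ip2 h (\<kappa>2 i) = 0" for h
    proof (rule g(4)[OF h(1)])
      fix q c assume "(q, c) \<in> Z"
      then obtain p where "(p, q) \<in> L" by (auto simp: Z_def)
      then show "ip2 h q = 0" unfolding L_def
      proof induction
        case zero then show ?case using h(1) by simp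
      next
        case (step p q a i)
        then show ?case using mem[unfolded L_def, of p q] h
          by (simp add: B.ip_algebra B.mem \<kappa>2)
      qed
    qed
  qed
qed

section \<open>Subspaces, direct sums and reproducing kernel spaces\<close>

definition csubspace :: "'a::complex_vector set \<Rightarrow> bool" where
  "csubspace X \<longleftrightarrow> 0 \<in> X \<and> (\<forall>a\<in>X. \<forall>b\<in>X. a + b \<in> X) \<and> (\<forall>c. \<forall>a\<in>X. c *\<^sub>C a \<in> X)"

lemma csubspace_mem:
  assumes "csubspace X"
  shows "0 \<in> X" "a \<in> X \<Longrightarrow> b \<in> X \<Longrightarrow> a + b \<in> X" "a \<in> X \<Longrightarrow> c *\<^sub>C a \<in> X"
    "a \<in> X \<Longrightarrow> b \<in> X \<Longrightarrow> a - b \<in> X"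
proof -
  show "a \<in> X \<Longrightarrow> b \<in> X \<Longrightarrow> a - b \<in> X"
    using assms unfolding csubspace_def by (metis diff_conv_add_uminus scaleC_minus_one)
qed (use assms in \<open>auto simp: csubspace_def\<close>)

lemma csubspace_UNIV [simp]: "csubspace UNIV"
  by (simp add: csubspace_def)

lemma hspace_closed:
  fixes X :: "'a::chilbert_space set"
  assumes "csubspace X" "closed X" shows "hspace X cinner"
proof
  show "0 < Re (cinner f f)" if "f \<noteq> 0" for f :: 'a using that by (simp add: cinner_self)
  show "cinner g f = cnj (cinner f g)" for f g :: 'a by (rule cinner_commute)
  fix F :: "nat \<Rightarrow> 'a" assume F: "\<And>n. F n \<in> X"
    and C: "\<forall>e>0. \<exists>M. \<forall>m\<ge>M. \<forall>n\<ge>M. sqrt (Re (cinner (F m - F n) (F m - F n))) < e"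
  have "Cauchy F" using C unfolding Cauchy_def dist_norm by (simp add: cinner_self)
  then obtain f where f: "F \<longlonglongrightarrow> f" using Cauchy_convergent_iff convergent_def by blast
  then have "f \<in> X" using assms(2) F closed_sequentially by blast
  moreover have "(\<lambda>n. sqrt (Re (cinner (F n - f) (F n - f)))) \<longlonglongrightarrow> 0"
    using tendsto_norm_zero[OF LIM_zero[OF f]] by (simp add: cinner_self)
  ultimately show "\<exists>f\<in>X. (\<lambda>n. sqrt (Re (cinner (F n - f) (F n - f)))) \<longlonglongrightarrow> 0" by blast
qed (use csubspace_mem[OF assms(1)] in \<open>auto simp: cinner_algebra\<close>)

lemma nm_cinner: "hspace.nm cinner (a::'a::chilbert_space) = norm a"
  using hspace.nm_def[OF hspace_closed[OF csubspace_UNIV closed_UNIV], of a]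
  by (simp add: cinner_self)

definition ip_dsum :: "('a \<Rightarrow> 'a \<Rightarrow> complex) \<Rightarrow> ('b \<Rightarrow> 'b \<Rightarrow> complex) \<Rightarrow>
  ('a, 'b) dsum \<Rightarrow> ('a, 'b) dsum \<Rightarrow> complex" where
  "ip_dsum ip1 ip2 p q = ip1 (dfst p) (dfst q) + ip2 (dsnd p) (dsnd q)"

lemma hspace_dsum:
  assumes H1: "hspace H1 ip1" and H2: "hspace H2 ip2"
  shows "hspace {p. dfst p \<in> H1 \<and> dsnd p \<in> H2} (ip_dsum ip1 ip2)"
proof -
  interpret A: hspace H1 ip1 by (rule H1)
  interpret B: hspace H2 ip2 by (rule H2)
  let ?H = "{p. dfst p \<in> H1 \<and> dsnd p \<in> H2}"
  let ?nm = "\<lambda>p. sqrt (Re (ip_dsum ip1 ip2 p p))"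
  have nm: "?nm p = sqrt ((A.nm (dfst p))\<^sup>2 + (B.nm (dsnd p))\<^sup>2)" if "p \<in> ?H" for p
    using that by (simp add: ip_dsum_def A.nm_sq B.nm_sq)
  show ?thesis
  proof
    show "0 < Re (ip_dsum ip1 ip2 f f)" if f: "f \<in> ?H" "f \<noteq> 0" for f
    proof -
      have "dfst f \<noteq> 0 \<or> dsnd f \<noteq> 0" using f(2) by (cases f) (auto simp: zero_dsum_def)
      then show ?thesis
        using f(1) A.ip_pos[of "dfst f"] B.ip_pos[of "dsnd f"] A.Re_ip_nonneg[of "dfst f"]
          B.Re_ip_nonneg[of "dsnd f"]
        by (auto simp: ip_dsum_def add_pos_nonneg add_nonneg_pos)
    qed
    show "ip_dsum ip1 ip2 g f = cnj (ip_dsum ip1 ip2 f g)" if "f \<in> ?H" "g \<in> ?H" for f g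
      using that A.ip_commute[of "dfst f" "dfst g"] B.ip_commute[of "dsnd f" "dsnd g"]
      by (simp add: ip_dsum_def)
  next
    fix F :: "nat \<Rightarrow> _" assume F: "\<And>n. F n \<in> ?H"
      and C: "\<forall>e>0. \<exists>M. \<forall>m\<ge>M. \<forall>n\<ge>M. ?nm (F m - F n) < e"
    have FD: "F m - F n \<in> ?H" for m n using F by (simp add: A.mem B.mem)
    have le: "A.nm (dfst p) \<le> ?nm p" "B.nm (dsnd p) \<le> ?nm p" if "p \<in> ?H" for p
      using that by (simp_all add: nm real_le_rsqrt)
    have "\<exists>f\<in>H1. (\<lambda>n. A.nm (dfst (F n) - f)) \<longlonglongrightarrow> 0"
      using F C le(1)[OF FD] by (intro A.complete') (auto, meson le_less_trans)
    then obtain f where f: "f \<in> H1" "(\<lambda>n. A.nm (dfst (F n) - f)) \<longlonglongrightarrow> 0" by blast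
    have "\<exists>f\<in>H2. (\<lambda>n. B.nm (dsnd (F n) - f)) \<longlonglongrightarrow> 0"
      using F C le(2)[OF FD] by (intro B.complete') (auto, meson le_less_trans)
    then obtain g where g: "g \<in> H2" "(\<lambda>n. B.nm (dsnd (F n) - g)) \<longlonglongrightarrow> 0" by blast
    have "?nm (F n - DSum f g) = sqrt ((A.nm (dfst (F n) - f))\<^sup>2 + (B.nm (dsnd (F n) - g))\<^sup>2)" for n
      using F f g by (subst nm) (auto simp: A.mem B.mem)
    moreover have "(\<lambda>n. sqrt ((A.nm (dfst (F n) - f))\<^sup>2 + (B.nm (dsnd (F n) - g))\<^sup>2)) \<longlonglongrightarrow> sqrt (0\<^sup>2 + 0\<^sup>2)"
      by (intro tendsto_intros f g)
    ultimately show "\<exists>f\<in>?H. (\<lambda>n. ?nm (F n - f)) \<longlonglongrightarrow> 0"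
      using f g by (intro bexI[of _ "DSum f g"]) auto
  qed (auto simp: A.mem B.mem A.ip_algebra B.ip_algebra ip_dsum_def algebra_simps)
qed

lemma hspace_subset:
  assumes "hspace H ip" and "0 \<in> H'" "H' \<subseteq> H"
    and "\<And>f g. f \<in> H' \<Longrightarrow> g \<in> H' \<Longrightarrow> f + g \<in> H'" "\<And>c f. f \<in> H' \<Longrightarrow> c *\<^sub>C f \<in> H'"
    and cl: "\<And>F f. (\<And>n. F n \<in> H') \<Longrightarrow> f \<in> H \<Longrightarrow> (\<lambda>n::nat. hspace.nm ip (F n - f)) \<longlonglongrightarrow> 0 \<Longrightarrow> f \<in> H'"
  shows "hspace H' ip"
proof -
  interpret hspace H ip by fact
  show ?thesis
  proof
    fix F :: "nat \<Rightarrow> _" assume F: "\<And>n. F n \<in> H'"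
      and C: "\<forall>e>0. \<exists>M. \<forall>m\<ge>M. \<forall>n\<ge>M. sqrt (Re (ip (F m - F n) (F m - F n))) < e"
    then obtain f where f: "f \<in> H" "(\<lambda>n. sqrt (Re (ip (F n - f) (F n - f)))) \<longlonglongrightarrow> 0"
      using complete[of F] assms(3) by blast
    then show "\<exists>f\<in>H'. (\<lambda>n. sqrt (Re (ip (F n - f) (F n - f)))) \<longlonglongrightarrow> 0"
      using cl[of F f] F unfolding nm_def by blast
  next
    show "ip g f = cnj (ip f g)" if "f \<in> H'" "g \<in> H'" for f g using that assms(3) ip_commute by blast
  qed (use assms(2,4,5) subsetD[OF assms(3)] in \<open>simp_all add: ip_algebra ip_pos\<close>)
qed

lemma hspace_rkhs:
  assumes "is_rkhs K H ip" shows "hspace H ip"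
proof -
  note a = assms[unfolded is_rkhs_def]
  note zero = a[THEN conjunct2, THEN conjunct1]
  note add = a[THEN conjunct2, THEN conjunct2, THEN conjunct1]
  note scale = a[THEN conjunct2, THEN conjunct2, THEN conjunct2, THEN conjunct1]
  note ip_add = a[THEN conjunct2, THEN conjunct2, THEN conjunct2, THEN conjunct2, THEN conjunct1]
  note ip_scale = a[THEN conjunct2, THEN conjunct2, THEN conjunct2, THEN conjunct2, THEN conjunct2, THEN conjunct1]
  note ip_comm = a[THEN conjunct2, THEN conjunct2, THEN conjunct2, THEN conjunct2, THEN conjunct2, THEN conjunct2, THEN conjunct1]
  note ip_pos = a[THEN conjunct2, THEN conjunct2, THEN conjunct2, THEN conjunct2, THEN conjunct2, THEN conjunct2, THEN conjunct2, THEN conjunct1]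
  note compl = a[THEN conjunct2, THEN conjunct2, THEN conjunct2, THEN conjunct2, THEN conjunct2, THEN conjunct2, THEN conjunct2, THEN conjunct2, THEN conjunct1]
  show ?thesis
  proof
    show "0 \<in> H" using zero by (simp add: zero_fun_def)
    show "f + g \<in> H" if "f \<in> H" "g \<in> H" for f g using add that by (simp add: plus_fun_def)
    show "c *\<^sub>C f \<in> H" if "f \<in> H" for f c using scale that by (simp add: scaleC_fun_def)
    show "ip (f + g) h = ip f h + ip g h" if "f \<in> H" "g \<in> H" "h \<in> H" for f g h
      using ip_add that by (simp add: plus_fun_def)
    show "ip (c *\<^sub>C f) h = c * ip f h" if "f \<in> H" "h \<in> H" for f h c
      using ip_scale that by (simp add: scaleC_fun_def)
    show "ip g f = cnj (ip f g)" if "f \<in> H" "g \<in> H" for f g using ip_comm that by blast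
    show "0 < Re (ip f f)" if "f \<in> H" "f \<noteq> 0" for f using ip_pos that by (simp add: zero_fun_def)
    show "\<exists>f\<in>H. (\<lambda>n::nat. sqrt (Re (ip (F n - f) (F n - f)))) \<longlonglongrightarrow> 0"
      if F: "\<And>n. F n \<in> H" and C: "\<forall>e>0. \<exists>M. \<forall>m\<ge>M. \<forall>n\<ge>M. sqrt (Re (ip (F m - F n) (F m - F n))) < e" for F
    proof -
      from compl[rule_format, of F] F C show ?thesis by (simp add: rk_norm_def fun_diff_def)
    qed
  qed
qed

lemma nm_rk_norm: "hspace H ip \<Longrightarrow> hspace.nm ip = rk_norm ip"
  by (simp add: fun_eq_iff hspace.nm_def rk_norm_def)

section \<open>Bounded operators\<close>

lemma bounded_clinear_bounded_linear: "bounded_clinear f \<Longrightarrow> bounded_linear f"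
  by (simp add: bounded_clinear_def)

lemma bounded_clinear_simps:
  assumes "bounded_clinear f"
  shows "f (x + y) = f x + f y" "f (x - y) = f x - f y" "f (c *\<^sub>C x) = c *\<^sub>C f x" "f 0 = 0"
  using assms linear_simps[of f] unfolding bounded_clinear_def by auto

lemma bounded_clinearI:
  assumes "\<And>x y. f (x + y) = f x + f y" "\<And>c x. f (c *\<^sub>C x) = c *\<^sub>C f x" "\<And>x. norm (f x) \<le> norm x * K"
  shows "bounded_clinear f"
  unfolding bounded_clinear_def
  using assms by (auto intro!: bounded_linear_intro[of f K] simp: scaleR_scaleC)

lemma cadjoint:
  fixes f :: "'a::chilbert_space \<Rightarrow> 'b::chilbert_space"
  assumes "bounded_clinear f" shows "cinner (f x) y = cinner x (cadjoint f y)"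
proof -
  interpret X: hspace "UNIV :: 'a set" cinner by (rule hspace_closed) simp_all
  obtain K where K: "K > 0" "\<And>x. norm (f x) \<le> norm x * K"
    using bounded_linear.pos_bounded[OF bounded_clinear_bounded_linear[OF assms]] by blast
  have "\<exists>g. \<forall>x. cinner (f x) y = cinner x g" for y
  proof (rule X.riesz[of "\<lambda>x. cinner (f x) y" "K * norm y"])
    show "cmod (cinner (f x) y) \<le> K * norm y * X.nm x" for x
    proof -
      have "cmod (cinner (f x) y) \<le> norm (f x) * norm y" by (rule cinner_cauchy)
      also have "\<dots> \<le> norm x * K * norm y" by (intro mult_right_mono K) auto
      finally show ?thesis by (simp add: nm_cinner algebra_simps)
    qed
  qed (use K in \<open>auto simp: bounded_clinear_simps[OF assms] cinner_algebra\<close>, metis)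
  then obtain g where g: "\<And>x y. cinner (f x) y = cinner x (g y)" by metis
  have "\<forall>x y. cinner (f x) y = cinner x (cadjoint f y)"
    unfolding cadjoint_def
  proof (rule theI[of _ g])
    fix h assume h: "\<forall>x y. cinner (f x) y = cinner x (h y)"
    show "h = g"
    proof
      fix y show "h y = g y" by (rule cinner_extensionality_right) (metis g h)
    qed
  qed (simp add: g)
  then show ?thesis by blast
qed

text \<open>The projection of \<open>x\<close> is the vector of \<open>X\<close> that represents the
  functional \<open>cinner _ x\<close> restricted to \<open>X\<close>.\<close>

lemma projection:
  fixes X :: "'a::chilbert_space set"
  assumes "csubspace X" "closed X"
  obtains p where "p \<in> X" "\<And>m. m \<in> X \<Longrightarrow> cinner (x - p) m = 0"
proof -
  interpret X: hspace X cinner using assms by (rule hspace_closed)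
  obtain p where p: "p \<in> X" "\<And>f. f \<in> X \<Longrightarrow> cinner f p = cinner f x"
    by (rule X.riesz[of "\<lambda>f. cinner f x" "norm x"])
      (auto simp: cinner_algebra nm_cinner intro!: order_trans[OF cinner_cauchy])
  show ?thesis
  proof (rule that[OF p(1)])
    fix m assume "m \<in> X"
    then have "cinner m (x - p) = 0" using p by (simp add: cinner_algebra)
    then show "cinner (x - p) m = 0" by (metis cinner_commute complex_cnj_zero)
  qed
qed

lemma csubspace_closure:
  fixes X :: "'a::chilbert_space set"
  assumes "csubspace X" shows "csubspace (closure X)"
proof -
  have "a + b \<in> closure X" if ab: "a \<in> closure X" "b \<in> closure X" for a b
  proof -
    obtain f g where "\<forall>n. f n \<in> X" "f \<longlonglongrightarrow> a" "\<forall>n. g n \<in> X" "g \<longlonglongrightarrow> b"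
      using ab unfolding closure_sequential by blast
    then show ?thesis unfolding closure_sequential
      by (intro exI[of _ "\<lambda>n. f n + g n"]) (auto intro: csubspace_mem[OF assms] tendsto_add)
  qed
  moreover have "c *\<^sub>C a \<in> closure X" if a: "a \<in> closure X" for a c
  proof -
    obtain f where "\<forall>n. f n \<in> X" "f \<longlonglongrightarrow> a"
      using a unfolding closure_sequential by blast
    then show ?thesis unfolding closure_sequential
      by (intro exI[of _ "\<lambda>n. c *\<^sub>C f n"]) (auto intro: csubspace_mem[OF assms] tendsto_scaleC)
  qed
  ultimately show ?thesis
    using csubspace_mem(1)[OF assms] closure_subset[of X] by (auto simp: csubspace_def)
qed

lemma csubspace_range:
  assumes "bounded_clinear f" shows "csubspace (range f)"
proof -
  have "0 \<in> range f" by (metis bounded_clinear_simps(4)[OF assms] rangeI)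
  moreover have "f x + f y \<in> range f" "c *\<^sub>C f x \<in> range f" for x y c
    by (metis bounded_clinear_simps(1,3)[OF assms] rangeI)+
  ultimately show ?thesis unfolding csubspace_def by blast
qed

lemma orthogonal_closure:
  fixes a :: "'a::chilbert_space"
  assumes "\<And>m. m \<in> X \<Longrightarrow> cinner a m = 0" "m \<in> closure X" shows "cinner a m = 0"
proof -
  obtain f where f: "\<forall>n. f n \<in> X" "f \<longlonglongrightarrow> m"
    using assms(2) unfolding closure_sequential by blast
  then have "(\<lambda>n. cinner a (f n)) \<longlonglongrightarrow> cinner a m" by (intro tendsto_cinner tendsto_const)
  moreover have "cinner a (f n) = 0" for n using assms(1) f by blast
  ultimately show ?thesis by (simp add: LIMSEQ_const_iff)
qed

lemma closure_eq_UNIV: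
  fixes X :: "'a::chilbert_space set"
  assumes "csubspace X" "\<And>a. (\<And>m. m \<in> X \<Longrightarrow> cinner a m = 0) \<Longrightarrow> a = 0"
  shows "closure X = UNIV"
proof -
  have "a \<in> closure X" for a
  proof -
    obtain p where p: "p \<in> closure X" "\<And>m. m \<in> closure X \<Longrightarrow> cinner (a - p) m = 0"
      by (rule projection[of "closure X" a]) (auto simp: csubspace_closure assms)
    then have "a - p = 0" by (intro assms(2)) (use closure_subset in blast)
    then show ?thesis using p by simp
  qed
  then show ?thesis by blast
qed

text \<open>Needed because analytic output pairs and the range condition on \<open>M_F\<close> are
  given vector by vector, whereas adjoints require operator bounds. By Baire, some closed set
  \<open>A n\<close> contains a ball.\<close>

lemma uniform_boundedness:
  fixes f :: "'i \<Rightarrow> 'a::chilbert_space \<Rightarrow> 'b::real_normed_vector"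
  assumes lin: "\<And>i. i \<in> I \<Longrightarrow> bounded_linear (f i)"
    and pt: "\<And>x. \<exists>B. \<forall>i\<in>I. norm (f i x) \<le> B"
  obtains C where "C \<ge> 0" "\<And>i x. i \<in> I \<Longrightarrow> norm (f i x) \<le> C * norm x"
proof -
  define A where "A n = {x. \<forall>i\<in>I. norm (f i x) \<le> real n}" for n :: nat
  have cl: "closed (A n)" for n
  proof -
    have "A n = (\<Inter>i\<in>I. {x. norm (f i x) \<le> real n})" by (auto simp: A_def)
    moreover have "closed {x. norm (f i x) \<le> real n}" if "i \<in> I" for i
      by (intro closed_Collect_le continuous_intros
          bounded_linear.continuous_on[OF lin[OF that]])
    ultimately show ?thesis by auto
  qed
  have un: "\<Union>(range A) = UNIV"
  proof -
    have "x \<in> \<Union>(range A)" for x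
    proof -
      obtain B where "\<forall>i\<in>I. norm (f i x) \<le> B" using pt by blast
      moreover obtain n where "B \<le> real n" using real_arch_simple by blast
      ultimately show ?thesis by (auto simp: A_def intro: order_trans)
    qed
    then show ?thesis by blast
  qed
  have "\<exists>n. interior (A n) \<noteq> {}"
  proof (rule ccontr)
    assume "\<not> (\<exists>n. interior (A n) \<noteq> {})"
    then have "Met_TC.mtopology interior_of (\<Union>(range A)) = {}"
      by (intro Met_TC.metric_Baire_category_alt) (auto simp: cl mcomplete_iff_complete complete_UNIV)
    then show False by (simp add: un)
  qed
  then obtain n x0 e where e: "e > 0" "cball x0 e \<subseteq> A n"
    by (metis all_not_in_conv mem_interior_cball)
  show ?thesis
  proof (rule that[of "2 * real n / e"])
    show "0 \<le> 2 * real n / e" using e by simp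
    fix i x assume i: "i \<in> I"
    interpret bounded_linear "f i" by (rule lin[OF i])
    show "norm (f i x) \<le> 2 * real n / e * norm x"
    proof (cases "x = 0")
      case False
      \<comment> \<open>Rescaling \<open>x\<close> to length \<open>e\<close> keeps
        \<open>x0 + v\<close> in the ball; the factor 2 comes from subtracting the value at the
        centre.\<close>
      define v where "v = (e / norm x) *\<^sub>R x"
      have "x0 + v \<in> A n" "x0 \<in> A n" using e False by (auto simp: v_def dist_norm intro!: subsetD[OF e(2)])
      then have "norm (f i (x0 + v)) \<le> real n" "norm (f i x0) \<le> real n" using i by (auto simp: A_def)
      then have "norm (f i v) \<le> 2 * real n"
        using norm_triangle_ineq4[of "f i (x0 + v)" "f i x0"] by (simp add: add)
      then show ?thesis using False e by (simp add: v_def scaleR field_simps)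
    qed (simp add: zero)
  qed
qed

section \<open>Contractive colligations\<close>

text \<open>An error bound uniform in \<open>u\<close> and linear in the distance of
  \<open>w\<close> and \<open>z\<close> bounds the operator norm of the error, so no operator norm
  has to be computed for transfer functions.\<close>

lemma op_holomorphic_diskI:
  assumes S: "\<And>z. z \<in> \<bbbD> \<Longrightarrow> bounded_clinear (S z)"
    and D: "\<And>z. z \<in> \<bbbD> \<Longrightarrow> \<exists>L C \<delta>. \<delta> > 0 \<and> C \<ge> 0 \<and> bounded_clinear L \<and>
      (\<forall>w\<in>\<bbbD>. w \<noteq> z \<and> cmod (w - z) < \<delta> \<longrightarrow>
        (\<forall>u. norm ((1 / (w - z)) *\<^sub>C (S w u - S z u) - L u) \<le> C * cmod (w - z) * norm u))"
  shows "op_holomorphic_disk S"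
  unfolding op_holomorphic_disk_def
proof
  fix z :: complex assume z: "z \<in> \<bbbD>"
  obtain L C \<delta> where L: "\<delta> > 0" "C \<ge> 0" "bounded_clinear L"
    "\<And>w u. w \<in> \<bbbD> \<Longrightarrow> w \<noteq> z \<Longrightarrow> cmod (w - z) < \<delta> \<Longrightarrow>
        norm ((1 / (w - z)) *\<^sub>C (S w u - S z u) - L u) \<le> C * cmod (w - z) * norm u"
    using D[OF z] by blast
  let ?f = "\<lambda>w u. (1 / (w - z)) *\<^sub>C (S w u - S z u) - L u"
  have "eventually (\<lambda>w. w \<in> \<bbbD> \<inter> ball z \<delta>) (at z)"
    using z L(1) by (intro eventually_at_topological[THEN iffD2] exI[of _ "\<bbbD> \<inter> ball z \<delta>"]) auto
  moreover have "eventually (\<lambda>w. w \<noteq> z) (at z)" by (rule eventually_neq_at_within)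
  ultimately have ev: "eventually (\<lambda>w. norm (onorm (?f w)) \<le> C * cmod (w - z)) (at z)"
  proof eventually_elim
    case (elim w)
    then have w: "w \<in> \<bbbD>" "w \<noteq> z" "cmod (w - z) < \<delta>" by (auto simp: dist_norm norm_minus_commute)
    have "bounded_linear (?f w)"
      by (intro bounded_linear_sub bounded_linear_compose[OF bounded_linear_scaleC]
          bounded_clinear_bounded_linear S w z L)
    from onorm_pos_le[OF this] show ?case
      using onorm_bound[of "C * cmod (w - z)" "?f w", OF _ L(4)[OF w]] L(2) by simp
  qed
  have "((\<lambda>w. C * cmod (w - z)) \<longlongrightarrow> C * cmod (z - z)) (at z)"
    by (intro tendsto_intros)
  then have "((\<lambda>w. onorm (?f w)) \<longlongrightarrow> 0) (at z)"
    by (intro Lim_null_comparison[OF ev]) simp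
  then show "\<exists>L. bounded_clinear L \<and>
      ((\<lambda>w. onorm (\<lambda>u. (1 / (w - z)) *\<^sub>C (S w u - S z u) - L u)) \<longlongrightarrow> 0) (at z)"
    using L(3) by blast
qed

text \<open>\<open>W k d k' e\<close> says that the colligation takes the state \<open>k\<close> and the input \<open>d\<close> to the state
  \<open>k'\<close> and the output \<open>e\<close>. Its transfer function \<open>tf\<close> and observability map \<open>obs\<close> are read off
  the fixed points of the feedback \<open>k = z k' + p\<close>.\<close>

locale colligation = hspace H ip
  for H :: "'h::complex_vector set" and ip +
  fixes W :: "'h \<Rightarrow> 'd::chilbert_space \<Rightarrow> 'h \<Rightarrow> 'e::chilbert_space \<Rightarrow> bool"
  assumes W_mem: "W k d k' e \<Longrightarrow> k \<in> H \<and> k' \<in> H"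
    and W_lin: "W k d k' e \<Longrightarrow> W l c l' b \<Longrightarrow>
      W (k + a *\<^sub>C l) (d + a *\<^sub>C c) (k' + a *\<^sub>C l') (e + a *\<^sub>C b)"
    and W_total: "k \<in> H \<Longrightarrow> \<exists>k' e. W k d k' e"
    and W_contr: "W k d k' e \<Longrightarrow> (nm k')\<^sup>2 + (norm e)\<^sup>2 \<le> (nm k)\<^sup>2 + (norm d)\<^sup>2"
begin

lemma W_zero: "W 0 0 0 0"
proof -
  obtain k' e where 1: "W 0 0 k' e" using W_total by fastforce
  have "(nm k')\<^sup>2 + (norm e)\<^sup>2 \<le> 0" using W_contr[OF 1] by simp
  then have "nm k' = 0" "e = 0" by (simp_all only: sum_power2_le_zero_iff norm_eq_zero)
  then show ?thesis using 1 nm_eq_0[of k'] W_mem[OF 1] by simp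
qed

lemma W_add: "W k d k' e \<Longrightarrow> W l c l' b \<Longrightarrow> W (k + l) (d + c) (k' + l') (e + b)"
  using W_lin[of k d k' e l c l' b 1] by simp

lemma W_diff: "W k d k' e \<Longrightarrow> W l c l' b \<Longrightarrow> W (k - l) (d - c) (k' - l') (e - b)"
  using W_lin[of k d k' e l c l' b "-1"] by (simp add: scaleC_minus_one)

lemma W_scale: "W k d k' e \<Longrightarrow> W (a *\<^sub>C k) (a *\<^sub>C d) (a *\<^sub>C k') (a *\<^sub>C e)"
  using W_lin[OF W_zero, of k d k' e a] by simp

lemma W_out: assumes "W k d k' e" shows "norm e \<le> nm k + norm d" "nm k' \<le> nm k + norm d"
proof -
  have "0 \<le> nm k" "0 \<le> nm k'" using W_mem[OF assms] by auto
  then have "(norm e)\<^sup>2 \<le> (nm k + norm d)\<^sup>2" "(nm k')\<^sup>2 \<le> (nm k + norm d)\<^sup>2"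
    using W_contr[OF assms] zero_le_power2[of "norm e"] zero_le_power2[of "nm k'"]
      mult_nonneg_nonneg[of "nm k" "norm d"] norm_ge_zero[of d]
    unfolding power2_sum by linarith+
  then show "norm e \<le> nm k + norm d" "nm k' \<le> nm k + norm d"
    using \<open>0 \<le> nm k\<close> by (auto intro: power2_le_imp_le)
qed

lemma feedback_bound:
  assumes "W (z *\<^sub>C k + p) d k e" "p \<in> H" "cmod z < 1"
  shows "(1 - cmod z) * nm k \<le> nm p + norm d"
proof -
  have k: "k \<in> H" using W_mem[OF assms(1)] by blast
  have "nm k \<le> nm (z *\<^sub>C k + p) + norm d" by (rule W_out[OF assms(1)])
  also have "nm (z *\<^sub>C k + p) \<le> cmod z * nm k + nm p"
    using nm_triangle[of "z *\<^sub>C k" p] k assms by (simp add: mem nm_scale)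
  finally show ?thesis by (simp add: algebra_simps)
qed

lemma feedback_unique:
  assumes "W (z *\<^sub>C k + p) d k e" "W (z *\<^sub>C l + p) d l b" "cmod z < 1"
  shows "k = l" "e = b"
proof -
  have m: "k \<in> H" "l \<in> H" using W_mem assms by blast+
  have 1: "W (z *\<^sub>C (k - l) + 0) 0 (k - l) (e - b)"
    using W_diff[OF assms(1,2)] by (simp add: scaleC_diff_right)
  have "(1 - cmod z) * nm (k - l) \<le> 0" using feedback_bound[OF 1] assms(3) by simp
  then have "nm (k - l) = 0" using m assms(3) nm_nonneg[of "k - l"]
    by (simp add: mult_le_0_iff mem antisym)
  then show kl: "k = l" using m nm_eq_0[of "k - l"] by (simp add: mem)
  show "e = b" using W_out(1)[OF 1] kl by simp
qed

text \<open>One step of the colligation does not increase differences of states, and the factor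
  \<open>z\<close> makes the loop map a strict contraction.\<close>

lemma feedback_exists:
  assumes p: "p \<in> H" and z: "cmod z < 1" obtains k e where "W (z *\<^sub>C k + p) d k e"
proof -
  have "\<exists>k' e. W (z *\<^sub>C k + p) d k' e" if "k \<in> H" for k using W_total that p by (simp add: mem)
  then obtain A b where A: "\<And>k. k \<in> H \<Longrightarrow> W (z *\<^sub>C k + p) d (A k) (b k)" by metis
  obtain k where k: "k \<in> H" "A k = k"
  proof (rule banach_fixpoint[of A "cmod z"])
    show "A f \<in> H" if "f \<in> H" for f using W_mem[OF A[OF that]] by blast
    show "nm (A f - A g) \<le> cmod z * nm (f - g)" if "f \<in> H" "g \<in> H" for f g
      using W_out(2)[OF W_diff[OF A[OF that(1)] A[OF that(2)]]] that
      by (simp add: scaleC_diff_right[symmetric] nm_scale mem)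
  qed (use z in auto)
  then show ?thesis using A[of k] that by simp
qed

text \<open>Writing \<open>W k d k' e\<close> as k' = A k + B d and e = C k + D d, the fixed point
  is (I - z A)^{-1} B d, so that \<open>tf z\<close> is D + z C (I - z A)^{-1} B.\<close>

definition state :: "complex \<Rightarrow> 'd \<Rightarrow> 'h" where
  "state z d = (SOME k. \<exists>e. W (z *\<^sub>C k) d k e)"

definition tf :: "complex \<Rightarrow> 'd \<Rightarrow> 'e" where
  "tf z d = (SOME e. W (z *\<^sub>C state z d) d (state z d) e)"

text \<open>The loop is driven by a source \<open>p\<close> in the state instead of an input. Its
  fixed point is (I - z A)^{-1} A p, so \<open>obs p z\<close> is C (I - z A)^{-1} p; the value 0
  off the disk follows the convention for function spaces.\<close>

definition ostate :: "'h \<Rightarrow> complex \<Rightarrow> 'h" where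
  "ostate p z = (SOME k. \<exists>e. W (z *\<^sub>C k + p) 0 k e)"

definition obs :: "'h \<Rightarrow> complex \<Rightarrow> 'e" where
  "obs p z = (if z \<in> \<bbbD> then (SOME e. W (z *\<^sub>C ostate p z + p) 0 (ostate p z) e) else 0)"

lemma tf: "z \<in> \<bbbD> \<Longrightarrow> W (z *\<^sub>C state z d) d (state z d) (tf z d)"
proof -
  assume z: "z \<in> \<bbbD>"
  have "\<exists>k e. W (z *\<^sub>C k) d k e" using feedback_exists[of 0 z d thesis for thesis] z by (metis add.right_neutral mem_ball_0 zero_mem)
  then have "\<exists>e. W (z *\<^sub>C state z d) d (state z d) e"
    unfolding state_def by (rule someI_ex)
  then show ?thesis unfolding tf_def by (rule someI_ex)
qed

lemma obs: "z \<in> \<bbbD> \<Longrightarrow> p \<in> H \<Longrightarrow> W (z *\<^sub>C ostate p z + p) 0 (ostate p z) (obs p z)"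
proof -
  assume z: "z \<in> \<bbbD>" and p: "p \<in> H"
  have "\<exists>k e. W (z *\<^sub>C k + p) 0 k e" using feedback_exists[OF p, of z 0] z by (metis mem_ball_0)
  then have "\<exists>e. W (z *\<^sub>C ostate p z + p) 0 (ostate p z) e"
    unfolding ostate_def by (rule someI_ex)
  then show ?thesis using z unfolding obs_def by simp (rule someI_ex)
qed

lemma tf_eq: "z \<in> \<bbbD> \<Longrightarrow> W (z *\<^sub>C k) d k e \<Longrightarrow> state z d = k \<and> tf z d = e"
  using feedback_unique[of z "state z d" 0 d "tf z d" k e] tf[of z d] by auto

lemma obs_eq: "z \<in> \<bbbD> \<Longrightarrow> W (z *\<^sub>C k + p) 0 k e \<Longrightarrow> p \<in> H \<Longrightarrow> ostate p z = k \<and> obs p z = e"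
  using feedback_unique[OF obs, of z p k e] by auto

lemma state_mem: "z \<in> \<bbbD> \<Longrightarrow> state z d \<in> H"
  using tf W_mem by blast

lemma ostate_mem: "z \<in> \<bbbD> \<Longrightarrow> p \<in> H \<Longrightarrow> ostate p z \<in> H"
  using obs W_mem by blast

lemma tf_linear:
  assumes z: "z \<in> \<bbbD>"
  shows "state z (d + c) = state z d + state z c" "tf z (d + c) = tf z d + tf z c"
    "state z (a *\<^sub>C d) = a *\<^sub>C state z d" "tf z (a *\<^sub>C d) = a *\<^sub>C tf z d"
  using tf_eq[OF z, of "state z d + state z c" "d + c" "tf z d + tf z c"]
    W_add[OF tf[OF z, of d] tf[OF z, of c]]
    tf_eq[OF z, of "a *\<^sub>C state z d" "a *\<^sub>C d" "a *\<^sub>C tf z d"] W_scale[OF tf[OF z, of d], of a]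
  by (auto simp: scaleC_algebra mult.commute)

lemma obs_add:
  assumes z: "z \<in> \<bbbD>" and p: "p \<in> H" and q: "q \<in> H"
  shows "obs (p + q) z = obs p z + obs q z"
  using obs_eq[OF z, of "ostate p z + ostate q z" "p + q" "obs p z + obs q z"]
    W_add[OF obs[OF z p] obs[OF z q]] p q
  by (auto simp: scaleC_add_right mem add_ac)

lemma obs_scale:
  assumes z: "z \<in> \<bbbD>" and p: "p \<in> H" shows "obs (a *\<^sub>C p) z = a *\<^sub>C obs p z"
  using obs_eq[OF z, of "a *\<^sub>C ostate p z" "a *\<^sub>C p" "a *\<^sub>C obs p z"] W_scale[OF obs[OF z p], of a] p
  by (auto simp: scaleC_algebra mult.commute mem)

lemma tf_contr: "z \<in> \<bbbD> \<Longrightarrow> norm (tf z d) \<le> norm d"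
proof -
  assume z: "z \<in> \<bbbD>"
  have "(cmod z * nm (state z d))\<^sup>2 \<le> (nm (state z d))\<^sup>2"
    using z state_mem[OF z, of d] by (intro power_mono mult_left_le_one_le) auto
  then have "(norm (tf z d))\<^sup>2 \<le> (norm d)\<^sup>2"
    using W_contr[OF tf[OF z, of d], unfolded nm_scale[OF state_mem[OF z]]] by linarith
  then show ?thesis by (rule power2_le_imp_le) simp
qed

lemma state_bound: "z \<in> \<bbbD> \<Longrightarrow> nm (state z d) \<le> norm d / (1 - cmod z)"
  using feedback_bound[of z "state z d" 0 d "tf z d"] tf[of z d] by (simp add: field_simps)

lemma ostate_bound: "z \<in> \<bbbD> \<Longrightarrow> p \<in> H \<Longrightarrow> nm (ostate p z) \<le> nm p / (1 - cmod z)"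
  using feedback_bound[OF obs] by (simp add: field_simps)

lemma obs_bound:
  assumes z: "z \<in> \<bbbD>" and p: "p \<in> H" shows "norm (obs p z) \<le> (1 / (1 - cmod z) + 1) * nm p"
proof -
  have m: "ostate p z \<in> H" by (rule ostate_mem[OF z p])
  have "norm (obs p z) \<le> nm (z *\<^sub>C ostate p z + p)" using W_out(1)[OF obs[OF z p]] by simp
  also have "\<dots> \<le> cmod z * nm (ostate p z) + nm p"
    using nm_triangle[of "z *\<^sub>C ostate p z" p] m p by (simp add: mem nm_scale)
  also have "\<dots> \<le> 1 * nm (ostate p z) + nm p" using z m by (intro add_mono mult_right_mono) auto
  also have "\<dots> \<le> nm p / (1 - cmod z) + nm p" using ostate_bound[OF z p] by simp
  finally show ?thesis by (simp add: algebra_simps)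
qed

lemma tf_clinear: "z \<in> \<bbbD> \<Longrightarrow> bounded_clinear (tf z)"
  by (rule bounded_clinearI[of _ 1]) (simp_all add: tf_linear tf_contr)

text \<open>The derivative of D + z C (I - z A)^{-1} B is C (I - z A)^{-2} B, that is,
  \<open>obs\<close> applied to \<open>state\<close>. The remainder of the difference quotient of
  states solves a feedback equation whose source is of the order of \<open>w - z\<close>.\<close>

lemma tf_schur: "tf \<in> schur_class"
proof -
  have "op_holomorphic_disk tf"
  proof (rule op_holomorphic_diskI[OF tf_clinear])
    fix z :: complex assume z: "z \<in> \<bbbD>"
    define s where "s = 1 - cmod z"
    have s: "s > 0" using z by (simp add: s_def)
    define L where "L d = obs (state z d) z" for d
    define \<kappa> where "\<kappa> d = ostate (state z d) z" for d
    \<comment> \<open>The source has length at most \<open>t\<close>, the remainder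
      \<open>\<rho>\<close> at most \<open>2 / s * t\<close> as long as \<open>w\<close> is within
      \<open>s / 2\<close> of \<open>z\<close>, and the output at most their sum; \<open>t\<close>
      contains the factor \<open>1 / s\<^sup>2\<close>.\<close>
    define C where "C = 2 / s ^ 3 + 1 / s\<^sup>2"
    have \<kappa>: "\<kappa> d \<in> H" "W (z *\<^sub>C \<kappa> d + state z d) 0 (\<kappa> d) (L d)" for d
      using obs[OF z] state_mem[OF z] ostate_mem[OF z] by (auto simp: \<kappa>_def L_def)
    have \<kappa>_bound: "nm (\<kappa> d) \<le> norm d / s\<^sup>2" for d
    proof -
      have "nm (\<kappa> d) \<le> nm (state z d) / s"
        using ostate_bound[OF z state_mem[OF z]] by (simp add: \<kappa>_def s_def)
      also have "\<dots> \<le> (norm d / s) / s" using state_bound[OF z, of d] s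
        by (intro divide_right_mono) (auto simp: s_def)
      finally show ?thesis by (simp add: power2_eq_square)
    qed
    have "bounded_clinear L"
    proof (rule bounded_clinearI)
      show "norm (L d) \<le> norm d * ((1 / s + 1) / s)" for d
      proof -
        have "norm (L d) \<le> (1 / s + 1) * nm (state z d)"
          unfolding L_def s_def by (rule obs_bound[OF z state_mem[OF z]])
        also have "\<dots> \<le> (1 / s + 1) * (norm d / s)"
          using state_bound[OF z, of d] s by (intro mult_left_mono) (auto simp: s_def)
        finally show ?thesis by (simp add: mult.commute)
      qed
    qed (use z in \<open>simp_all add: L_def tf_linear obs_add obs_scale state_mem\<close>)
    moreover have "norm ((1 / (w - z)) *\<^sub>C (tf w d - tf z d) - L d) \<le> C * cmod (w - z) * norm d"
      if w: "w \<in> \<bbbD>" "w \<noteq> z" "cmod (w - z) < s / 2" for w d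
    proof -
      define c where "c = 1 / (w - z)"
      define \<rho> where "\<rho> = c *\<^sub>C (state w d - state z d) - \<kappa> d"
      have c: "c * (w - z) = 1" using w by (simp add: c_def)
      have \<rho>: "\<rho> \<in> H" using \<kappa> state_mem z w by (simp add: \<rho>_def mem)
      have "W (c *\<^sub>C (w *\<^sub>C state w d - z *\<^sub>C state z d) - (z *\<^sub>C \<kappa> d + state z d)) (c *\<^sub>C (d - d) - 0)
          \<rho> (c *\<^sub>C (tf w d - tf z d) - L d)"
        unfolding \<rho>_def by (intro W_diff W_scale tf \<kappa> z w)
      moreover have "c *\<^sub>C (w *\<^sub>C state w d - z *\<^sub>C state z d) - (z *\<^sub>C \<kappa> d + state z d)
          = w *\<^sub>C \<rho> + (w - z) *\<^sub>C \<kappa> d"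
      proof -
        have "state z d = (c * (w - z)) *\<^sub>C state z d" by (simp add: c)
        then have "state z d = (c * w) *\<^sub>C state z d - (c * z) *\<^sub>C state z d"
          by (simp add: algebra_simps scaleC_diff_left)
        then show ?thesis by (simp add: \<rho>_def scaleC_algebra mult.commute algebra_simps)
      qed
      ultimately have Wr: "W (w *\<^sub>C \<rho> + (w - z) *\<^sub>C \<kappa> d) 0 \<rho> (c *\<^sub>C (tf w d - tf z d) - L d)" by simp
      have "cmod w \<le> cmod z + cmod (w - z)" using norm_triangle_sub[of w z] by simp
      then have sw: "s / 2 \<le> 1 - cmod w" using w(3) by (simp add: s_def field_simps)
      define t where "t = cmod (w - z) * (norm d / s\<^sup>2)"
      have t: "nm ((w - z) *\<^sub>C \<kappa> d) \<le> t"
        unfolding t_def nm_scale[OF \<kappa>(1)] by (intro mult_left_mono \<kappa>_bound) simp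
      have "s / 2 * nm \<rho> \<le> (1 - cmod w) * nm \<rho>" using sw \<rho> by (intro mult_right_mono) auto
      also have "\<dots> \<le> nm ((w - z) *\<^sub>C \<kappa> d)" using feedback_bound[OF Wr] w \<kappa>(1) by (simp add: mem)
      finally have \<rho>t: "nm \<rho> \<le> 2 / s * t" using t s by (simp add: field_simps)
      have "norm (c *\<^sub>C (tf w d - tf z d) - L d) \<le> nm (w *\<^sub>C \<rho> + (w - z) *\<^sub>C \<kappa> d)"
        using W_out(1)[OF Wr] by simp
      also have "\<dots> \<le> cmod w * nm \<rho> + nm ((w - z) *\<^sub>C \<kappa> d)"
        using nm_triangle[of "w *\<^sub>C \<rho>" "(w - z) *\<^sub>C \<kappa> d"] \<rho> \<kappa>(1) by (simp add: mem nm_scale)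
      also have "\<dots> \<le> 1 * nm \<rho> + t" using w \<rho> t by (intro add_mono mult_right_mono) auto
      also have "\<dots> \<le> 2 / s * t + t" using \<rho>t by simp
      also have "\<dots> = C * cmod (w - z) * norm d"
        using s by (simp add: C_def t_def field_simps power2_eq_square power3_eq_cube)
      finally show ?thesis by (simp add: c_def)
    qed
    ultimately show "\<exists>L C \<delta>. \<delta> > 0 \<and> C \<ge> 0 \<and> bounded_clinear L \<and>
      (\<forall>w\<in>\<bbbD>. w \<noteq> z \<and> cmod (w - z) < \<delta> \<longrightarrow>
        (\<forall>u. norm ((1 / (w - z)) *\<^sub>C (tf w u - tf z u) - L u) \<le> C * cmod (w - z) * norm u))"
      using s by (intro exI[of _ L] exI[of _ C] exI[of _ "s / 2"]) (auto simp: C_def)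
  qed
  then show ?thesis by (simp add: schur_class_def tf_clinear tf_contr)
qed

end

section \<open>Coisometric colligations and the kernel of their transfer function\<close>

lemma is_rkhs_kernel:
  assumes "is_rkhs K H ip" "z \<in> \<bbbD>"
  shows "on_disk (\<lambda>w. K w z y) \<in> H" "f \<in> H \<Longrightarrow> ip f (on_disk (\<lambda>w. K w z y)) = cinner (f z) y"
  using assms unfolding is_rkhs_def by blast+

lemma is_rkhs_off_disk: "is_rkhs K H ip \<Longrightarrow> f \<in> H \<Longrightarrow> z \<notin> \<bbbD> \<Longrightarrow> f z = 0"
  unfolding is_rkhs_def by blast

text \<open>The hypothesis of \<open>coiso\<close> says that the adjoint of \<open>W\<close> takes
  \<open>(q, e0)\<close> to \<open>(p, d0)\<close>; the conclusion says that \<open>W\<close> takes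
  it back. This is coisometry, expressed without naming the adjoint.\<close>

locale coisometric_colligation = colligation H ip W
  for H :: "'h::complex_vector set" and ip
    and W :: "'h \<Rightarrow> 'd::chilbert_space \<Rightarrow> 'h \<Rightarrow> 'e::chilbert_space \<Rightarrow> bool" +
  assumes coiso: "p \<in> H \<Longrightarrow> q \<in> H \<Longrightarrow>
      (\<And>k d k' e. W k d k' e \<Longrightarrow> ip k' q + cinner e e0 = ip k p + cinner d d0) \<Longrightarrow> W p d0 q e0"
begin

text \<open>The adjoint of the evaluation \<open>obs _ z\<close>, applied to \<open>e\<close>; it
  will correspond to a kernel function of the transfer function.\<close>

definition kv :: "complex \<Rightarrow> 'e \<Rightarrow> 'h" where
  "kv z e = (SOME k. k \<in> H \<and> (\<forall>p\<in>H. ip p k = cinner (obs p z) e))"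

lemma kv: assumes z: "z \<in> \<bbbD>" shows "kv z e \<in> H" "p \<in> H \<Longrightarrow> ip p (kv z e) = cinner (obs p z) e"
proof -
  let ?B = "(1 / (1 - cmod z) + 1) * norm e"
  have "\<exists>k. k \<in> H \<and> (\<forall>p\<in>H. ip p k = cinner (obs p z) e)"
  proof (rule riesz[of "\<lambda>p. cinner (obs p z) e" ?B])
    show "cmod (cinner (obs p z) e) \<le> ?B * nm p" if "p \<in> H" for p
      using mult_right_mono[OF obs_bound[OF z that], of "norm e"] cinner_cauchy[of "obs p z" e]
      by (simp add: mult_ac)
  qed (use z in \<open>auto simp: obs_add obs_scale cinner_algebra\<close>)
  then have "kv z e \<in> H \<and> (\<forall>p\<in>H. ip p (kv z e) = cinner (obs p z) e)"
    unfolding kv_def by (rule someI_ex)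
  then show "kv z e \<in> H" "p \<in> H \<Longrightarrow> ip p (kv z e) = cinner (obs p z) e" by auto
qed

text \<open>Both \<open>z *\<^sub>C obs k' z + e\<close> and \<open>tf z d + obs k z\<close> are
  outputs of the loop with source \<open>k\<close> and input \<open>d\<close>, hence equal. Pairing
  this identity with \<open>e0\<close> is the adjoint relation required by
  \<open>coiso\<close>.\<close>

lemma W_kv:
  assumes z: "z \<in> \<bbbD>" shows "W (kv z e0) (cadjoint (tf z) e0) (cnj z *\<^sub>C kv z e0) e0"
proof (rule coiso)
  fix k d k' e assume W: "W k d k' e"
  then have m: "k \<in> H" "k' \<in> H" using W_mem by auto
  have "W (z *\<^sub>C (z *\<^sub>C ostate k' z + k') + k) (z *\<^sub>C 0 + d) (z *\<^sub>C ostate k' z + k') (z *\<^sub>C obs k' z + e)"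
    by (intro W_add W_scale obs z m W)
  moreover have "W (z *\<^sub>C (state z d + ostate k z) + k) (d + 0) (state z d + ostate k z) (tf z d + obs k z)"
    using W_add[OF tf[OF z, of d] obs[OF z m(1)]] by (simp add: scaleC_add_right add.assoc)
  ultimately have "z *\<^sub>C obs k' z + e = tf z d + obs k z" using z by (intro feedback_unique(2)) auto
  then have "cinner (z *\<^sub>C obs k' z + e) e0 = cinner (tf z d + obs k z) e0" by simp
  then show "ip k' (cnj z *\<^sub>C kv z e0) + cinner e e0 = ip k (kv z e0) + cinner d (cadjoint (tf z) e0)"
    using m kv[OF z] by (simp add: ip_algebra cinner_algebra cadjoint[OF tf_clinear[OF z]])
qed (simp_all add: kv[OF z] mem)

text \<open>Subtracting the loop that defines \<open>tf z\<close> from \<open>W_kv\<close> cancels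
  the input; division by \<open>1 - z * cnj w\<close> leaves the loop with source
  \<open>kv w e\<close>.\<close>

lemma obs_kv:
  assumes z: "z \<in> \<bbbD>" and w: "w \<in> \<bbbD>" shows "obs (kv w e) z = dBR_kernel tf z w e"
proof -
  let ?d = "cadjoint (tf w) e"
  define c where "c = 1 / (1 - z * cnj w)"
  define k where "k = c *\<^sub>C (cnj w *\<^sub>C kv w e - state z ?d)"
  have "cmod (z * cnj w) < 1 * 1" unfolding norm_mult using z w by (intro mult_strict_mono) auto
  then have "z * cnj w \<noteq> 1" by auto
  then have c: "c * (1 - z * cnj w) = 1" by (simp add: c_def)
  have "W (c *\<^sub>C (kv w e - z *\<^sub>C state z ?d)) (c *\<^sub>C (?d - ?d)) k (c *\<^sub>C (e - tf z ?d))"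
    unfolding k_def by (intro W_scale W_diff tf W_kv z w)
  moreover have "c *\<^sub>C (kv w e - z *\<^sub>C state z ?d) = z *\<^sub>C k + kv w e"
  proof -
    have "kv w e = (c * (1 - z * cnj w)) *\<^sub>C kv w e" by (simp add: c)
    then have "kv w e = c *\<^sub>C kv w e - (c * z * cnj w) *\<^sub>C kv w e"
      by (simp add: algebra_simps scaleC_diff_left)
    then show ?thesis by (simp add: k_def scaleC_algebra algebra_simps)
  qed
  ultimately have "W (z *\<^sub>C k + kv w e) 0 k (c *\<^sub>C (e - tf z ?d))" by simp
  then show ?thesis using obs_eq[OF z] kv(1)[OF w] by (simp add: dBR_kernel_def c_def)
qed

text \<open>By \<open>obs_kv\<close> the vectors \<open>kv\<close> and the kernel functions have the
  same Gram matrix. Transfer in each direction is contractive, and testing against kernel functions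
  identifies it with \<open>obs\<close> or a right inverse of \<open>obs\<close>; injectivity turns
  the two inequalities into equality of norms.\<close>

lemma rkhs_obs:
  assumes E: "is_rkhs (dBR_kernel tf) HE ipE"
    and inj: "\<And>p q. p \<in> H \<Longrightarrow> q \<in> H \<Longrightarrow> obs p = obs q \<Longrightarrow> p = q"
  shows "p \<in> H \<Longrightarrow> obs p \<in> HE \<and> rk_norm ipE (obs p) = nm p"
    and "h \<in> HE \<Longrightarrow> \<exists>p\<in>H. obs p = h"
proof -
  interpret HE: hspace HE ipE using hspace_rkhs[OF E] .
  \<comment> \<open>Both families vanish for parameters off the disk, so that they can be indexed by
    a whole type.\<close>
  define \<kappa>1 where "\<kappa>1 = (\<lambda>(z, e). if z \<in> \<bbbD> then kv z e else 0)"
  define \<kappa>2 where "\<kappa>2 = (\<lambda>(z, e). if z \<in> \<bbbD> then on_disk (\<lambda>w. dBR_kernel tf w z e) else 0)"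
  have m1: "\<kappa>1 i \<in> H" for i by (auto simp: \<kappa>1_def kv split: prod.split)
  have m2: "\<kappa>2 i \<in> HE" for i by (auto simp: \<kappa>2_def is_rkhs_kernel(1)[OF E] split: prod.split)
  have gram: "ip (\<kappa>1 i) (\<kappa>1 k) = ipE (\<kappa>2 i) (\<kappa>2 k)" for i k
  proof -
    obtain z e w b where ik: "i = (z, e)" "k = (w, b)" by (metis surj_pair)
    show ?thesis
    proof (cases "z \<in> \<bbbD> \<and> w \<in> \<bbbD>")
      case True
      have "ipE (\<kappa>2 i) (\<kappa>2 k) = cinner (\<kappa>2 i w) b"
        using is_rkhs_kernel(2)[OF E _ m2, of w i b] True by (simp add: ik \<kappa>2_def)
      also have "\<dots> = cinner (obs (kv z e) w) b" using True by (simp add: ik \<kappa>2_def obs_kv on_disk_def)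
      finally show ?thesis using True kv(2)[of w "kv z e" b] kv(1)[of z e] by (simp add: ik \<kappa>1_def)
    next
      case False
      then have "(\<kappa>1 i = 0 \<and> \<kappa>2 i = 0) \<or> (\<kappa>1 k = 0 \<and> \<kappa>2 k = 0)" by (auto simp: ik \<kappa>1_def \<kappa>2_def)
      then show ?thesis using m1[of i] m2[of i] m1[of k] m2[of k] by auto
    qed
  qed
  have one: "obs p \<in> HE \<and> rk_norm ipE (obs p) \<le> nm p" if p: "p \<in> H" for p
  proof -
    obtain g where g: "g \<in> HE" "HE.nm g \<le> nm p" "\<And>i. ipE g (\<kappa>2 i) = ip p (\<kappa>1 i)"
      by (rule gram_transfer[of H ip HE ipE \<kappa>1 \<kappa>2 p])
        (use m1 m2 gram p hspace_axioms HE.hspace_axioms in auto)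
    have "g z = obs p z" for z
    proof (cases "z \<in> \<bbbD>")
      case True
      show ?thesis
      proof (rule cinner_extensionality)
        fix e show "cinner (g z) e = cinner (obs p z) e"
          using g(3)[of "(z, e)"] True is_rkhs_kernel(2)[OF E True g(1), of e] kv(2)[OF True p, of e]
          by (simp add: \<kappa>1_def \<kappa>2_def)
      qed
    next
      case False
      then show ?thesis using is_rkhs_off_disk[OF E g(1)] by (simp add: obs_def)
    qed
    then have "g = obs p" by blast
    then show ?thesis using g by (simp add: nm_rk_norm[OF HE.hspace_axioms])
  qed
  have two: "\<exists>p\<in>H. obs p = h \<and> nm p \<le> rk_norm ipE h" if h: "h \<in> HE" for h
  proof -
    obtain p where p: "p \<in> H" "nm p \<le> HE.nm h" "\<And>i. ip p (\<kappa>1 i) = ipE h (\<kappa>2 i)"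
      by (rule gram_transfer[of HE ipE H ip \<kappa>2 \<kappa>1 h])
        (use m1 m2 gram h hspace_axioms HE.hspace_axioms in auto)
    have "obs p z = h z" for z
    proof (cases "z \<in> \<bbbD>")
      case True
      show ?thesis
      proof (rule cinner_extensionality)
        fix e show "cinner (obs p z) e = cinner (h z) e"
          using p(3)[of "(z, e)"] True is_rkhs_kernel(2)[OF E True h, of e] kv(2)[OF True p(1), of e]
          by (simp add: \<kappa>1_def \<kappa>2_def)
      qed
    next
      case False
      then show ?thesis using is_rkhs_off_disk[OF E h] by (simp add: obs_def)
    qed
    then have "obs p = h" by blast
    then show ?thesis using p by (auto simp: nm_rk_norm[OF HE.hspace_axioms])
  qed
  show "obs p \<in> HE \<and> rk_norm ipE (obs p) = nm p" if p: "p \<in> H"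
  proof -
    obtain q where "q \<in> H" "obs q = obs p" "nm q \<le> rk_norm ipE (obs p)" using two one[OF p] by blast
    then show ?thesis using one[OF p] inj[of q p] p by auto
  qed
  show "\<exists>p\<in>H. obs p = h" if "h \<in> HE" using two[OF that] by blast
qed

end

section \<open>Operator valued holomorphic functions\<close>

lemma schur_classD:
  assumes "S \<in> schur_class" "z \<in> \<bbbD>"
  shows "bounded_clinear (S z)" "norm (S z u) \<le> norm u"
  using assms by (auto simp: schur_class_def)

lemma schur_deriv:
  fixes S :: "complex \<Rightarrow> 'u::chilbert_space \<Rightarrow> 'y::chilbert_space"
  assumes S: "S \<in> schur_class" and z: "z \<in> \<bbbD>"
  obtains L where "bounded_clinear L"
    "\<And>u. ((\<lambda>w. (1 / (w - z)) *\<^sub>C (S w u - S z u)) \<longlongrightarrow> L u) (at z)"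
proof -
  obtain L where L: "bounded_clinear L"
    "((\<lambda>w. onorm (\<lambda>u. (1 / (w - z)) *\<^sub>C (S w u - S z u) - L u)) \<longlongrightarrow> 0) (at z)"
    using S z unfolding schur_class_def op_holomorphic_disk_def by blast
  have "((\<lambda>w. (1 / (w - z)) *\<^sub>C (S w u - S z u)) \<longlongrightarrow> L u) (at z)" for u
  proof -
    let ?f = "\<lambda>w u. (1 / (w - z)) *\<^sub>C (S w u - S z u) - L u"
    have "eventually (\<lambda>w. w \<in> \<bbbD>) (at z)" using z by (intro eventually_at_in_open') auto
    then have ev: "eventually (\<lambda>w. norm (?f w u) \<le> onorm (?f w) * norm u) (at z)"
    proof eventually_elim
      case (elim w)
      have "bounded_linear (?f w)"
        by (intro bounded_linear_sub bounded_linear_compose[OF bounded_linear_scaleC]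
            bounded_clinear_bounded_linear schur_classD[OF S] elim z L)
      then show ?case by (rule onorm)
    qed
    have "((\<lambda>w. onorm (?f w) * norm u) \<longlongrightarrow> 0) (at z)" using tendsto_mult_left_zero[OF L(2)] .
    from Lim_null_comparison[OF ev this] show ?thesis by (rule LIM_zero_cancel)
  qed
  then show ?thesis using L(1) that by blast
qed

lemma schur_weakly_holomorphic:
  fixes S :: "complex \<Rightarrow> 'u::chilbert_space \<Rightarrow> 'y::chilbert_space"
  assumes S: "S \<in> schur_class"
  shows "(\<lambda>z. cinner (S z u) v) holomorphic_on \<bbbD>"
proof -
  have "(\<lambda>z. cinner (S z u) v) field_differentiable (at z)" if z: "z \<in> \<bbbD>" for z
  proof -
    obtain L where L: "\<And>u. ((\<lambda>w. (1 / (w - z)) *\<^sub>C (S w u - S z u)) \<longlongrightarrow> L u) (at z)"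
      using schur_deriv[OF S z] by metis
    have "((\<lambda>w. cinner ((1 / (w - z)) *\<^sub>C (S w u - S z u)) v) \<longlongrightarrow> cinner (L u) v) (at z)"
      by (intro tendsto_cinner L tendsto_const)
    then have "((\<lambda>z. cinner (S z u) v) has_field_derivative cinner (L u) v) (at z)"
      by (simp add: has_field_derivative_iff cinner_algebra)
    then show ?thesis by (auto simp: field_differentiable_def)
  qed
  then show ?thesis by (auto simp: holomorphic_on_def intro: field_differentiable_at_within)
qed

text \<open>The Taylor coefficients \<open>y\<^sub>n\<close> of \<open>y\<close> satisfy \<open>T\<^sup>* y\<^sub>0 = 0\<close> and \<open>T\<^sup>* y\<^sub>n\<^sub>+\<^sub>1 = y\<^sub>n\<close>, so that \<open>y\<^sub>0\<close>
  lies in the range of every power of \<open>T\<^sup>*\<close>.\<close>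

lemma eigenvector_family_zero:
  fixes y :: "complex \<Rightarrow> 'x::chilbert_space"
  assumes T: "bounded_clinear T"
    and T_cond: "(\<Inter>k\<in>{1..}. range (cadjoint T ^^ k)) \<inter> {v. cadjoint T v = 0} = {0}"
    and hol: "\<And>v. (\<lambda>z. cinner (y z) v) holomorphic_on \<bbbD>"
    and bound: "\<And>z. cmod z \<le> 1/2 \<Longrightarrow> norm (y z) \<le> B"
    and eig: "\<And>z. z \<in> \<bbbD> \<Longrightarrow> cadjoint T (y z) = z *\<^sub>C y z"
    and z: "z \<in> \<bbbD>"
  shows "y z = 0"
proof -
  interpret X: hspace "UNIV :: 'x set" cinner by (rule hspace_closed) simp_all
  define f where "f v z = cinner (y z) v" for v z
  define c where "c n v = (deriv ^^ n) (f v) 0 / fact n" for n v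
  have hol': "f v holomorphic_on \<bbbD>" for v using hol[of v] by (simp add: f_def[abs_def])
  have c_nth: "c n v = fps_nth (fps_expansion (f v) 0) n" for n v
    by (simp add: c_def fps_expansion_def)
  have fps: "f v has_fps_expansion fps_expansion (f v) 0" for v
    by (rule has_fps_expansion_fps_expansion[of \<bbbD>]) (auto simp: hol')
  have c_unique: "c n v = fps_nth F n" if "f v has_fps_expansion F" for n v F
    using that fps_expansion_unique_complex[OF fps] c_nth has_fps_expansion_imp_analytic_0
    by (metis fps_expansion_unique_complex)
  have B: "0 \<le> B" using order_trans[OF norm_ge_zero bound[of 0]] by simp
  \<comment> \<open>The weak Taylor coefficients are antilinear in \<open>v\<close>. Cauchy's
    estimate on the circle of radius 1/2 produces the factor \<open>2 ^ n\<close>, and the Riesz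
    theorem turns them into vectors.\<close>
  have "\<exists>w. \<forall>v. cinner v w = cnj (c n v)" for n
  proof (rule X.riesz[of "\<lambda>v. cnj (c n v)" "B * 2 ^ n"])
    fix v v' :: 'x and a :: complex
    have "f (v + v') = (\<lambda>z. f v z + f v' z)" by (simp add: f_def cinner_algebra fun_eq_iff)
    then have "f (v + v') has_fps_expansion fps_expansion (f v) 0 + fps_expansion (f v') 0"
      using has_fps_expansion_add[OF fps fps] by simp
    from c_unique[OF this] show "cnj (c n (v + v')) = cnj (c n v) + cnj (c n v')" by (simp add: c_nth)
    have "f (a *\<^sub>C v) = (\<lambda>z. cnj a * f v z)" by (simp add: f_def cinner_algebra fun_eq_iff)
    then have "f (a *\<^sub>C v) has_fps_expansion fps_const (cnj a) * fps_expansion (f v) 0"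
      using has_fps_expansion_cmult_left[OF fps] by simp
    from c_unique[OF this] show "cnj (c n (a *\<^sub>C v)) = a * cnj (c n v)" by (simp add: c_nth)
    have "cmod ((deriv ^^ n) (f v) 0) \<le> fact n * (B * norm v) / (1/2) ^ n"
    proof (rule Cauchy_inequality)
      show "f v holomorphic_on ball 0 (1/2)" by (rule holomorphic_on_subset[OF hol']) auto
      show "continuous_on (cball 0 (1/2)) (f v)"
        by (rule holomorphic_on_imp_continuous_on[OF holomorphic_on_subset[OF hol']]) auto
      show "cmod (f v x) \<le> B * norm v" if "cmod (0 - x) = 1/2" for x
        unfolding f_def using that bound[of x]
        by (intro order_trans[OF cinner_cauchy] mult_right_mono) auto
    qed auto
    then have "cmod (c n v) \<le> B * norm v * 2 ^ n"
      by (simp add: c_def norm_divide field_simps power_one_over)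
    then show "cmod (cnj (c n v)) \<le> B * 2 ^ n * X.nm v" by (simp add: nm_cinner mult_ac)
  qed (use B in auto)
  then obtain Y where Y': "\<And>n v. cinner v (Y n) = cnj (c n v)" by metis
  have Y: "cinner (Y n) v = c n v" for n v
    using cinner_commute[of v "Y n"] by (simp add: Y')
  have adj: "cinner (cadjoint T a) b = cinner a (T b)" for a b
    using cadjoint[OF T, of b a] by (metis cinner_commute)
  have TY: "cadjoint T (Y 0) = 0" "cadjoint T (Y (Suc n)) = Y n" for n
  proof -
    \<comment> \<open>Coefficients of the two sides of \<open>z * f v z = f (T v) z\<close>, which
      is the eigenvector equation moved to the other argument.\<close>
    have eqs: "c n (T v) = (if n = 0 then 0 else c (n - 1) v)" for n v
    proof -
      have "f v has_fps_expansion fps_expansion (f v) 0" by (rule fps)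
      then have "(\<lambda>z. z * f v z) has_fps_expansion fps_X * fps_expansion (f v) 0"
        by (intro has_fps_expansion_mult has_fps_expansion_fps_X)
      moreover have "eventually (\<lambda>z. z * f v z = f (T v) z) (nhds 0)"
      proof -
        have "eventually (\<lambda>z::complex. z \<in> \<bbbD>) (nhds 0)" by (intro eventually_nhds_in_open) auto
        then show ?thesis
          by eventually_elim (simp add: f_def adj[symmetric] eig cinner_algebra)
      qed
      ultimately have "f (T v) has_fps_expansion fps_X * fps_expansion (f v) 0"
        using has_fps_expansion_cong[of "\<lambda>z. z * f v z" "f (T v)"] by simp
      from c_unique[OF this] show ?thesis by (simp add: c_nth)
    qed
    show "cadjoint T (Y 0) = 0" "cadjoint T (Y (Suc n)) = Y n"
      by (rule cinner_extensionality; simp add: adj Y eqs)+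
  qed
  have pow: "(cadjoint T ^^ k) (Y (n + k)) = Y n" for k n
  proof (induction k arbitrary: n)
    case (Suc k)
    have "(cadjoint T ^^ Suc k) (Y (n + Suc k)) = cadjoint T ((cadjoint T ^^ k) (Y (Suc n + k)))" by simp
    then show ?case by (simp only: Suc.IH TY)
  qed simp
  have zero: "Y n = 0" if "cadjoint T (Y n) = 0" for n
  proof -
    have "Y n \<in> range (cadjoint T ^^ k)" for k using pow[of k n] by (metis rangeI)
    then have "Y n \<in> (\<Inter>k\<in>{1..}. range (cadjoint T ^^ k)) \<inter> {v. cadjoint T v = 0}" using that by blast
    then show ?thesis using T_cond by blast
  qed
  have "Y n = 0" for n by (induction n) (auto intro!: zero simp: TY)
  then have c0: "c n v = 0" for n v using Y[of n v] by simp
  have "f v z = 0" for v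
  proof -
    have "(\<lambda>n. (deriv ^^ n) (f v) 0 / (fact n) * (z - 0) ^ n) sums f v z"
      using holomorphic_power_series[OF hol' z] .
    then have "(\<lambda>n. 0) sums f v z" using c0[of _ v, unfolded c_def] by simp
    from sums_unique2[OF this sums_zero] show ?thesis .
  qed
  then show ?thesis by (intro cinner_extensionality[of _ 0]) (simp add: f_def)
qed

section \<open>Loading a unitary colligation\<close>

text \<open>The port from \<open>e\<close> to \<open>d\<close> will be closed by a load
  \<open>e = \<E> z d\<close>. Since \<open>D22\<close> excludes direct feedthrough from
  \<open>e\<close> to \<open>d\<close>, the closed loop is well posed.\<close>

locale loading =
  fixes X :: "'x::chilbert_space set"
    and U :: "'x \<times> 'u::chilbert_space \<times> 'e::chilbert_space \<Rightarrow> 'x \<times> 'y::chilbert_space \<times> 'd::chilbert_space"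
  assumes X: "csubspace X" "closed X"
    and U: "unitary_between (X \<times> UNIV) (X \<times> UNIV) U"
    and D22: "snd (snd (U (0, 0, e))) = 0"
begin

lemmas X_mem = csubspace_mem[OF X(1)]

definition sys :: "'x \<Rightarrow> 'u \<Rightarrow> 'e \<Rightarrow> 'x \<Rightarrow> 'y \<Rightarrow> 'd \<Rightarrow> bool" where
  "sys a u e a' y d \<longleftrightarrow> a \<in> X \<and> U (a, u, e) = (a', y, d)"

lemma sys_exists: "a \<in> X \<Longrightarrow> \<exists>a' y d. sys a u e a' y d"
  by (auto simp: sys_def) (metis surj_pair)

lemma sys_mem: "sys a u e a' y d \<Longrightarrow> a \<in> X" "sys a u e a' y d \<Longrightarrow> a' \<in> X"
proof -
  show "a \<in> X" if "sys a u e a' y d" using that by (simp add: sys_def)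
  show "a' \<in> X" if "sys a u e a' y d"
  proof -
    have "U (a, u, e) \<in> X \<times> UNIV" using that U unfolding sys_def unitary_between_def by blast
    then show ?thesis using that by (simp add: sys_def)
  qed
qed

lemma sys_fun: "sys a u e a1 y1 d1 \<Longrightarrow> sys a u e a2 y2 d2 \<Longrightarrow> a1 = a2 \<and> y1 = y2 \<and> d1 = d2"
  by (auto simp: sys_def)

lemma sys_cinner:
  assumes "sys a u e a' y d" "sys b v c b' w g"
  shows "cinner a' b' + cinner y w + cinner d g = cinner a b + cinner u v + cinner e c"
proof -
  have "cinner (U (a, u, e)) (U (b, v, c)) = cinner (a, u, e) (b, v, c)"
    using assms U unfolding sys_def unitary_between_def by blast
  then show ?thesis using assms by (simp add: sys_def add.assoc)
qed

lemma sys_norm: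
  assumes "sys a u e a' y d"
  shows "(norm a')\<^sup>2 + (norm y)\<^sup>2 + (norm d)\<^sup>2 = (norm a)\<^sup>2 + (norm u)\<^sup>2 + (norm e)\<^sup>2"
proof -
  have "of_real ((norm a')\<^sup>2 + (norm y)\<^sup>2 + (norm d)\<^sup>2) = (of_real ((norm a)\<^sup>2 + (norm u)\<^sup>2 + (norm e)\<^sup>2) :: complex)"
    using sys_cinner[OF assms assms] by (simp add: cinner_self)
  then show ?thesis using of_real_eq_iff by blast
qed

lemma sys_le:
  assumes "sys a u e a' y d"
  shows "(norm a')\<^sup>2 + (norm d)\<^sup>2 \<le> (norm a)\<^sup>2 + (norm u)\<^sup>2 + (norm e)\<^sup>2"
    "(norm a')\<^sup>2 \<le> (norm a)\<^sup>2 + (norm u)\<^sup>2 + (norm e)\<^sup>2"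
    "(norm d)\<^sup>2 \<le> (norm a)\<^sup>2 + (norm u)\<^sup>2 + (norm e)\<^sup>2"
  using sys_norm[OF assms] zero_le_power2[of "norm a'"] zero_le_power2[of "norm y"]
    zero_le_power2[of "norm d"] by linarith+

lemma sys_add:
  assumes "sys a u e a' y d" "sys b v c b' w g"
  shows "sys (a + b) (u + v) (e + c) (a' + b') (y + w) (d + g)"
proof -
  have "U ((a, u, e) + (b, v, c)) = U (a, u, e) + U (b, v, c)"
    using assms U unfolding unitary_between_def sys_def by blast
  then show ?thesis using assms by (simp add: sys_def X_mem)
qed

lemma sys_scale:
  assumes "sys a u e a' y d"
  shows "sys (k *\<^sub>C a) (k *\<^sub>C u) (k *\<^sub>C e) (k *\<^sub>C a') (k *\<^sub>C y) (k *\<^sub>C d)"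
proof -
  have "U (k *\<^sub>C (a, u, e)) = k *\<^sub>C U (a, u, e)"
    using assms U unfolding unitary_between_def sys_def by blast
  then show ?thesis using assms by (simp add: sys_def X_mem)
qed

lemma sys_diff:
  assumes "sys a u e a' y d" "sys b v c b' w g"
  shows "sys (a - b) (u - v) (e - c) (a' - b') (y - w) (d - g)"
  using sys_add[OF assms(1) sys_scale[OF assms(2), of "-1"]] by (simp add: scaleC_minus_one)

lemma sys_blk:
  "a \<in> X \<Longrightarrow> sys a 0 0 (blk_A U a) (blk_C1 U a) (blk_C2 U a)"
  "sys 0 u 0 (blk_B1 U u) (blk_D11 U u) (blk_D21 U u)"
  "sys 0 0 e (blk_B2 U e) (blk_D12 U e) 0"
  using D22[of e] X_mem(1)
  by (auto simp: sys_def blk_A_def blk_C1_def blk_C2_def blk_B1_def blk_D11_def blk_D21_def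
      blk_B2_def blk_D12_def prod_eq_iff)

text \<open>The bound does not involve \<open>e\<close>: by \<open>D22\<close> the signal
  \<open>d\<close> is unchanged when \<open>e\<close> is replaced by 0, and the energy balance is
  applied afterwards.\<close>

lemma sys_out: assumes "sys a u e a' y d" shows "norm d \<le> norm a + norm u"
proof -
  have a: "a \<in> X" using sys_mem[OF assms] by blast
  from sys_exists[OF this, of u 0] obtain b w g where 1: "sys a u 0 b w g" by blast
  have "sys (a - a) (u - u) (e - 0) (a' - b) (y - w) (d - g)" by (rule sys_diff[OF assms 1])
  then have dg: "d = g" using sys_fun[OF sys_blk(3)[of e]] by fastforce
  have "(norm d)\<^sup>2 \<le> (norm a)\<^sup>2 + (norm u)\<^sup>2"
    using sys_le(3)[OF 1] dg by simp
  moreover have "0 \<le> 2 * norm a * norm u" by simp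
  ultimately have "(norm d)\<^sup>2 \<le> (norm a + norm u)\<^sup>2" unfolding power2_sum by linarith
  then show ?thesis by (rule power2_le_imp_le) simp
qed

text \<open>\<open>blk_A\<close> does not expand on \<open>X\<close>, so \<open>I - z A\<close> maps
  \<open>X\<close> onto \<open>X\<close>; an inverse image chosen in \<open>X\<close> therefore
  satisfies the resolvent equation.\<close>

lemma resolvent:
  assumes a: "a \<in> X" and z: "z \<in> \<bbbD>"
  shows "resolvent U X z a \<in> X"
    "resolvent U X z a = a + z *\<^sub>C blk_A U (resolvent U X z a)"
proof -
  interpret X: hspace X cinner by (rule hspace_closed[OF X])
  have A: "blk_A U b \<in> X" if "b \<in> X" for b using sys_blk(1)[OF that] sys_mem by blast
  have A': "norm (blk_A U b - blk_A U c) \<le> norm (b - c)" if "b \<in> X" "c \<in> X" for b c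
  proof -
    have "(norm (blk_A U b - blk_A U c))\<^sup>2 \<le> (norm (b - c))\<^sup>2"
      using sys_le(2)[OF sys_diff[OF sys_blk(1)[OF that(1)] sys_blk(1)[OF that(2)]]] by simp
    then show ?thesis by (rule power2_le_imp_le) simp
  qed
  obtain b where b: "b \<in> X" "a + z *\<^sub>C blk_A U b = b"
  proof (rule X.banach_fixpoint[of "\<lambda>b. a + z *\<^sub>C blk_A U b" "cmod z"])
    show "X.nm (a + z *\<^sub>C blk_A U f - (a + z *\<^sub>C blk_A U g)) \<le> cmod z * X.nm (f - g)"
      if "f \<in> X" "g \<in> X" for f g
      using A'[OF that] by (simp add: nm_cinner scaleC_diff_right[symmetric] norm_scaleC mult_left_mono)
  qed (use z a A X_mem in auto)
  then have "a \<in> (\<lambda>a. a - z *\<^sub>C blk_A U a) ` X" by (intro image_eqI[of _ _ b]) (auto simp: algebra_simps)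
  from f_inv_into_f[OF this] inv_into_into[OF this]
  show "resolvent U X z a \<in> X" "resolvent U X z a = a + z *\<^sub>C blk_A U (resolvent U X z a)"
    unfolding resolvent_def by (auto simp: algebra_simps)
qed

lemma sys_Sigma1:
  assumes z: "z \<in> \<bbbD>"
  shows "\<exists>b. sys (z *\<^sub>C b) u 0 b (Sigma11 U X z u) (Sigma21 U X z u)"
proof -
  let ?b = "resolvent U X z (blk_B1 U u)"
  have B: "blk_B1 U u \<in> X" using sys_blk(2) sys_mem by blast
  note b = resolvent[OF B z]
  have "sys (z *\<^sub>C ?b) u 0 (blk_B1 U u + z *\<^sub>C blk_A U ?b) (Sigma11 U X z u) (Sigma21 U X z u)"
    using sys_add[OF sys_blk(2)[of u] sys_scale[OF sys_blk(1)[OF b(1)], of z]]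
    by (simp add: Sigma11_def Sigma21_def)
  then show ?thesis using b(2) by auto
qed

lemma sys_Sigma2:
  assumes z: "z \<in> \<bbbD>"
  shows "\<exists>b. sys (z *\<^sub>C b) 0 e b (Sigma12 U X z e) (Sigma22 U X z e)"
proof -
  let ?b = "resolvent U X z (blk_B2 U e)"
  have B: "blk_B2 U e \<in> X" using sys_blk(3) sys_mem by blast
  note b = resolvent[OF B z]
  have "sys (z *\<^sub>C ?b) 0 e (blk_B2 U e + z *\<^sub>C blk_A U ?b) (Sigma12 U X z e) (Sigma22 U X z e)"
    using sys_add[OF sys_blk(3)[of e] sys_scale[OF sys_blk(1)[OF b(1)], of z]]
    by (simp add: Sigma12_def Sigma22_def)
  then show ?thesis using b(2) by auto
qed

lemma sys_Sigma_unique: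
  assumes z: "z \<in> \<bbbD>" and s: "sys (z *\<^sub>C a) u e a y d" "sys (z *\<^sub>C b) u e b w g"
  shows "a = b" "y = w" "d = g"
proof -
  have 1: "sys (z *\<^sub>C (a - b)) 0 0 (a - b) (y - w) (d - g)"
    using sys_diff[OF s] by (simp add: scaleC_diff_right)
  have "(norm (a - b))\<^sup>2 \<le> (cmod z * norm (a - b))\<^sup>2"
    using sys_le(2)[OF 1] by (simp add: norm_scaleC)
  then have "norm (a - b) \<le> cmod z * norm (a - b)" by (rule power2_le_imp_le) simp
  then have "(1 - cmod z) * norm (a - b) \<le> 0" by (simp add: algebra_simps)
  then show ab: "a = b" using z by (simp add: mult_le_0_iff)
  have "(norm (y - w))\<^sup>2 + (norm (d - g))\<^sup>2 = 0" using sys_norm[OF 1] ab by simp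
  then show "y = w" "d = g" by (simp_all add: sum_power2_eq_zero_iff)
qed

lemma Sigma_linear:
  assumes z: "z \<in> \<bbbD>"
  shows "Sigma22 U X z (e + e') = Sigma22 U X z e + Sigma22 U X z e'"
    "Sigma22 U X z (k *\<^sub>C e) = k *\<^sub>C Sigma22 U X z e"
    "Sigma21 U X z (u + u') = Sigma21 U X z u + Sigma21 U X z u'"
    "Sigma21 U X z (k *\<^sub>C u) = k *\<^sub>C Sigma21 U X z u"
proof -
  obtain a b c where 1: "sys (z *\<^sub>C a) 0 e a (Sigma12 U X z e) (Sigma22 U X z e)"
    "sys (z *\<^sub>C b) 0 e' b (Sigma12 U X z e') (Sigma22 U X z e')"
    "sys (z *\<^sub>C c) 0 (e + e') c (Sigma12 U X z (e + e')) (Sigma22 U X z (e + e'))"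
    using sys_Sigma2[OF z] by metis
  show "Sigma22 U X z (e + e') = Sigma22 U X z e + Sigma22 U X z e'"
    by (rule sys_Sigma_unique(3)[OF z 1(3)])
      (use sys_add[OF 1(1,2)] in \<open>simp add: scaleC_add_right[symmetric]\<close>)
  obtain c where 2: "sys (z *\<^sub>C c) 0 (k *\<^sub>C e) c (Sigma12 U X z (k *\<^sub>C e)) (Sigma22 U X z (k *\<^sub>C e))"
    using sys_Sigma2[OF z] by metis
  show "Sigma22 U X z (k *\<^sub>C e) = k *\<^sub>C Sigma22 U X z e"
    by (rule sys_Sigma_unique(3)[OF z 2, of "k *\<^sub>C a"])
      (use sys_scale[OF 1(1), of k] in \<open>simp add: scaleC_scaleC mult.commute[of k]\<close>)
  obtain a b c where 1: "sys (z *\<^sub>C a) u 0 a (Sigma11 U X z u) (Sigma21 U X z u)"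
    "sys (z *\<^sub>C b) u' 0 b (Sigma11 U X z u') (Sigma21 U X z u')"
    "sys (z *\<^sub>C c) (u + u') 0 c (Sigma11 U X z (u + u')) (Sigma21 U X z (u + u'))"
    using sys_Sigma1[OF z] by metis
  show "Sigma21 U X z (u + u') = Sigma21 U X z u + Sigma21 U X z u'"
    by (rule sys_Sigma_unique(3)[OF z 1(3)])
      (use sys_add[OF 1(1,2)] in \<open>simp add: scaleC_add_right[symmetric]\<close>)
  obtain c where 2: "sys (z *\<^sub>C c) (k *\<^sub>C u) 0 c (Sigma11 U X z (k *\<^sub>C u)) (Sigma21 U X z (k *\<^sub>C u))"
    using sys_Sigma1[OF z] by metis
  show "Sigma21 U X z (k *\<^sub>C u) = k *\<^sub>C Sigma21 U X z u"
    by (rule sys_Sigma_unique(3)[OF z 2, of "k *\<^sub>C a"])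
      (use sys_scale[OF 1(1), of k] in \<open>simp add: scaleC_scaleC mult.commute[of k]\<close>)
qed

text \<open>The Schwarz lemma for a Schur function vanishing at 0, obtained from the energy balance
  together with the bound on \<open>d\<close> by the state alone.\<close>

lemma Sigma22_bound:
  assumes z: "z \<in> \<bbbD>" shows "norm (Sigma22 U X z e) \<le> cmod z * norm e"
proof -
  obtain a where s: "sys (z *\<^sub>C a) 0 e a (Sigma12 U X z e) (Sigma22 U X z e)"
    using sys_Sigma2[OF z] by blast
  let ?d = "norm (Sigma22 U X z e)"
  have "?d \<le> cmod z * norm a" using sys_out[OF s] by (simp add: norm_scaleC)
  then have 1: "?d\<^sup>2 \<le> (cmod z)\<^sup>2 * (norm a)\<^sup>2" by (metis norm_ge_zero power_mono power_mult_distrib)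
  have "(norm a)\<^sup>2 + ?d\<^sup>2 \<le> (cmod z)\<^sup>2 * (norm a)\<^sup>2 + (norm e)\<^sup>2"
    using sys_le(1)[OF s] by (simp add: norm_scaleC power_mult_distrib)
  \<comment> \<open>The energy balance is weighted by \<open>(cmod z)\<^sup>2\<close> and the bound
    on \<open>d\<close> by \<open>1 - (cmod z)\<^sup>2\<close>; in the sum the terms with
    \<open>norm a\<close> cancel.\<close>
  then have 2: "(cmod z)\<^sup>2 * ((norm a)\<^sup>2 + ?d\<^sup>2) \<le> (cmod z)\<^sup>2 * ((cmod z)\<^sup>2 * (norm a)\<^sup>2 + (norm e)\<^sup>2)"
    by (intro mult_left_mono) auto
  have "(cmod z)\<^sup>2 < 1" using z by (simp add: power_less_one_iff abs_square_less_1)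
  then have "(1 - (cmod z)\<^sup>2) * ?d\<^sup>2 \<le> (1 - (cmod z)\<^sup>2) * ((cmod z)\<^sup>2 * (norm a)\<^sup>2)"
    using 1 by (intro mult_left_mono) auto
  with 2 have "?d\<^sup>2 \<le> (cmod z * norm e)\<^sup>2" by (simp add: power_mult_distrib algebra_simps)
  then show ?thesis by (rule power2_le_imp_le) simp
qed

definition contraction :: "('d \<Rightarrow> 'e) \<Rightarrow> bool" where
  "contraction K \<longleftrightarrow> bounded_clinear K \<and> (\<forall>d. norm (K d) \<le> norm d)"

lemma schur_contraction: "\<E> \<in> schur_class \<Longrightarrow> z \<in> \<bbbD> \<Longrightarrow> contraction (\<E> z)"
  by (simp add: contraction_def schur_class_def)

text \<open>The inverse in the definitions is the total function \<open>inv\<close>; it solves the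
  loop equation because \<open>f\<close> is onto: \<open>Sigma22\<close> shrinks by the factor
  \<open>cmod z\<close> and \<open>K\<close> does not expand.\<close>

lemma loop_inv:
  assumes z: "z \<in> \<bbbD>" and K: "contraction K"
  defines "f \<equiv> \<lambda>e. e - K (Sigma22 U X z e)"
  shows "inv f h = h + K (Sigma22 U X z (inv f h))"
proof -
  interpret X: hspace "UNIV :: 'e set" cinner by (rule hspace_closed) simp_all
  have lin: "K (Sigma22 U X z e) - K (Sigma22 U X z e') = K (Sigma22 U X z (e - e'))" for e e'
    using Sigma_linear(1)[OF z, of "e - e'" e'] K
    by (simp add: contraction_def bounded_clinear_simps(1))
  have "surj f"
  proof -
    have "\<exists>e. f e = h" for h
    proof (rule X.banach_fixpoint[of "\<lambda>e. h + K (Sigma22 U X z e)" "cmod z"])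
      show "X.nm (h + K (Sigma22 U X z e) - (h + K (Sigma22 U X z e'))) \<le> cmod z * X.nm (e - e')" for e e'
        using Sigma22_bound[OF z, of "e - e'"] K by (auto simp: nm_cinner lin contraction_def intro: order_trans)
    qed (use z in \<open>auto simp: f_def algebra_simps\<close>, metis add_diff_cancel)
    then show ?thesis by (metis surjI)
  qed
  then have "f (inv f h) = h" by (rule surj_f_inv_f)
  then show ?thesis unfolding f_def by (simp add: algebra_simps)
qed

text \<open>The transform becomes the input-output map of the loop closed by the load. The next two
  lemmas read \<open>G_fun\<close> and \<open>Gamma_fun\<close> as the responses of this loop to a
  signal added to the load output and to a source in the state.\<close>

lemma loop_redheffer:
  assumes z: "z \<in> \<bbbD>" and K: "contraction (\<E> z)"
  obtains a e d where "sys (z *\<^sub>C a) u e a (redheffer U X \<E> z u) d" "e = \<E> z d"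
    "d = Sigma21 U X z u + Sigma22 U X z e"
proof -
  define e where "e = inv (\<lambda>e'. e' - \<E> z (Sigma22 U X z e')) (\<E> z (Sigma21 U X z u))"
  have e: "e = \<E> z (Sigma21 U X z u) + \<E> z (Sigma22 U X z e)"
    unfolding e_def by (rule loop_inv[OF z K])
  obtain a b where 1: "sys (z *\<^sub>C a) u 0 a (Sigma11 U X z u) (Sigma21 U X z u)"
    "sys (z *\<^sub>C b) 0 e b (Sigma12 U X z e) (Sigma22 U X z e)"
    using sys_Sigma1[OF z] sys_Sigma2[OF z] by metis
  show ?thesis
    using that[of "a + b" e "Sigma21 U X z u + Sigma22 U X z e"] sys_add[OF 1] e K
    by (simp add: scaleC_add_right redheffer_def e_def[symmetric] contraction_def bounded_clinear_simps)
qed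

lemma loop_G:
  assumes z: "z \<in> \<bbbD>" and K: "contraction (\<E> z)"
  obtains a e d where "sys (z *\<^sub>C a) 0 e a (G_fun U X \<E> z h) d" "e = \<E> z d + h"
proof -
  define e where "e = inv (\<lambda>e'. e' - \<E> z (Sigma22 U X z e')) h"
  have e: "e = h + \<E> z (Sigma22 U X z e)"
    unfolding e_def by (rule loop_inv[OF z K])
  obtain b where 1: "sys (z *\<^sub>C b) 0 e b (Sigma12 U X z e) (Sigma22 U X z e)"
    using sys_Sigma2[OF z] by metis
  show ?thesis
    using that[of b e "Sigma22 U X z e"] 1 e
    by (simp add: G_fun_def e_def[symmetric] add.commute)
qed

lemma loop_Gamma:
  assumes z: "z \<in> \<bbbD>" and K: "contraction (\<E> z)" and p: "p \<in> X"
  obtains a e d where "sys (z *\<^sub>C a + p) 0 e a (Gamma_fun U X \<E> z p) d" "e = \<E> z d"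
proof -
  let ?b = "resolvent U X z p"
  note b = resolvent[OF p z]
  \<comment> \<open>The resolvent is the response of \<open>U\<close> to the source with open port
    \<open>e\<close>; its \<open>d\<close> component, sent through the load, acts as an external
    signal for the closed loop.\<close>
  let ?h = "\<E> z (blk_C2 U ?b)"
  obtain a e d where 1: "sys (z *\<^sub>C a) 0 e a (G_fun U X \<E> z ?h) d" "e = \<E> z d + ?h"
    using loop_G[where \<E> = \<E>, OF z K] by blast
  have "sys (p + z *\<^sub>C blk_A U ?b) 0 0 (blk_A U ?b) (blk_C1 U ?b) (blk_C2 U ?b)"
    using sys_blk(1)[OF b(1)] b(2) by simp
  from sys_add[OF 1(1) this] show ?thesis
    using that[of "a + blk_A U ?b" e "d + blk_C2 U ?b"] K 1(2)
    by (simp add: Gamma_fun_def scaleC_add_right contraction_def bounded_clinear_simps add_ac)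
qed

lemma loop_exists:
  assumes z: "z \<in> \<bbbD>" and K: "contraction K" and p: "p \<in> X"
  obtains a y d where "sys (z *\<^sub>C a + p) u (K d + h) a y d"
proof -
  obtain a e d where 1: "sys (z *\<^sub>C a) u e a (redheffer U X (\<lambda>_. K) z u) d" "e = K d"
    using loop_redheffer[where \<E> = "\<lambda>_. K", OF z K] by blast
  obtain b f g where 2: "sys (z *\<^sub>C b) 0 f b (G_fun U X (\<lambda>_. K) z h) g" "f = K g + h"
    using loop_G[where \<E> = "\<lambda>_. K", OF z K] by blast
  obtain c k l where 3: "sys (z *\<^sub>C c + p) 0 k c (Gamma_fun U X (\<lambda>_. K) z p) l" "k = K l"
    using loop_Gamma[where \<E> = "\<lambda>_. K", OF z K p] by blast
  show ?thesis
    using that[of "a + b + c" "d + g + l"] sys_add[OF sys_add[OF 1(1) 2(1)] 3(1)] K 1(2) 2(2) 3(2)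
    by (simp add: scaleC_add_right contraction_def bounded_clinear_simps add_ac)
qed

text \<open>The load returns at most the energy it receives, up to \<open>h\<close>, so the squares
  of \<open>norm d\<close> cancel in the balance and a quadratic inequality for
  \<open>norm a\<close> remains.\<close>

lemma loop_bound:
  assumes z: "z \<in> \<bbbD>" and K: "contraction K" and p: "p \<in> X"
    and s: "sys (z *\<^sub>C a + p) u (K d + h) a y d"
  shows "(1 - (cmod z)\<^sup>2) * norm a \<le> 9 * (norm p + norm u + norm h)"
    and "norm d \<le> norm a + (norm p + norm u + norm h)"
proof -
  define F where "F = norm p + norm u + norm h"
  define A where "A = norm a"
  have F: "0 \<le> F" "norm p \<le> F" "norm u \<le> F" "norm h \<le> F" "0 \<le> A" by (auto simp: F_def A_def)
  have zp: "norm (z *\<^sub>C a + p) \<le> cmod z * A + norm p"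
    using norm_triangle_ineq[of "z *\<^sub>C a" p] by (simp add: norm_scaleC A_def)
  have zA: "cmod z * A \<le> A" using z F by (intro mult_left_le_one_le) auto
  have d: "norm d \<le> A + F" using sys_out[OF s] zp zA norm_ge_zero[of h] unfolding F_def by linarith
  then show "norm d \<le> norm a + (norm p + norm u + norm h)" by (simp add: F_def A_def)
  have Kd: "norm (K d + h) \<le> norm d + F"
    using norm_triangle_ineq[of "K d" h] K F unfolding contraction_def by (meson add_mono order_trans)
  have "A\<^sup>2 + (norm d)\<^sup>2 \<le> (norm (z *\<^sub>C a + p))\<^sup>2 + (norm u)\<^sup>2 + (norm (K d + h))\<^sup>2"
    using sys_norm[OF s] zero_le_power2[of "norm y"] unfolding A_def by linarith
  also have "\<dots> \<le> (cmod z * A + F)\<^sup>2 + F\<^sup>2 + (norm d + F)\<^sup>2"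
    using zp F Kd by (intro add_mono power_mono) auto
  finally have "A\<^sup>2 \<le> (cmod z)\<^sup>2 * A\<^sup>2 + 2 * (cmod z * A) * F + 3 * F\<^sup>2 + 2 * norm d * F"
    by (simp add: power2_sum power_mult_distrib)
  also have "\<dots> \<le> (cmod z)\<^sup>2 * A\<^sup>2 + 2 * A * F + 3 * F\<^sup>2 + 2 * (A + F) * F"
    using zA d F by (intro add_mono mult_right_mono mult_left_mono) auto
  finally have 1: "(1 - (cmod z)\<^sup>2) * A\<^sup>2 \<le> 4 * A * F + 5 * F\<^sup>2"
    by (simp add: algebra_simps power2_eq_square)
  have z2: "0 \<le> 1 - (cmod z)\<^sup>2" "1 - (cmod z)\<^sup>2 \<le> 1" using z by (auto simp: abs_square_le_1)
  \<comment> \<open>If \<open>F < A\<close>, then \<open>F * F \<le> A * F\<close>, and 4 + 5 = 9;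
    otherwise the bound is immediate.\<close>
  have "(1 - (cmod z)\<^sup>2) * A \<le> 9 * F"
  proof (cases "A \<le> F")
    case True
    have "(1 - (cmod z)\<^sup>2) * A \<le> 1 * A" using z2 F by (intro mult_right_mono) auto
    then show ?thesis using True F by linarith
  next
    case False
    have "F * F \<le> A * F" using False F by (intro mult_right_mono) auto
    then have "((1 - (cmod z)\<^sup>2) * A) * A \<le> (9 * F) * A"
      using 1 by (simp add: power2_eq_square algebra_simps)
    then show ?thesis using False F by simp
  qed
  then show "(1 - (cmod z)\<^sup>2) * norm a \<le> 9 * (norm p + norm u + norm h)" by (simp add: F_def A_def)
qed

end

section \<open>Analytic dependence of the loop state\<close>

context loading
begin

text \<open>Differentiating the loop equation gives a loop of the same kind with source
  \<open>a z\<close> and added signal \<open>L (d z)\<close>; its state \<open>\<alpha>\<close> is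
  the derivative. The error \<open>\<rho> w\<close> is again a loop state, and
  \<open>loop_bound\<close> controls it by \<open>F w\<close>, which tends to 0 because
  \<open>\<E>\<close> is differentiable.\<close>

lemma loop_state_holomorphic:
  assumes \<E>: "\<E> \<in> schur_class"
    and s: "\<And>z. z \<in> \<bbbD> \<Longrightarrow> sys (z *\<^sub>C a z) u (\<E> z (d z)) (a z) (y z) (d z)"
  shows "(\<lambda>z. cinner (a z) v) holomorphic_on \<bbbD>"
proof -
  have "(\<lambda>z. cinner (a z) v) field_differentiable (at z)" if z: "z \<in> \<bbbD>" for z
  proof -
    obtain L where L: "\<And>u. ((\<lambda>w. (1 / (w - z)) *\<^sub>C (\<E> w u - \<E> z u)) \<longlongrightarrow> L u) (at z)"
      using schur_deriv[OF \<E> z] by metis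
    have az: "a z \<in> X" using sys_mem(2)[OF s[OF z]] .
    obtain \<alpha> \<eta> \<delta> where 2: "sys (z *\<^sub>C \<alpha> + a z) 0 (\<E> z \<delta> + L (d z)) \<alpha> \<eta> \<delta>"
      using loop_exists[OF z schur_contraction[OF \<E> z] az] by blast
    \<comment> \<open>A radius strictly between \<open>cmod z\<close> and 1 bounds
      \<open>1 - (cmod w)\<^sup>2\<close> below by \<open>m\<close> for all \<open>w\<close> near
      \<open>z\<close>.\<close>
    define r where "r = (1 + cmod z) / 2"
    have r: "cmod z < r" "0 \<le> r" "r < 1" using z by (auto simp: r_def)
    define m where "m = 1 - r\<^sup>2"
    have m: "0 < m" using r by (simp add: m_def abs_square_less_1)
    define q where "q w v = (1 / (w - z)) *\<^sub>C (\<E> w v - \<E> z v)" for w v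
    define \<rho> where "\<rho> w = (1 / (w - z)) *\<^sub>C (a w - a z) - \<alpha>" for w
    define F where "F w = cmod (w - z) * norm \<alpha> + (cmod (w - z) * norm (q w \<delta>) + norm (q w (d z) - L (d z)))" for w
    have \<rho>_bound: "norm (\<rho> w) \<le> 9 / m * F w" if w: "w \<in> ball 0 r - {z}" for w
    proof -
      have wD: "w \<in> \<bbbD>" "w \<noteq> z" and wr: "cmod w < r" using w r by auto
      note lin = bounded_clinear_simps[OF schur_classD(1)[OF \<E> wD(1)]]
      define c where "c = 1 / (w - z)"
      define \<sigma> where "\<sigma> = c *\<^sub>C (d w - d z) - \<delta>"
      define h where "h = (w - z) *\<^sub>C q w \<delta> + (q w (d z) - L (d z))"
      have c: "c * (w - z) = 1" "(w - z) * c = 1" using wD by (simp_all add: c_def)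
      have "sys (c *\<^sub>C (w *\<^sub>C a w - z *\<^sub>C a z) - (z *\<^sub>C \<alpha> + a z)) (c *\<^sub>C (u - u) - 0)
          (c *\<^sub>C (\<E> w (d w) - \<E> z (d z)) - (\<E> z \<delta> + L (d z)))
          (c *\<^sub>C (a w - a z) - \<alpha>) (c *\<^sub>C (y w - y z) - \<eta>) \<sigma>"
        unfolding \<sigma>_def by (intro sys_diff sys_scale s wD z 2)
      moreover have "c *\<^sub>C (w *\<^sub>C a w - z *\<^sub>C a z) - (z *\<^sub>C \<alpha> + a z) = w *\<^sub>C \<rho> w + (w - z) *\<^sub>C \<alpha>"
      proof -
        have "a z = (c * (w - z)) *\<^sub>C a z" by (simp add: c)
        then have "a z = (c * w) *\<^sub>C a z - (c * z) *\<^sub>C a z"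
          by (simp add: algebra_simps scaleC_diff_left)
        then show ?thesis by (simp add: \<rho>_def c_def[symmetric] scaleC_algebra mult.commute algebra_simps)
      qed
      moreover have "c *\<^sub>C (\<E> w (d w) - \<E> z (d z)) - (\<E> z \<delta> + L (d z)) = \<E> w \<sigma> + h"
        by (simp add: \<sigma>_def h_def q_def c_def[symmetric] lin scaleC_diff_right scaleC_scaleC c)
      ultimately have 3: "sys (w *\<^sub>C \<rho> w + (w - z) *\<^sub>C \<alpha>) 0 (\<E> w \<sigma> + h) (\<rho> w) (c *\<^sub>C (y w - y z) - \<eta>) \<sigma>"
        by (simp add: \<rho>_def c_def)
      have "(1 - (cmod w)\<^sup>2) * norm (\<rho> w) \<le> 9 * (norm ((w - z) *\<^sub>C \<alpha>) + norm (0::'u) + norm h)"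
        by (rule loop_bound(1)[OF wD(1) schur_contraction[OF \<E> wD(1)] _ 3])
          (use sys_mem(2)[OF 2] X_mem in auto)
      also have "\<dots> \<le> 9 * F w"
        using norm_triangle_ineq[of "(w - z) *\<^sub>C q w \<delta>" "q w (d z) - L (d z)"]
        by (simp add: h_def F_def norm_scaleC)
      finally have 4: "(1 - (cmod w)\<^sup>2) * norm (\<rho> w) \<le> 9 * F w" .
      have "m \<le> 1 - (cmod w)\<^sup>2" using power_mono[of "cmod w" r 2] wr by (simp add: m_def)
      then have "m * norm (\<rho> w) \<le> (1 - (cmod w)\<^sup>2) * norm (\<rho> w)" by (intro mult_right_mono) auto
      then show ?thesis using 4 m by (simp add: field_simps)
    qed
    have "(F \<longlongrightarrow> cmod (z - z) * norm \<alpha> + (cmod (z - z) * norm (L \<delta>) + norm (L (d z) - L (d z)))) (at z)"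
      unfolding F_def q_def by (intro tendsto_intros L)
    then have F0: "((\<lambda>w. 9 / m * F w * norm v) \<longlongrightarrow> 9 / m * 0 * norm v) (at z)"
      by (intro tendsto_intros) simp
    have "eventually (\<lambda>w. w \<in> ball 0 r - {z}) (at z)" using r by (intro eventually_at_in_open) auto
    then have ev: "eventually (\<lambda>w. norm ((cinner (a w) v - cinner (a z) v) / (w - z) - cinner \<alpha> v)
        \<le> 9 / m * F w * norm v) (at z)"
    proof eventually_elim
      case (elim w)
      have "(cinner (a w) v - cinner (a z) v) / (w - z) - cinner \<alpha> v = cinner (\<rho> w) v"
        by (simp add: \<rho>_def cinner_algebra)
      then show ?case
        using order_trans[OF cinner_cauchy mult_right_mono[OF \<rho>_bound[OF elim] norm_ge_zero[of v]]] by simp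
    qed
    have "((\<lambda>w. (cinner (a w) v - cinner (a z) v) / (w - z)) \<longlongrightarrow> cinner \<alpha> v) (at z)"
      by (rule LIM_zero_cancel[OF Lim_null_comparison[OF ev]]) (use F0 in simp)
    then show ?thesis by (auto simp: field_differentiable_def has_field_derivative_iff)
  qed
  then show ?thesis by (auto simp: holomorphic_on_def intro: field_differentiable_at_within)
qed

text \<open>The constant is 9 divided by 3/4, a lower bound of \<open>1 - (cmod z)\<^sup>2\<close>
  on this smaller disk.\<close>

lemma loop_state_bound:
  assumes \<E>: "\<E> \<in> schur_class" and z: "cmod z \<le> 1 / 2"
    and s: "sys (z *\<^sub>C a) u (\<E> z d) a y d"
  shows "norm a \<le> 12 * norm u"
proof -
  have zD: "z \<in> \<bbbD>" using z by simp
  have "(1 - (cmod z)\<^sup>2) * norm a \<le> 9 * (norm (0::'x) + norm u + norm (0::'e))"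
    using s by (intro loop_bound(1)[OF zD schur_contraction[OF \<E> zD] X_mem(1), where y = y and d = d]) simp
  moreover have "3 / 4 * norm a \<le> (1 - (cmod z)\<^sup>2) * norm a"
    using power_mono[OF z, of 2] by (intro mult_right_mono) (auto simp: power2_eq_square)
  ultimately show ?thesis by simp
qed

end

section \<open>Uniqueness of the load\<close>

locale interpolation_loading = loading X U
  for X :: "'x::chilbert_space set"
    and U :: "'x \<times> 'u::chilbert_space \<times> 'e::chilbert_space \<Rightarrow> 'x \<times> 'y::chilbert_space \<times> 'd::chilbert_space" +
  fixes R T :: "'x \<Rightarrow> 'x" and E :: "'x \<Rightarrow> 'y" and N :: "'x \<Rightarrow> 'u"
  assumes X_eq: "X = closure (range R)"
    and R: "bounded_clinear R" and R_sym: "cinner (R a) b = cinner a (R b)"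
    and T: "bounded_clinear T"
    and sys_data: "sys (R a) (N a) 0 (R (T a)) (E a) 0"
begin

lemma R_mem: "R a \<in> X"
  unfolding X_eq by (rule subsetD[OF closure_subset]) simp

text \<open>\<open>R\<close> is symmetric, so a vector of its kernel is orthogonal to its range and
  to the closure \<open>X\<close> of the range.\<close>

lemma R_inj: assumes "a \<in> X" "R a = 0" shows "a = 0"
proof -
  have "cinner a m = 0" if "m \<in> range R" for m
    using that R_sym[of a] assms(2) by auto
  from orthogonal_closure[OF this, where m = a] have "cinner a a = 0" using assms(1) by (simp add: X_eq)
  then show ?thesis by (simp add: cinner_self)
qed

text \<open>Unitarity of \<open>U\<close>, tested against the data trajectories
  \<open>sys_data\<close>: these carry no \<open>e\<close> and no \<open>d\<close>, and the given
  trajectory has no input in U and no output in Y, so only the state terms survive.\<close>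

lemma eigenvector_of_sys:
  assumes "sys (z *\<^sub>C a) 0 e a 0 d" shows "cadjoint T (R a) = z *\<^sub>C R a"
proof (rule cinner_extensionality_right)
  fix b
  have "cinner a (R (T b)) = cinner (z *\<^sub>C a) (R b)" using sys_cinner[OF assms sys_data[of b]] by simp
  then have "cinner (R a) (T b) = z * cinner (R a) b" by (simp add: R_sym cinner_algebra)
  then have "cinner (T b) (R a) = cnj z * cinner b (R a)" by (metis cinner_commute complex_cnj_mult)
  then show "cinner b (cadjoint T (R a)) = cinner b (z *\<^sub>C R a)"
    by (simp add: cadjoint[OF T, symmetric] cinner_algebra)
qed

text \<open>If \<open>\<delta>\<close> is orthogonal to the range of \<open>\<Sigma>\<^sub>2\<^sub>1(z)\<close>, then the state \<open>\<xi>\<close> it generates under \<open>U\<^sup>*\<close>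
  satisfies \<open>R \<xi> = cnj z T\<^sup>* R \<xi>\<close>, which forces \<open>\<xi> = 0\<close> once \<open>|z| \<parallel>T\<parallel> < 1\<close>.\<close>

lemma Sigma21_dense:
  assumes z: "z \<in> \<bbbD>" and zT: "cmod z * onorm T < 1"
  shows "closure (range (Sigma21 U X z)) = UNIV"
proof (rule closure_eq_UNIV)
  have "Sigma21 U X z 0 = 0" using Sigma_linear(4)[OF z, of 0 0] by simp
  then have "0 \<in> range (Sigma21 U X z)" by (metis rangeI)
  then show "csubspace (range (Sigma21 U X z))"
    unfolding csubspace_def by (auto simp: Sigma_linear[OF z, symmetric])
next
  fix \<delta> assume \<delta>: "\<And>m. m \<in> range (Sigma21 U X z) \<Longrightarrow> cinner \<delta> m = 0"
  interpret X: hspace X cinner by (rule hspace_closed[OF X])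
  \<comment> \<open>\<open>U\<close> is inverted on
    \<open>(cnj z *\<^sub>C \<xi>, 0, \<delta>)\<close>; the inverse preserves norms, so the
    resulting state depends on \<open>\<xi>\<close> with Lipschitz constant
    \<open>cmod z\<close>.\<close>
  have "\<exists>b v c. sys b v c (cnj z *\<^sub>C \<xi>) 0 \<delta>" if "\<xi> \<in> X" for \<xi>
  proof -
    have "(cnj z *\<^sub>C \<xi>, 0, \<delta>) \<in> U ` (X \<times> UNIV)" using U that X_mem by (simp add: unitary_between_def)
    then show ?thesis by (force simp: sys_def)
  qed
  then obtain B v c where B: "\<And>\<xi>. \<xi> \<in> X \<Longrightarrow> sys (B \<xi>) (v \<xi>) (c \<xi>) (cnj z *\<^sub>C \<xi>) 0 \<delta>" by metis
  obtain \<xi> where \<xi>: "\<xi> \<in> X" "B \<xi> = \<xi>"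
  proof (rule X.banach_fixpoint[of B "cmod z"])
    show "X.nm (B f - B g) \<le> cmod z * X.nm (f - g)" if "f \<in> X" "g \<in> X" for f g
    proof -
      have "(norm (B f - B g))\<^sup>2 \<le> (cmod z * norm (f - g))\<^sup>2"
        using sys_norm[OF sys_diff[OF B[OF that(1)] B[OF that(2)]]]
          zero_le_power2[of "norm (v f - v g)"] zero_le_power2[of "norm (c f - c g)"]
        by (simp add: scaleC_diff_right[symmetric] norm_scaleC del: zero_le_power2)
      then have "norm (B f - B g) \<le> cmod z * norm (f - g)" by (rule power2_le_imp_le) simp
      then show ?thesis by (simp add: nm_cinner)
    qed
  qed (use z sys_mem(1)[OF B] in auto)
  have 1: "sys \<xi> (v \<xi>) (c \<xi>) (cnj z *\<^sub>C \<xi>) 0 \<delta>" using B \<xi> by metis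
  \<comment> \<open>Pairing with the open loop that defines \<open>Sigma21\<close>: the state terms
    on the two sides agree, and \<open>\<delta>\<close> is orthogonal to
    \<open>Sigma21 U X z u\<close>.\<close>
  have "cinner u (v \<xi>) = 0" for u
  proof -
    obtain b where "sys (z *\<^sub>C b) u 0 b (Sigma11 U X z u) (Sigma21 U X z u)" using sys_Sigma1[OF z] by blast
    from sys_cinner[OF this 1] \<delta>[of "Sigma21 U X z u"] cinner_commute[of \<delta> "Sigma21 U X z u"]
    show ?thesis by (simp add: cinner_algebra)
  qed
  from this[of "v \<xi>"] have v: "v \<xi> = 0" by (simp add: cinner_self)
  have eq: "cinner \<xi> (R b) = cnj z * cinner \<xi> (R (T b))" for b
    using sys_cinner[OF 1 sys_data[of b]] v by (simp add: cinner_algebra)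
  have "cinner (R \<xi>) (R \<xi>) = cnj z * cinner (R \<xi>) (T (R \<xi>))" unfolding R_sym by (rule eq)
  moreover have "cmod (cinner (R \<xi>) (R \<xi>)) = (norm (R \<xi>))\<^sup>2" by (simp add: cinner_self norm_power)
  ultimately have "(norm (R \<xi>))\<^sup>2 = cmod (cnj z * cinner (R \<xi>) (T (R \<xi>)))" by simp
  also have "\<dots> \<le> cmod z * (norm (R \<xi>) * (onorm T * norm (R \<xi>)))"
    unfolding norm_mult complex_mod_cnj
    by (intro mult_left_mono order_trans[OF cinner_cauchy] onorm bounded_clinear_bounded_linear T) auto
  finally have "(1 - cmod z * onorm T) * (norm (R \<xi>))\<^sup>2 \<le> 0" by (simp add: power2_eq_square algebra_simps)
  then have "R \<xi> = 0" using zT by (simp add: mult_le_0_iff)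
  then have "\<xi> = 0" using R_inj \<xi> by blast
  then show "\<delta> = 0" using 1 v sys_fun[OF sys_blk(3)] by fastforce
qed

lemma redheffer_unique:
  assumes \<E>: "\<E> \<in> schur_class" and \<E>': "\<E>' \<in> schur_class"
    and eq: "\<And>z. z \<in> \<bbbD> \<Longrightarrow> redheffer U X \<E> z = redheffer U X \<E>' z"
    and T_cond: "(\<Inter>k\<in>{1..}. range (cadjoint T ^^ k)) \<inter> {v. cadjoint T v = 0} = {0}"
    and z: "z \<in> \<bbbD>"
  shows "\<E> z = \<E>' z"
proof -
  \<comment> \<open>For every input \<open>u\<close> the two loops carry the same signals: both
    loads receive the same \<open>d\<close> and answer with the same \<open>e\<close>.\<close>
  have loops: "\<exists>e d. e = \<E> z d \<and> e = \<E>' z d \<and> d = Sigma21 U X z u + Sigma22 U X z e"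
    if z: "z \<in> \<bbbD>" for z u
  proof -
    have "\<exists>a d y. sys (z *\<^sub>C a) u (\<E> z d) a (redheffer U X \<E> z u) d \<and>
        d = Sigma21 U X z u + Sigma22 U X z (\<E> z d)" if "z \<in> \<bbbD>" for z
      using loop_redheffer[where \<E> = \<E> and u = u, OF that schur_contraction[OF \<E> that]] by metis
    then obtain a d where 1: "\<And>z. z \<in> \<bbbD> \<Longrightarrow> sys (z *\<^sub>C a z) u (\<E> z (d z)) (a z) (redheffer U X \<E> z u) (d z)"
      "\<And>z. z \<in> \<bbbD> \<Longrightarrow> d z = Sigma21 U X z u + Sigma22 U X z (\<E> z (d z))" by metis
    have "\<exists>a d y. sys (z *\<^sub>C a) u (\<E>' z d) a (redheffer U X \<E>' z u) d" if "z \<in> \<bbbD>" for z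
      using loop_redheffer[where \<E> = \<E>' and u = u, OF that schur_contraction[OF \<E>' that]] by metis
    then obtain a' d' where 2: "\<And>z. z \<in> \<bbbD> \<Longrightarrow> sys (z *\<^sub>C a' z) u (\<E>' z (d' z)) (a' z) (redheffer U X \<E> z u) (d' z)"
      using eq by metis
    have 3: "sys (z *\<^sub>C (a z - a' z)) 0 (\<E> z (d z) - \<E>' z (d' z)) (a z - a' z) 0 (d z - d' z)"
      if "z \<in> \<bbbD>" for z
      using sys_diff[OF 1(1)[OF that] 2[OF that]] by (simp add: scaleC_diff_right)
    have "R (a z - a' z) = 0"
    proof (rule eigenvector_family_zero[OF T T_cond, where B = "onorm R * (24 * norm u)"])
      show "(\<lambda>z. cinner (R (a z - a' z)) v) holomorphic_on \<bbbD>" for v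
        using holomorphic_on_diff[OF loop_state_holomorphic[OF \<E> 1(1), where v = "R v"]
          loop_state_holomorphic[OF \<E>' 2, where v = "R v"]]
        by (simp add: R_sym cinner_algebra)
      show "norm (R (a z - a' z)) \<le> onorm R * (24 * norm u)" if "cmod z \<le> 1 / 2" for z
      proof -
        have zD: "z \<in> \<bbbD>" using that by simp
        have "norm (a z - a' z) \<le> 12 * norm u + 12 * norm u"
          by (intro order_trans[OF norm_triangle_ineq4] add_mono
              loop_state_bound[OF \<E> that 1(1)[OF zD]] loop_state_bound[OF \<E>' that 2[OF zD]])
        then show ?thesis
          by (intro order_trans[OF onorm mult_left_mono] onorm_pos_le bounded_clinear_bounded_linear R) auto
      qed
      show "cadjoint T (R (a z - a' z)) = z *\<^sub>C R (a z - a' z)" if "z \<in> \<bbbD>" for z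
        by (rule eigenvector_of_sys[OF 3[OF that]])
    qed (rule z)
    then have a: "a z - a' z = 0" using R_inj sys_mem(2)[OF 3[OF z]] by blast
    have 4: "sys 0 0 (\<E> z (d z) - \<E>' z (d' z)) 0 0 (d z - d' z)" using 3[OF z] a by simp
    have dd: "d z - d' z = 0" using sys_fun[OF 4 sys_blk(3)] by blast
    have "(norm (\<E> z (d z) - \<E>' z (d' z)))\<^sup>2 = 0" using sys_norm[OF 4] dd by simp
    then show ?thesis using dd 1(2)[OF z]
      by (intro exI[of _ "\<E> z (d z)"] exI[of _ "d z"]) auto
  qed
  obtain \<epsilon> where \<epsilon>: "0 < \<epsilon>" "\<epsilon> \<le> 1" "\<epsilon> * onorm T \<le> 1"
  proof -
    have "0 \<le> onorm T" by (intro onorm_pos_le bounded_clinear_bounded_linear T)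
    then show ?thesis by (intro that[of "1 / (1 + onorm T)"]) (auto simp: field_simps)
  qed
  have near: "\<E> z g = \<E>' z g" if z': "z \<in> ball 0 \<epsilon>" for z g
  proof -
    have z: "z \<in> \<bbbD>" using z' \<epsilon> by auto
    have zT: "cmod z * onorm T < 1"
    proof (cases "onorm T = 0")
      case False
      then have "0 < onorm T" using onorm_pos_le[OF bounded_clinear_bounded_linear[OF T]] by simp
      then have "cmod z * onorm T < \<epsilon> * onorm T" using z' by (intro mult_strict_right_mono) auto
      then show ?thesis using \<epsilon> by linarith
    qed simp
    have E: "bounded_linear (\<E> z)" "bounded_linear (\<E>' z)"
      using schur_classD(1)[OF \<E> z] schur_classD(1)[OF \<E>' z] by (auto intro: bounded_clinear_bounded_linear)
    define e where "e = \<E> z g"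
    \<comment> \<open>What \<open>Sigma21\<close> would have to supply for the first load to receive
      exactly \<open>g\<close>. By density it is a limit of attainable values \<open>s n\<close>;
      the loop answers \<open>f n\<close> then converge both to \<open>\<E> z g\<close> and to
      \<open>\<E>' z g\<close>.\<close>
    define \<sigma> where "\<sigma> = g - Sigma22 U X z e"
    have "\<sigma> \<in> closure (range (Sigma21 U X z))" using Sigma21_dense[OF z zT] by simp
    then obtain s where s: "\<forall>n. s n \<in> range (Sigma21 U X z)" "s \<longlonglongrightarrow> \<sigma>"
      unfolding closure_sequential by blast
    have "\<exists>f. f = \<E> z (s n + Sigma22 U X z f) \<and> f = \<E>' z (s n + Sigma22 U X z f)" for n
    proof -
      obtain u where "s n = Sigma21 U X z u" using s(1) by blast
      then show ?thesis using loops[OF z, of u] by metis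
    qed
    then obtain f where f: "\<And>n. f n = \<E> z (s n + Sigma22 U X z (f n))"
      "\<And>n. f n = \<E>' z (s n + Sigma22 U X z (f n))" by metis
    have S22: "norm (Sigma22 U X z (f n) - Sigma22 U X z e) \<le> cmod z * norm (f n - e)" for n
    proof -
      have "Sigma22 U X z (f n) - Sigma22 U X z e = Sigma22 U X z (f n - e)"
        using Sigma_linear(1)[OF z, of "f n - e" e] by simp
      then show ?thesis using Sigma22_bound[OF z] by simp
    qed
    \<comment> \<open>\<open>f n\<close> and \<open>e\<close> solve loop equations whose external
      signals differ by \<open>s n - \<sigma>\<close>; the loop map contracts by
      \<open>cmod z\<close>.\<close>
    have fe: "norm (f n - e) \<le> norm (s n - \<sigma>) / (1 - cmod z)" for n
    proof -
      have "f n - e = \<E> z (s n + Sigma22 U X z (f n)) - \<E> z g" using f(1)[of n] by (simp add: e_def)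
      also have "\<dots> = \<E> z (s n + Sigma22 U X z (f n) - g)"
        by (simp add: bounded_clinear_simps[OF schur_classD(1)[OF \<E> z]])
      finally have "f n - e = \<E> z ((s n - \<sigma>) + (Sigma22 U X z (f n) - Sigma22 U X z e))"
        by (simp add: \<sigma>_def algebra_simps)
      then have "norm (f n - e) \<le> norm ((s n - \<sigma>) + (Sigma22 U X z (f n) - Sigma22 U X z e))"
        using schur_classD(2)[OF \<E> z] by metis
      also have "\<dots> \<le> norm (s n - \<sigma>) + cmod z * norm (f n - e)"
        by (intro order_trans[OF norm_triangle_ineq] add_left_mono S22)
      finally show ?thesis using z by (simp add: field_simps)
    qed
    have "(\<lambda>n. norm (s n - \<sigma>) / (1 - cmod z)) \<longlonglongrightarrow> norm (\<sigma> - \<sigma>) / (1 - cmod z)"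
      using z by (intro tendsto_intros s) auto
    then have lim0: "(\<lambda>n. norm (s n - \<sigma>) / (1 - cmod z)) \<longlonglongrightarrow> 0" by simp
    have fl: "f \<longlonglongrightarrow> e"
      by (rule LIM_zero_cancel[OF Lim_null_comparison[OF always_eventually[OF allI[OF fe]] lim0]])
    have "(\<lambda>n. cmod z * norm (f n - e)) \<longlonglongrightarrow> cmod z * norm (e - e)" by (intro tendsto_intros fl)
    then have "(\<lambda>n. cmod z * norm (f n - e)) \<longlonglongrightarrow> 0" by simp
    then have "(\<lambda>n. Sigma22 U X z (f n)) \<longlonglongrightarrow> Sigma22 U X z e"
      by (rule LIM_zero_cancel[OF Lim_null_comparison[OF always_eventually[OF allI[OF S22]]]])
    then have "(\<lambda>n. s n + Sigma22 U X z (f n)) \<longlonglongrightarrow> \<sigma> + Sigma22 U X z e" by (intro tendsto_add s)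
    then have "(\<lambda>n. \<E>' z (s n + Sigma22 U X z (f n))) \<longlonglongrightarrow> \<E>' z g"
      using bounded_linear.tendsto[OF E(2)] by (simp add: \<sigma>_def)
    then have "f \<longlonglongrightarrow> \<E>' z g" by (simp add: f(2)[symmetric])
    then show ?thesis using fl LIMSEQ_unique unfolding e_def by blast
  qed
  show ?thesis
  proof
    fix g show "\<E> z g = \<E>' z g"
    proof (rule cinner_extensionality)
      fix v
      show "cinner (\<E> z g) v = cinner (\<E>' z g) v"
        by (rule analytic_continuation_open[of "ball 0 \<epsilon>" \<bbbD>])
          (use \<epsilon> z near in \<open>auto intro: schur_weakly_holomorphic \<E> \<E>'\<close>)
    qed
  qed
qed

end

text \<open>A contraction that preserves the norm of a vector preserves orthogonality to it. Adding
  \<open>a\<close> times that vector with \<open>a = t c\<close> cancels the quadratic terms and the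
  input cross term, leaving an inequality linear in \<open>t\<close> whose slope is a multiple of
  \<open>(cmod c)\<^sup>2\<close>.\<close>

lemma (in colligation) W_isometric_orthogonal:
  assumes W: "W f u g y" "W f' u' g' y'"
    and iso: "(nm g')\<^sup>2 + (norm y')\<^sup>2 = (nm f')\<^sup>2 + (norm u')\<^sup>2"
    and orth: "ip f f' + cinner u u' = 0"
  shows "ip g g' + cinner y y' = 0"
proof -
  note m = W_mem[OF W(1)] W_mem[OF W(2)]
  define c where "c = ip g g' + cinner y y'"
  define K where "K = (nm f)\<^sup>2 + (norm u)\<^sup>2 - (nm g)\<^sup>2 - (norm y)\<^sup>2"
  have nsq: "(norm (v + w))\<^sup>2 = (norm v)\<^sup>2 + (norm w)\<^sup>2 + 2 * Re (cinner v w)" for v w :: "'z::complex_inner"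
    by (simp add: power2_norm_eq_inner inner_add inner_eq_Re_cinner[symmetric] inner_commute)
  have key: "2 * (cmod c)\<^sup>2 * t \<le> K" for t :: real
  proof -
    define a where "a = of_real t * c"
    have "cnj c * c = of_real ((cmod c)\<^sup>2)" by (metis complex_norm_square mult.commute)
    then have ac: "Re (cnj a * c) = t * (cmod c)\<^sup>2" by (simp add: a_def mult.assoc)
    have "W (f + a *\<^sub>C f') (u + a *\<^sub>C u') (g + a *\<^sub>C g') (y + a *\<^sub>C y')" by (rule W_lin[OF W])
    from W_contr[OF this]
    have "(nm g)\<^sup>2 + (cmod a * nm g')\<^sup>2 + 2 * Re (cnj a * ip g g') + ((norm y)\<^sup>2 + (cmod a * norm y')\<^sup>2 + 2 * Re (cnj a * cinner y y'))
      \<le> (nm f)\<^sup>2 + (cmod a * nm f')\<^sup>2 + 2 * Re (cnj a * ip f f') + ((norm u)\<^sup>2 + (cmod a * norm u')\<^sup>2 + 2 * Re (cnj a * cinner u u'))"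
      using m by (simp only: nsq nm_add_sq mem nm_scale norm_scaleC ip_scale_right cinner_scaleC_right)
    moreover have "Re (cnj a * ip g g') + Re (cnj a * cinner y y') = t * (cmod c)\<^sup>2"
      by (simp only: ac[symmetric]) (simp only: c_def distrib_left plus_complex.sel)
    moreover have "Re (cnj a * ip f f') + Re (cnj a * cinner u u') = 0"
      using arg_cong[OF orth, of "\<lambda>w. Re (cnj a * w)"] by (simp add: algebra_simps)
    moreover have "(cmod a * nm g')\<^sup>2 + (cmod a * norm y')\<^sup>2 = (cmod a * nm f')\<^sup>2 + (cmod a * norm u')\<^sup>2"
      using iso by (simp add: power_mult_distrib distrib_left[symmetric])
    ultimately show ?thesis unfolding K_def by (simp add: algebra_simps)
  qed
  have "c = 0"
  proof (rule ccontr)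
    assume "c \<noteq> 0"
    then have "2 * (cmod c)\<^sup>2 * ((K + 1) / (2 * (cmod c)\<^sup>2)) = K + 1" by simp
    then show False using key[of "(K + 1) / (2 * (cmod c)\<^sup>2)"] by linarith
  qed
  then show ?thesis by (simp add: c_def)
qed

section \<open>The de Branges--Rovnyak space\<close>

locale dBR_space =
  fixes S :: "complex \<Rightarrow> 'u::chilbert_space \<Rightarrow> 'y::chilbert_space"
    and H :: "(complex \<Rightarrow> 'y) set" and ip
  assumes S: "S \<in> schur_class" and rkhs: "is_rkhs (dBR_kernel S) H ip"

sublocale dBR_space \<subseteq> HS: hspace H ip
  by (rule hspace_rkhs[OF rkhs])

context dBR_space
begin

definition ker :: "complex \<Rightarrow> 'y \<Rightarrow> complex \<Rightarrow> 'y" where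
  "ker w y = on_disk (\<lambda>z. dBR_kernel S z w y)"

lemma ker_mem: "w \<in> \<bbbD> \<Longrightarrow> ker w y \<in> H"
  unfolding ker_def by (rule is_rkhs_kernel(1)[OF rkhs])

lemma ker: "w \<in> \<bbbD> \<Longrightarrow> f \<in> H \<Longrightarrow> ip f (ker w y) = cinner (f w) y"
  unfolding ker_def by (rule is_rkhs_kernel(2)[OF rkhs])

lemma off_disk: "f \<in> H \<Longrightarrow> z \<notin> \<bbbD> \<Longrightarrow> f z = 0"
  by (rule is_rkhs_off_disk[OF rkhs])

lemma fun_eqI: "f \<in> H \<Longrightarrow> g \<in> H \<Longrightarrow> (\<And>z. z \<in> \<bbbD> \<Longrightarrow> f z = g z) \<Longrightarrow> f = g"
  using off_disk by (metis ext)

lemma S_clinear: "z \<in> \<bbbD> \<Longrightarrow> bounded_clinear (S z)"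
  by (rule schur_classD[OF S])

lemmas S_simps = bounded_clinear_simps[OF S_clinear]
lemmas S_adj = cadjoint[OF S_clinear]

lemma S_adj': "z \<in> \<bbbD> \<Longrightarrow> cinner (cadjoint (S z) y) u = cinner y (S z u)"
  using S_adj[of z u y] by (metis cinner_commute)

lemma ker_identity:
  assumes z: "z \<in> \<bbbD>" and w: "w \<in> \<bbbD>"
  shows "(z * cnj w) *\<^sub>C ker w y z + y = ker w y z + S z (cadjoint (S w) y)"
proof -
  have "cmod (z * cnj w) < 1 * 1" unfolding norm_mult using z w by (intro mult_strict_mono) auto
  then have "z * cnj w \<noteq> 1" by auto
  then have "(1 - z * cnj w) *\<^sub>C ker w y z = y - S z (cadjoint (S w) y)"
    using z by (simp add: ker_def on_disk_def dBR_kernel_def scaleC_scaleC)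
  then show ?thesis by (simp add: scaleC_diff_left algebra_simps)
qed

text \<open>The lurking isometry behind the shift: rearranged, it equates the Gram matrices of
  \<open>(ker w y, cadjoint (S w) y)\<close> and
  \<open>(cnj w *\<^sub>C ker w y, y)\<close>.\<close>

lemma ker_Gram:
  assumes z: "z \<in> \<bbbD>" and w: "w \<in> \<bbbD>"
  shows "(1 - z * cnj w) * ip (ker w y) (ker z y') =
    cinner y y' - cinner (cadjoint (S w) y) (cadjoint (S z) y')"
proof -
  have "cinner ((z * cnj w) *\<^sub>C ker w y z + y) y' = cinner (ker w y z + S z (cadjoint (S w) y)) y'"
    by (simp only: ker_identity[OF z w])
  then show ?thesis
    by (simp add: ker[OF z ker_mem[OF w]] cinner_algebra S_adj[OF z] algebra_simps)
qed

text \<open>Elements of the space are continuous at 0; this is what makes the backward shift unique.\<close>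

lemma zero_off_origin:
  assumes f: "f \<in> H" and z: "\<And>z. z \<in> \<bbbD> \<Longrightarrow> z \<noteq> 0 \<Longrightarrow> f z = 0"
  shows "f = 0"
proof -
  have "cinner (f 0) y = 0" for y
  proof -
    define s where "s = cadjoint (S 0) y"
    define q where "q w = Re (cinner (S w s) y)" for w
    \<comment> \<open>An upper bound for the squared distance of two kernel functions that involves
      \<open>S w\<close> only through \<open>q w\<close>, and so tends to 0 by weak continuity: the
      squared norm of \<open>cadjoint (S w) y\<close> is replaced by the lower bound
      \<open>2 * q w - (norm s)\<^sup>2\<close>.\<close>
    define b where "b w = (norm y)\<^sup>2 - (norm s)\<^sup>2 +
      ((norm y)\<^sup>2 - (2 * q w - (norm s)\<^sup>2)) / (1 - (cmod w)\<^sup>2) - 2 * ((norm y)\<^sup>2 - q w)" for w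
    have q0: "q 0 = (norm s)\<^sup>2" by (simp add: q_def s_def S_adj cinner_self)
    have bound: "(HS.nm (ker 0 y - ker w y))\<^sup>2 \<le> b w" if w: "w \<in> \<bbbD>" for w
    proof -
      define sw where "sw = cadjoint (S w) y"
      have q: "Re (cinner s sw) = q w" using S_adj[OF w, of s y] by (simp add: q_def sw_def)
      have w1: "0 < 1 - (cmod w)\<^sup>2" using w by (simp add: abs_square_less_1)
      have "0 \<le> (norm (sw - s))\<^sup>2" by simp
      also have "\<dots> = (norm sw)\<^sup>2 + (norm s)\<^sup>2 - 2 * q w"
        unfolding q[symmetric] by (simp add: power2_norm_eq_inner inner_diff inner_eq_Re_cinner[symmetric] inner_commute)
      finally have sw: "2 * q w - (norm s)\<^sup>2 \<le> (norm sw)\<^sup>2" by simp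
      have 1: "(HS.nm (ker 0 y))\<^sup>2 = (norm y)\<^sup>2 - (norm s)\<^sup>2"
        using ker_Gram[of 0 0 y y] by (simp add: HS.nm_sq ker_mem cinner_self s_def)
      have "Re ((1 - w * cnj w) * ip (ker w y) (ker w y)) = (norm y)\<^sup>2 - (norm sw)\<^sup>2"
        by (subst ker_Gram[OF w w]) (simp add: cinner_self sw_def)
      moreover have "(1 - w * cnj w) = of_real (1 - (cmod w)\<^sup>2)" by (simp add: complex_norm_square[symmetric])
      ultimately have "(1 - (cmod w)\<^sup>2) * (HS.nm (ker w y))\<^sup>2 = (norm y)\<^sup>2 - (norm sw)\<^sup>2"
        by (simp add: HS.nm_sq[OF ker_mem[OF w]])
      then have 2: "(HS.nm (ker w y))\<^sup>2 = ((norm y)\<^sup>2 - (norm sw)\<^sup>2) / (1 - (cmod w)\<^sup>2)"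
        using w1 by (simp add: field_simps)
      have 3: "Re (ip (ker 0 y) (ker w y)) = (norm y)\<^sup>2 - q w"
        using ker_Gram[OF w, of 0 y y] q by (simp add: cinner_self s_def sw_def)
      show ?thesis
        using divide_right_mono[OF diff_left_mono[OF sw, of "(norm y)\<^sup>2"], of "1 - (cmod w)\<^sup>2"] w1
        by (simp add: HS.nm_diff_sq[OF ker_mem ker_mem[OF w]] 1 2 3 b_def)
    qed
    have "isCont (\<lambda>w. cinner (S w s) y) 0"
      using holomorphic_on_imp_continuous_on[OF schur_weakly_holomorphic[OF S, of s y]]
      by (simp add: continuous_on_eq_continuous_at)
    then have ql: "(q \<longlongrightarrow> q 0) (at 0)" unfolding q_def isCont_def by (intro tendsto_intros)
    have "(b \<longlongrightarrow> (norm y)\<^sup>2 - (norm s)\<^sup>2 +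
      ((norm y)\<^sup>2 - (2 * q 0 - (norm s)\<^sup>2)) / (1 - (cmod 0)\<^sup>2) - 2 * ((norm y)\<^sup>2 - q 0)) (at 0)"
      unfolding b_def by (intro tendsto_intros ql) simp
    then have bl: "(b \<longlongrightarrow> 0) (at 0)" by (simp add: q0)
    have "eventually (\<lambda>w::complex. w \<in> \<bbbD> - {0}) (at 0)" by (intro eventually_at_in_open) auto
    then have "eventually (\<lambda>w. (cmod (cinner (f 0) y))\<^sup>2 \<le> (HS.nm f)\<^sup>2 * b w) (at 0)"
    proof eventually_elim
      case (elim w)
      then have w: "w \<in> \<bbbD>" "w \<noteq> 0" by auto
      have "cinner (f 0) y = ip f (ker 0 y - ker w y)"
        using f z[OF w] w by (simp add: HS.ip_algebra ker ker_mem)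
      then have "cmod (cinner (f 0) y) \<le> HS.nm f * HS.nm (ker 0 y - ker w y)"
        using HS.cauchy_schwarz[OF f, of "ker 0 y - ker w y"] w by (simp add: HS.mem ker_mem)
      then have "(cmod (cinner (f 0) y))\<^sup>2 \<le> (HS.nm f)\<^sup>2 * (HS.nm (ker 0 y - ker w y))\<^sup>2"
        by (metis norm_ge_zero power_mono power_mult_distrib)
      also have "\<dots> \<le> (HS.nm f)\<^sup>2 * b w" by (intro mult_left_mono bound w) auto
      finally show ?case .
    qed
    moreover have "((\<lambda>w. (HS.nm f)\<^sup>2 * b w) \<longlongrightarrow> (HS.nm f)\<^sup>2 * 0) (at 0)" by (intro tendsto_intros bl)
    ultimately have "(cmod (cinner (f 0) y))\<^sup>2 \<le> (HS.nm f)\<^sup>2 * 0"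
      by (intro tendsto_lowerbound[of "\<lambda>w. (HS.nm f)\<^sup>2 * b w" _ "at (0::complex)"]) auto
    then show ?thesis by simp
  qed
  then have "f 0 = 0" by (intro cinner_extensionality[of _ 0]) simp
  then show ?thesis by (intro fun_eqI f HS.zero_mem) (metis z zero_fun_apply)
qed

text \<open>The backward shift colligation without division: at \<open>z = 0\<close> the equation
  gives y = f(0) + S(0) u, and elsewhere g is the corresponding difference quotient.\<close>

definition shift :: "(complex \<Rightarrow> 'y) \<Rightarrow> 'u \<Rightarrow> (complex \<Rightarrow> 'y) \<Rightarrow> 'y \<Rightarrow> bool" where
  "shift f u g y \<longleftrightarrow> f \<in> H \<and> g \<in> H \<and> (\<forall>z\<in>\<bbbD>. z *\<^sub>C g z + y = f z + S z u)"

lemma shift_ker: "w \<in> \<bbbD> \<Longrightarrow> shift (ker w y) (cadjoint (S w) y) (cnj w *\<^sub>C ker w y) y"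
  by (simp add: shift_def ker_mem HS.mem scaleC_scaleC ker_identity)

text \<open>Gram transfer from \<open>\<kappa>1\<close> to \<open>\<kappa>2\<close>, applied to
  \<open>(f, u)\<close>. Pairing the result with a member of \<open>\<kappa>2\<close> and using the
  reproducing property is the shift equation at one point; contractivity is part of the
  transfer.\<close>

lemma shift_exists:
  assumes f: "f \<in> H"
  obtains g y where "shift f u g y" "(HS.nm g)\<^sup>2 + (norm y)\<^sup>2 \<le> (HS.nm f)\<^sup>2 + (norm u)\<^sup>2"
proof -
  have U: "hspace (UNIV :: 'u set) cinner" and Y: "hspace (UNIV :: 'y set) cinner"
    by (rule hspace_closed; simp)+
  let ?H1 = "{p. dfst p \<in> H \<and> dsnd p \<in> (UNIV :: 'u set)}"
  let ?H2 = "{p. dfst p \<in> H \<and> dsnd p \<in> (UNIV :: 'y set)}"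
  interpret A: hspace ?H1 "ip_dsum ip cinner" by (rule hspace_dsum[OF HS.hspace_axioms U])
  interpret B: hspace ?H2 "ip_dsum ip cinner" by (rule hspace_dsum[OF HS.hspace_axioms Y])
  define \<kappa>1 where "\<kappa>1 = (\<lambda>(w, y). if w \<in> \<bbbD> then DSum (ker w y) (cadjoint (S w) y) else 0)"
  define \<kappa>2 where "\<kappa>2 = (\<lambda>(w, y). if w \<in> \<bbbD> then DSum (cnj w *\<^sub>C ker w y) y else 0)"
  have m1: "\<kappa>1 i \<in> ?H1" for i by (auto simp: \<kappa>1_def ker_mem split: prod.split)
  have m2: "\<kappa>2 i \<in> ?H2" for i by (auto simp: \<kappa>2_def ker_mem HS.mem split: prod.split)
  have gram: "ip_dsum ip cinner (\<kappa>1 i) (\<kappa>1 k) = ip_dsum ip cinner (\<kappa>2 i) (\<kappa>2 k)" for i k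
  proof -
    obtain w y z y' where ik: "i = (w, y)" "k = (z, y')" by (metis surj_pair)
    show ?thesis
    proof (cases "z \<in> \<bbbD> \<and> w \<in> \<bbbD>")
      case True
      then have z: "z \<in> \<bbbD>" and w: "w \<in> \<bbbD>" by auto
      show ?thesis using ker_Gram[OF z w, of y y'] z w
        by (simp add: ik \<kappa>1_def \<kappa>2_def ip_dsum_def HS.ip_algebra HS.mem ker_mem algebra_simps)
    next
      case False
      then have "(\<kappa>1 i = 0 \<and> \<kappa>2 i = 0) \<or> (\<kappa>1 k = 0 \<and> \<kappa>2 k = 0)" by (auto simp: ik \<kappa>1_def \<kappa>2_def)
      then show ?thesis using A.ip_zero[OF m1[of i]] A.ip_zero[OF m1[of k]]
          B.ip_zero[OF m2[of i]] B.ip_zero[OF m2[of k]] by auto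
    qed
  qed
  obtain g where g: "g \<in> ?H2" "B.nm g \<le> A.nm (DSum f u)"
    "\<And>i. ip_dsum ip cinner g (\<kappa>2 i) = ip_dsum ip cinner (DSum f u) (\<kappa>1 i)"
    by (rule gram_transfer[of ?H1 "ip_dsum ip cinner" ?H2 "ip_dsum ip cinner" \<kappa>1 \<kappa>2 "DSum f u"])
      (use f m1 m2 gram A.hspace_axioms B.hspace_axioms in \<open>simp_all\<close>)
  show ?thesis
  proof (rule that[of "dfst g" "dsnd g"])
    have "z *\<^sub>C dfst g z + dsnd g = f z + S z u" if z: "z \<in> \<bbbD>" for z
    proof (rule cinner_extensionality)
      fix y show "cinner (z *\<^sub>C dfst g z + dsnd g) y = cinner (f z + S z u) y"
        using g(3)[of "(z, y)"] z f g(1)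
        by (simp add: \<kappa>1_def \<kappa>2_def ip_dsum_def HS.ip_algebra ker ker_mem cinner_algebra S_adj)
    qed
    then show "shift f u (dfst g) (dsnd g)" using f g(1) by (simp add: shift_def)
    have "(B.nm g)\<^sup>2 \<le> (A.nm (DSum f u))\<^sup>2" using g by (intro power_mono) auto
    then show "(HS.nm (dfst g))\<^sup>2 + (norm (dsnd g))\<^sup>2 \<le> (HS.nm f)\<^sup>2 + (norm u)\<^sup>2"
      using f g(1) by (simp add: B.nm_sq A.nm_sq HS.nm_sq ip_dsum_def cinner_self)
  qed
qed

lemma shift_lin:
  assumes "shift f u g y" "shift f' u' g' y'"
  shows "shift (f + a *\<^sub>C f') (u + a *\<^sub>C u') (g + a *\<^sub>C g') (y + a *\<^sub>C y')"
proof -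
  have "z *\<^sub>C (g + a *\<^sub>C g') z + (y + a *\<^sub>C y') = (f + a *\<^sub>C f') z + S z (u + a *\<^sub>C u')" if z: "z \<in> \<bbbD>" for z
  proof -
    have "z *\<^sub>C (g + a *\<^sub>C g') z + (y + a *\<^sub>C y') = (z *\<^sub>C g z + y) + a *\<^sub>C (z *\<^sub>C g' z + y')"
      by (simp add: scaleC_algebra mult.commute)
    also have "\<dots> = (f z + S z u) + a *\<^sub>C (f' z + S z u')" using assms z by (simp add: shift_def)
    finally show ?thesis using z by (simp add: S_simps scaleC_add_right)
  qed
  then show ?thesis using assms by (auto simp: shift_def HS.mem)
qed

lemma shift_unique:
  assumes "shift f u g y" "shift f u g' y'" shows "g = g'" "y = y'"
proof -
  have eq: "z *\<^sub>C g z + y = z *\<^sub>C g' z + y'" if "z \<in> \<bbbD>" for z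
    using assms that by (simp add: shift_def)
  from eq[of 0] show y: "y = y'" by simp
  have "(g - g') z = 0" if z: "z \<in> \<bbbD>" "z \<noteq> 0" for z
    using eq[OF z(1)] scaleC_cancel[OF z(2)] by (simp add: y)
  then have "g - g' = 0" using assms by (intro zero_off_origin) (auto simp: shift_def HS.mem)
  then show "g = g'" by simp
qed

end

sublocale dBR_space \<subseteq> W: colligation H ip shift
proof
  show "\<exists>k' e. shift k d k' e" if "k \<in> H" for k d using shift_exists[OF that] by metis
  show "(HS.nm k')\<^sup>2 + (norm e)\<^sup>2 \<le> (HS.nm k)\<^sup>2 + (norm d)\<^sup>2" if s: "shift k d k' e" for k d k' e
  proof -
    have "k \<in> H" using s by (simp add: shift_def)
    then obtain g y where g: "shift k d g y" "(HS.nm g)\<^sup>2 + (norm y)\<^sup>2 \<le> (HS.nm k)\<^sup>2 + (norm d)\<^sup>2"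
      by (rule shift_exists)
    then show ?thesis using shift_unique[OF s g(1)] by simp
  qed
qed (rule shift_lin | simp add: shift_def)+

section \<open>The interpolation operator\<close>

lemma obs_op_off: "z \<notin> \<bbbD> \<Longrightarrow> obs_op E T x z = 0"
  by (simp add: obs_op_def on_disk_def)

lemma bounded_clinear_funpow:
  fixes T :: "'a::chilbert_space \<Rightarrow> 'a"
  shows "bounded_clinear T \<Longrightarrow> bounded_clinear (T ^^ n)"
proof (induction n)
  case 0 show ?case by (simp add: bounded_clinear_def id_def)
next
  case (Suc n)
  then show ?case by (auto simp: bounded_clinear_def intro: bounded_linear_compose)
qed

context
  fixes E :: "'x::chilbert_space \<Rightarrow> 'y::chilbert_space" and T :: "'x \<Rightarrow> 'x"
  assumes E: "bounded_clinear E" and T: "bounded_clinear T" and an: "analytic_output_pair E T"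
begin

lemma obs_op_summable: "z \<in> \<bbbD> \<Longrightarrow> summable (\<lambda>n. z ^ n *\<^sub>C E ((T ^^ n) x))"
  using an by (simp add: analytic_output_pair_def)

lemma obs_op_linear:
  "obs_op E T (x + x') z = obs_op E T x z + obs_op E T x' z"
  "obs_op E T (c *\<^sub>C x) z = c *\<^sub>C obs_op E T x z"
proof -
  note lin = bounded_clinear_simps[OF E] bounded_clinear_simps[OF bounded_clinear_funpow[OF T]]
  show "obs_op E T (x + x') z = obs_op E T x z + obs_op E T x' z"
    using obs_op_summable[of z x] obs_op_summable[of z x']
    by (cases "z \<in> \<bbbD>") (simp_all add: obs_op_def on_disk_def lin scaleC_add_right suminf_add)
  show "obs_op E T (c *\<^sub>C x) z = c *\<^sub>C obs_op E T x z"
  proof (cases "z \<in> \<bbbD>")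
    case True
    have "(\<Sum>n. z ^ n *\<^sub>C E ((T ^^ n) (c *\<^sub>C x))) = (\<Sum>n. c *\<^sub>C z ^ n *\<^sub>C E ((T ^^ n) x))"
      by (simp add: lin scaleC_scaleC mult.commute)
    also have "\<dots> = c *\<^sub>C (\<Sum>n. z ^ n *\<^sub>C E ((T ^^ n) x))"
      by (rule bounded_linear.suminf[OF bounded_linear_scaleC obs_op_summable[OF True], symmetric])
    finally show ?thesis using True by (simp add: obs_op_def on_disk_def)
  qed (simp add: obs_op_def on_disk_def)
qed

lemma obs_op_shift: "z \<in> \<bbbD> \<Longrightarrow> obs_op E T x z = E x + z *\<^sub>C obs_op E T (T x) z"
proof -
  assume z: "z \<in> \<bbbD>"
  have "(\<Sum>n. z ^ Suc n *\<^sub>C E ((T ^^ Suc n) x)) = (\<Sum>n. z *\<^sub>C z ^ n *\<^sub>C E ((T ^^ n) (T x)))"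
    by (simp add: scaleC_scaleC funpow_swap1)
  also have "\<dots> = z *\<^sub>C (\<Sum>n. z ^ n *\<^sub>C E ((T ^^ n) (T x)))"
    by (rule bounded_linear.suminf[OF bounded_linear_scaleC obs_op_summable[OF z], symmetric])
  finally show ?thesis
    using suminf_split_head[OF obs_op_summable[OF z, of x]] z
    by (simp add: obs_op_def on_disk_def algebra_simps)
qed

text \<open>The partial sums of the series are bounded operators that converge at each vector, hence
  are uniformly bounded.\<close>

lemma obs_op_bounded: "bounded_clinear (\<lambda>x. obs_op E T x z)"
proof (cases "z \<in> \<bbbD>")
  case True
  define f where "f n x = (\<Sum>k<n. z ^ k *\<^sub>C E ((T ^^ k) x))" for n x
  have lim: "(\<lambda>n. f n x) \<longlonglongrightarrow> obs_op E T x z" for x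
    using summable_LIMSEQ[OF obs_op_summable[OF True, of x]] True by (simp add: f_def obs_op_def on_disk_def)
  obtain C where C: "C \<ge> 0" "\<And>n x. norm (f n x) \<le> C * norm x"
  proof (rule uniform_boundedness[of UNIV f])
    show "bounded_linear (f n)" for n unfolding f_def
      by (intro bounded_linear_sum bounded_linear_compose[OF bounded_linear_scaleC]
          bounded_linear_compose[OF bounded_clinear_bounded_linear[OF E]]
          bounded_clinear_bounded_linear bounded_clinear_funpow T)
    show "\<exists>B. \<forall>i\<in>UNIV. norm (f i x) \<le> B" for x
      using Bseq_def convergent_imp_Bseq[OF convergentI[OF lim]] by (metis)
  qed auto
  have "norm (obs_op E T x z) \<le> norm x * C" for x
    using LIMSEQ_le_const2[OF tendsto_norm[OF lim[of x]], of "C * norm x"] C(2) by (simp add: mult.commute)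
  then show ?thesis by (rule bounded_clinearI[OF obs_op_linear])
qed (auto simp: obs_op_off intro: bounded_clinearI[of _ 0])

end

locale AIP_data = dBR_space S H ip
  for S :: "complex \<Rightarrow> 'u::chilbert_space \<Rightarrow> 'y::chilbert_space"
    and H :: "(complex \<Rightarrow> 'y) set" and ip +
  fixes T :: "'x::chilbert_space \<Rightarrow> 'x" and E :: "'x \<Rightarrow> 'y" and N :: "'x \<Rightarrow> 'u"
  assumes adm: "AIP_admissible H ip S T E N"
begin

abbreviation "M \<equiv> M_F S T E N"

lemma T_clinear: "bounded_clinear T" and E_clinear: "bounded_clinear E" and N_clinear: "bounded_clinear N"
  and an: "analytic_output_pair E T" "analytic_output_pair N T" and M_mem: "M x \<in> H"
  using adm by (auto simp: AIP_admissible_def)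

lemma M_disk: "z \<in> \<bbbD> \<Longrightarrow> M x z = obs_op E T x z - S z (obs_op N T x z)"
  by (simp add: M_F_def on_disk_def)

lemma M_add: "M (x + x') = M x + M x'"
  by (rule fun_eqI)
    (simp_all add: M_mem HS.mem M_disk obs_op_linear[OF E_clinear T_clinear an(1)] obs_op_linear[OF N_clinear T_clinear an(2)] S_simps)

lemma M_scale: "M (c *\<^sub>C x) = c *\<^sub>C M x"
  by (rule fun_eqI)
    (simp_all add: M_mem HS.mem M_disk obs_op_linear[OF E_clinear T_clinear an(1)] obs_op_linear[OF N_clinear T_clinear an(2)] S_simps
      scaleC_diff_right)

text \<open>Splitting the constant terms off both power series gives F x + S N x = E x + z F T x:
  the data form a trajectory of the shift.\<close>

lemma shift_M: "shift (M x) (N x) (M (T x)) (E x)"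
  unfolding shift_def
  by (simp add: M_mem M_disk obs_op_shift[OF E_clinear T_clinear an(1), of _ x] obs_op_shift[OF N_clinear T_clinear an(2), of _ x]
      S_simps scaleC_diff_right algebra_simps)

lemma M_eval_bounded: "z \<in> \<bbbD> \<Longrightarrow> bounded_clinear (\<lambda>x. M x z)"
proof -
  assume z: "z \<in> \<bbbD>"
  have "bounded_linear (\<lambda>x. M x z)" unfolding M_disk[OF z]
    by (intro bounded_linear_sub bounded_linear_compose[OF bounded_clinear_bounded_linear[OF S_clinear[OF z]]]
        bounded_clinear_bounded_linear obs_op_bounded E_clinear T_clinear N_clinear an)
  then show ?thesis by (simp add: bounded_clinear_def M_scale)
qed

text \<open>\<open>rk_adjoint\<close> is a definite description, so \<open>M\<close> must be bounded
  before it means anything. The functionals \<open>ip (M x) q\<close>, with \<open>q\<close> in the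
  unit ball of the span of the kernel functions, are bounded in \<open>x\<close> because point
  evaluations of \<open>M\<close> are, and pointwise bounded by \<open>HS.nm (M x)\<close>. The
  Riesz theorem on that span recovers \<open>M x\<close> together with its bound.\<close>

lemma M_bounded: obtains C where "C \<ge> 0" "\<And>x. HS.nm (M x) \<le> C * norm x"
proof -
  define \<kappa> where "\<kappa> = (\<lambda>(w, y). if w \<in> \<bbbD> then ker w y else 0)"
  define Q where "Q = {q. (q, q) \<in> lin_pairs \<kappa> \<kappa>}"
  have \<kappa>: "\<kappa> i \<in> H" for i by (auto simp: \<kappa>_def ker_mem split: prod.split)
  have diag: "p = q \<and> p \<in> H \<and> bounded_linear (\<lambda>x. ip (M x) p)" if "(p, q) \<in> lin_pairs \<kappa> \<kappa>" for p q
    using that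
  proof induction
    case zero show ?case using HS.zero_mem HS.ip_zero(2)[OF M_mem] by (simp add: zero_fun_def)
  next
    case (step p q a i)
    have "bounded_linear (\<lambda>x. ip (M x) (\<kappa> i))"
    proof -
      obtain w y where i: "i = (w, y)" by (metis surj_pair)
      show ?thesis
      proof (cases "w \<in> \<bbbD>")
        case True
        then have "(\<lambda>x. ip (M x) (\<kappa> i)) = (\<lambda>x. cinner (M x w) y)" by (simp add: i \<kappa>_def ker M_mem)
        then show ?thesis
          using bounded_linear_compose[OF bounded_bilinear.bounded_linear_left[OF bounded_bilinear_cinner]
              bounded_clinear_bounded_linear[OF M_eval_bounded[OF True]]] by simp
      next
        case False
        then have "\<kappa> i = 0" by (simp add: i \<kappa>_def)
        then show ?thesis by (simp add: M_mem)
      qed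
    qed
    then have "bounded_linear (\<lambda>x. ip (M x) p + cnj a * ip (M x) (\<kappa> i))"
      using step by (intro bounded_linear_add bounded_linear_const_mult) auto
    moreover have m: "p + a *\<^sub>C \<kappa> i \<in> H" using step by (intro HS.mem \<kappa>) auto
    moreover have "ip (M x) (p + a *\<^sub>C \<kappa> i) = ip (M x) p + cnj a * ip (M x) (\<kappa> i)" for x
      using conjunct1[OF conjunct2[OF step.IH]]
      by (simp only: HS.ip_add_right HS.ip_scale_right HS.scale_mem M_mem \<kappa>)
    ultimately show ?case using step.IH by (simp only: simp_thms)
  qed
  have Q: "q \<in> H" "bounded_linear (\<lambda>x. ip (M x) q)" if "q \<in> Q" for q using diag that by (auto simp: Q_def)
  obtain C where C: "C \<ge> 0" "\<And>q x. q \<in> {q \<in> Q. HS.nm q \<le> 1} \<Longrightarrow> cmod (ip (M x) q) \<le> C * norm x"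
  proof (rule uniform_boundedness[of "{q \<in> Q. HS.nm q \<le> 1}" "\<lambda>q x. ip (M x) q"])
    show "\<exists>B. \<forall>q\<in>{q \<in> Q. HS.nm q \<le> 1}. norm (ip (M x) q) \<le> B" for x
    proof (intro exI ballI)
      fix q assume q: "q \<in> {q \<in> Q. HS.nm q \<le> 1}"
      have "cmod (ip (M x) q) \<le> HS.nm (M x) * HS.nm q" using q Q by (intro HS.cauchy_schwarz M_mem) auto
      also have "\<dots> \<le> HS.nm (M x) * 1" using q M_mem by (intro mult_left_mono) auto
      finally show "norm (ip (M x) q) \<le> HS.nm (M x)" by simp
    qed
  qed (use Q in auto)
  have Q_scale: "a *\<^sub>C q \<in> Q" if "q \<in> Q" for a q using lin_pairs_scale that by (auto simp: Q_def)
  have C': "cmod (ip q (M x)) \<le> C * norm x * HS.nm q" if q: "q \<in> Q" for q x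
  proof (cases "q = 0")
    case False
    then have n: "0 < HS.nm q" using HS.nm_eq_0[OF Q(1)[OF q]] HS.nm_nonneg[OF Q(1)[OF q]] by linarith
    have "cmod (ip (M x) (of_real (1 / HS.nm q) *\<^sub>C q)) \<le> C * norm x"
      using n q by (intro C) (auto simp: Q_scale HS.nm_scale Q norm_divide)
    then show ?thesis
      using n q HS.ip_commute[OF M_mem Q(1)[OF q], of x]
      by (simp add: HS.ip_algebra Q M_mem norm_divide norm_mult field_simps)
  qed (simp add: M_mem)
  have "HS.nm (M x) \<le> C * norm x" for x
  proof -
    obtain g where g: "g \<in> H" "HS.nm g \<le> C * norm x"
      "\<And>q c. (q, c) \<in> (\<lambda>q. (q, ip q (M x))) ` Q \<Longrightarrow> ip q g = c"
    proof (rule HS.riesz_relation[of "(\<lambda>q. (q, ip q (M x))) ` Q" "C * norm x"])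
      have "0 \<in> Q" by (simp add: Q_def lin_pairs.zero)
      then show "(0, 0) \<in> (\<lambda>q. (q, ip q (M x))) ` Q" by (force simp: M_mem)
      fix q c q' c' a
      assume 1: "(q, c) \<in> (\<lambda>q. (q, ip q (M x))) ` Q"
      then show "(a *\<^sub>C q, a * c) \<in> (\<lambda>q. (q, ip q (M x))) ` Q"
        by (auto simp: image_iff Q_scale HS.ip_algebra Q M_mem)
      assume 2: "(q', c') \<in> (\<lambda>q. (q, ip q (M x))) ` Q"
      have "q + q' \<in> Q" using 1 2 lin_pairs_add by (auto simp: Q_def)
      then show "(q + q', c + c') \<in> (\<lambda>q. (q, ip q (M x))) ` Q"
        using 1 2 by (auto simp: image_iff HS.ip_algebra Q M_mem)
    qed (use C C' Q in auto)
    have "g = M x"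
    proof (rule fun_eqI)
      fix z :: complex assume z: "z \<in> \<bbbD>"
      have "cinner (g z) y = cinner (M x z) y" for y
      proof -
        have "ker z y \<in> Q" using lin_pairs_gen[of \<kappa> "(z, y)" \<kappa>] z by (simp add: Q_def \<kappa>_def)
        then have "ip (ker z y) g = ip (ker z y) (M x)" using g(3) by blast
        then show ?thesis
          using HS.ip_commute[OF g(1) ker_mem[OF z], of y] HS.ip_commute[OF M_mem[of x] ker_mem[OF z, of y]]
            ker[OF z g(1), of y] ker[OF z M_mem, of x y]
          by simp
      qed
      then show "g z = M x z" by (rule cinner_extensionality)
    qed (simp_all add: g M_mem)
    then show ?thesis using g by simp
  qed
  then show ?thesis using that C by blast
qed

lemma M_adjoint:
  assumes f: "f \<in> H" shows "ip (M x) f = cinner x (rk_adjoint ip M f)"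
proof -
  interpret X: hspace "UNIV :: 'x set" cinner by (rule hspace_closed) simp_all
  obtain C where C: "C \<ge> 0" "\<And>x. HS.nm (M x) \<le> C * norm x" by (rule M_bounded) blast
  obtain v where v: "\<And>x. cinner x v = ip (M x) f"
  proof (rule X.riesz[of "\<lambda>x. ip (M x) f" "C * HS.nm f"])
    show "cmod (ip (M x) f) \<le> C * HS.nm f * X.nm x" for x
      using HS.cauchy_schwarz[OF M_mem f, of x] mult_right_mono[OF C(2), of "HS.nm f" x] f
      by (simp add: nm_cinner mult_ac)
  qed (use f C in \<open>auto simp: M_add M_scale HS.ip_algebra M_mem\<close>)
  have "\<forall>x. ip (M x) f = cinner x (rk_adjoint ip M f)"
    unfolding rk_adjoint_def
  proof (rule theI[of _ v])
    fix w assume w: "\<forall>x. ip (M x) f = cinner x w"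
    show "w = v" by (rule cinner_extensionality_right) (metis w v)
  qed (simp add: v)
  then show ?thesis by blast
qed

lemma M_Gram:
  assumes "\<And>a b. cinner (R a) b = cinner a (R b)" "R \<circ> R = gram_op ip S T E N"
  shows "ip (M x) (M x') = cinner (R x) (R x')"
proof -
  have "R (R x') = rk_adjoint ip M (M x')" using fun_cong[OF assms(2), of x'] by (simp add: gram_op_def)
  then show ?thesis by (simp add: M_adjoint[OF M_mem] assms(1))
qed

end

text \<open>Polarization: real values of the quadratic form at \<open>a + b\<close> and
  \<open>a + \<i> *\<^sub>C b\<close> determine both parts of the sesquilinear form.\<close>

lemma positive_op_symmetric:
  assumes "positive_op R" shows "cinner (R a) b = cinner a (R b)"
proof -
  have R: "bounded_clinear R" and Im: "\<And>x. Im (cinner (R x) x) = 0"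
    using assms by (auto simp: positive_op_def)
  note lin = bounded_clinear_simps[OF R]
  have "Im (cinner (R a) b) + Im (cinner (R b) a) = 0"
    using Im[of "a + b"] Im[of a] Im[of b] by (simp add: lin cinner_algebra)
  moreover have "Re (cinner (R a) b) = Re (cinner (R b) a)"
    using Im[of "a + \<i> *\<^sub>C b"] Im[of a] Im[of b] by (simp add: lin cinner_algebra)
  ultimately have "cinner (R a) b = cnj (cinner (R b) a)" by (simp add: complex_eq_iff)
  then show ?thesis by (metis cinner_commute)
qed

section \<open>Splitting off the known part of the shift\<close>

text \<open>The last three assumptions record the construction of \<open>U\<close>: every
  \<open>d\<close> comes from an element of \<Delta>, trajectories with \<open>e = 0\<close> and
  \<open>d = 0\<close> start in the domain of V, and vectors orthogonal to the range of V are
  reached from the port \<open>e\<close> alone.\<close>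

locale AIP_loading = AIP_data S H ip T E N + interpolation_loading X U R T E N
  for S :: "complex \<Rightarrow> 'u::chilbert_space \<Rightarrow> 'y::chilbert_space"
    and H :: "(complex \<Rightarrow> 'y) set" and ip
    and T :: "'x::chilbert_space \<Rightarrow> 'x" and E :: "'x \<Rightarrow> 'y" and N :: "'x \<Rightarrow> 'u"
    and X :: "'x set" and R :: "'x \<Rightarrow> 'x"
    and U :: "'x \<times> 'u \<times> 'e::chilbert_space \<Rightarrow> 'x \<times> 'y \<times> 'd::chilbert_space" +
  assumes R_sq: "R \<circ> R = gram_op ip S T E N"
    and sys_input: "\<exists>a u. sys a u 0 0 0 d"
    and sys_domain: "sys a u 0 a' y 0 \<Longrightarrow> (a, u) \<in> closure (range (\<lambda>x. (R x, N x)))"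
    and sys_output: "a \<in> X \<Longrightarrow> (\<And>x. cinner a (R (T x)) + cinner y (E x) = 0) \<Longrightarrow> \<exists>e. sys 0 0 e a y 0"
begin

lemma Gram: "ip (M x) (M x') = cinner (R x) (R x')"
  by (rule M_Gram[OF R_sym R_sq])

lemma HX: "hspace X cinner"
  by (rule hspace_closed[OF X])

definition H0 :: "(complex \<Rightarrow> 'y) set" where
  "H0 = {k \<in> H. \<forall>x. ip k (M x) = 0}"

lemma H0_hspace: "hspace H0 ip"
proof (rule hspace_subset[OF HS.hspace_axioms])
  show "f \<in> H0" if F: "\<And>n. F n \<in> H0" "f \<in> H" "(\<lambda>n::nat. HS.nm (F n - f)) \<longlonglongrightarrow> 0" for F f
  proof -
    have "ip f (M x) = 0" for x
    proof -
      have "(\<lambda>n. ip (F n) (M x)) \<longlonglongrightarrow> ip f (M x)"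
        using F by (intro HS.ip_tendsto M_mem) (auto simp: H0_def)
      moreover have "ip (F n) (M x) = 0" for n using F(1)[of n] by (simp add: H0_def)
      ultimately show ?thesis by (simp add: LIMSEQ_const_iff)
    qed
    then show ?thesis using F(2) by (simp add: H0_def)
  qed
qed (auto simp: H0_def HS.mem HS.ip_algebra M_mem simp del: zero_fun_apply)

lemma shift_at: "shift f u g y \<Longrightarrow> z \<in> \<bbbD> \<Longrightarrow> z *\<^sub>C g z + y = f z + S z u"
  by (simp add: shift_def)

lemma H0_H: "k \<in> H0 \<Longrightarrow> k \<in> H"
  by (simp add: H0_def)

text \<open>\<open>J\<close> is the isometry from \<open>X\<close> onto the closed range of \<open>M\<close> with \<open>J (R x) = M x\<close>.\<close>

definition is_J :: "'x \<Rightarrow> (complex \<Rightarrow> 'y) \<Rightarrow> bool" where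
  "is_J a g \<longleftrightarrow> g \<in> H \<and> (\<forall>x. ip g (M x) = cinner a (R x)) \<and> (\<forall>k\<in>H0. ip k g = 0)"

definition J :: "'x \<Rightarrow> complex \<Rightarrow> 'y" where
  "J a = (SOME g. is_J a g)"

lemma is_J_exists: assumes "a \<in> X" obtains g where "is_J a g" "HS.nm g \<le> norm a"
proof -
  obtain g where "g \<in> H" "HS.nm g \<le> hspace.nm cinner a" "\<And>x. ip g (M x) = cinner a (R x)"
    "\<And>h. h \<in> H \<Longrightarrow> (\<And>x. ip h (M x) = 0) \<Longrightarrow> ip h g = 0"
    by (rule gram_transfer[of X cinner H ip R M a])
      (use assms in \<open>simp_all add: HX HS.hspace_axioms R_mem M_mem Gram\<close>)
  then show ?thesis using that[of g] by (simp add: is_J_def H0_def nm_cinner)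
qed

lemma is_J_lin: "is_J a g \<Longrightarrow> is_J b h \<Longrightarrow> is_J (a + c *\<^sub>C b) (g + c *\<^sub>C h)"
  unfolding is_J_def by (simp add: HS.mem HS.ip_algebra M_mem cinner_algebra H0_H)

lemma is_J_unique: assumes "is_J a g" "is_J a h" shows "g = h"
proof -
  have "is_J 0 (g - h)" using is_J_lin[OF assms, of "-1"] by (simp add: scaleC_minus_one)
  then have m: "g - h \<in> H0" and "ip (g - h) (g - h) = 0" by (auto simp: is_J_def H0_def)
  then have "HS.nm (g - h) = 0" by (simp add: HS.nm_def)
  then have "g - h = 0" using HS.nm_eq_0[OF H0_H[OF m]] by simp
  then show ?thesis by simp
qed

lemma is_J: assumes "a \<in> X" shows "is_J a (J a)"
proof -
  obtain g where "is_J a g" by (rule is_J_exists[OF assms])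
  then show ?thesis unfolding J_def by (rule someI[of "is_J a" g])
qed

lemma J_eq: "is_J a g \<Longrightarrow> a \<in> X \<Longrightarrow> J a = g"
  by (rule is_J_unique[OF is_J])

lemma J_mem: "a \<in> X \<Longrightarrow> J a \<in> H"
  using is_J by (simp add: is_J_def)

lemma J_lin: "a \<in> X \<Longrightarrow> b \<in> X \<Longrightarrow> J (a + c *\<^sub>C b) = J a + c *\<^sub>C J b"
  by (intro J_eq is_J_lin is_J X_mem)

lemma J_add: "a \<in> X \<Longrightarrow> b \<in> X \<Longrightarrow> J (a + b) = J a + J b"
  using J_lin[of a b 1] by simp

lemma J_diff: "a \<in> X \<Longrightarrow> b \<in> X \<Longrightarrow> J (a - b) = J a - J b"
  using J_lin[of a b "-1"] by (simp add: scaleC_minus_one)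

lemma J_zero: "J 0 = 0"
  using J_diff[OF X_mem(1) X_mem(1)] by simp

lemma J_scale: "a \<in> X \<Longrightarrow> J (c *\<^sub>C a) = c *\<^sub>C J a"
  using J_lin[OF X_mem(1), of a c] by (simp add: J_zero)

lemma J_R: "J (R x) = M x"
proof (rule J_eq[OF _ R_mem])
  have "ip k (M x) = 0" if "k \<in> H0" for k using that by (simp add: H0_def)
  then show "is_J (R x) (M x)" by (simp add: is_J_def M_mem Gram)
qed

lemma ip_J_H0: "a \<in> X \<Longrightarrow> k \<in> H0 \<Longrightarrow> ip k (J a) = 0" "a \<in> X \<Longrightarrow> k \<in> H0 \<Longrightarrow> ip (J a) k = 0"
proof -
  assume a: "a \<in> X" and k: "k \<in> H0"
  show "ip k (J a) = 0" using is_J[OF a] k by (simp add: is_J_def)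
  then show "ip (J a) k = 0" using HS.ip_commute[OF H0_H[OF k] J_mem[OF a]] by simp
qed

lemma X_eqI:
  assumes "a \<in> X" "b \<in> X" "\<And>x. cinner a (R x) = cinner b (R x)" shows "a = b"
proof -
  have "cinner (R (a - b)) x = 0" for x using assms(3)[of x] by (simp add: R_sym cinner_algebra)
  then have "R (a - b) = 0" by (intro cinner_extensionality[of _ 0]) simp
  then show ?thesis using R_inj[of "a - b"] assms X_mem by simp
qed

text \<open>Gram transfer in the direction opposite to \<open>J\<close>: the adjoint of
  \<open>J\<close>. It yields both the orthogonal projection onto the range of \<open>J\<close> and
  the lower bound that makes \<open>J\<close> isometric.\<close>

lemma adjoint_J: assumes "f \<in> H"
  obtains a where "a \<in> X" "norm a \<le> HS.nm f" "\<And>x. cinner a (R x) = ip f (M x)"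
proof -
  obtain a where "a \<in> X" "hspace.nm cinner a \<le> HS.nm f" "\<And>x. cinner a (R x) = ip f (M x)"
    by (rule gram_transfer[of H ip X cinner M R f])
      (use assms in \<open>simp_all add: HX HS.hspace_axioms R_mem M_mem Gram\<close>)
  then show ?thesis using that by (simp add: nm_cinner)
qed

lemma nm_J: assumes a: "a \<in> X" shows "HS.nm (J a) = norm a"
proof (rule antisym)
  obtain g where "is_J a g" "HS.nm g \<le> norm a" using is_J_exists[OF a] .
  then show "HS.nm (J a) \<le> norm a" using J_eq a by blast
  obtain b where b: "b \<in> X" "norm b \<le> HS.nm (J a)" "\<And>x. cinner b (R x) = ip (J a) (M x)"
    using adjoint_J[OF J_mem[OF a]] by metis
  have "b = a" using X_eqI[OF b(1) a] b(3) is_J[OF a] by (simp add: is_J_def)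
  then show "norm a \<le> HS.nm (J a)" using b(2) by simp
qed

lemma ip_J: assumes a: "a \<in> X" and b: "b \<in> X" shows "ip (J a) (J b) = cinner a b"
proof -
  have Re: "Re (ip (J a) (J c)) = Re (cinner a c)" if c: "c \<in> X" for c
  proof -
    have "(HS.nm (J a + J c))\<^sup>2 = (norm (a + c))\<^sup>2"
      using nm_J[of "a + c"] a c by (simp add: J_add X_mem)
    also have "\<dots> = (norm a)\<^sup>2 + (norm c)\<^sup>2 + 2 * Re (cinner a c)"
      by (simp add: power2_norm_eq_inner inner_add inner_eq_Re_cinner[symmetric] inner_commute)
    finally show ?thesis using a c by (simp add: HS.nm_add_sq J_mem nm_J)
  qed
  show ?thesis
    using Re[OF b] Re[OF X_mem(3)[OF b, of \<i>]] a b
    by (simp add: complex_eq_iff J_scale HS.ip_algebra J_mem cinner_algebra)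
qed

lemma decomposition:
  assumes f: "f \<in> H" obtains a k where "a \<in> X" "k \<in> H0" "f = J a + k"
proof -
  obtain a where a: "a \<in> X" "\<And>x. cinner a (R x) = ip f (M x)" using adjoint_J[OF f] by metis
  have "f - J a \<in> H0" using is_J[OF a(1)] f a
    unfolding H0_def is_J_def by (simp add: HS.mem HS.ip_algebra M_mem)
  then show ?thesis using that[of a "f - J a"] a by simp
qed

lemma nm_decomposition:
  "a \<in> X \<Longrightarrow> k \<in> H0 \<Longrightarrow> (HS.nm (J a + k))\<^sup>2 = (norm a)\<^sup>2 + (HS.nm k)\<^sup>2"
  by (simp add: HS.nm_add_sq J_mem H0_H nm_J ip_J_H0)

lemma ip_decomposition:
  "a \<in> X \<Longrightarrow> k \<in> H0 \<Longrightarrow> b \<in> X \<Longrightarrow> l \<in> H0 \<Longrightarrow> ip (J a + k) (J b + l) = cinner a b + ip k l"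
  by (simp add: HS.ip_algebra HS.mem J_mem H0_H ip_J ip_J_H0)

text \<open>True on the data by \<open>sys_data\<close> and \<open>shift_M\<close>. A general
  trajectory without \<open>e\<close> and \<open>d\<close> starts in the domain of V, so data
  approximate its start; norm preservation of \<open>U\<close> and contractivity of the shift carry
  both images to the limit.\<close>

lemma shift_J:
  assumes s: "sys a u 0 a' y 0" shows "shift (J a) u (J a') y"
proof -
  have a: "a \<in> X" "a' \<in> X" using sys_mem[OF s] by auto
  obtain g w where W: "shift (J a) u g w" using W.W_total[OF J_mem[OF a(1)]] by metis
  have g: "g \<in> H" using W by (simp add: shift_def)
  have bound: "HS.nm (g - J a') \<le> 2 * \<epsilon> \<and> norm (w - y) \<le> 2 * \<epsilon>" if "\<epsilon> > 0" for \<epsilon>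
  proof -
    have "\<exists>p\<in>range (\<lambda>x. (R x, N x)). dist p (a, u) < \<epsilon>"
      using sys_domain[OF s] that by (simp only: closure_approachable)
    then obtain x where "dist (R x, N x) (a, u) < \<epsilon>" by (elim bexE rangeE) simp
    then have n: "norm (R x - a, N x - u) < \<epsilon>" by (simp add: dist_norm)
    have "(norm (R x - a, N x - u))\<^sup>2 \<le> \<epsilon>\<^sup>2" using n by (intro power_mono) auto
    then have e: "(norm (R x - a))\<^sup>2 + (norm (N x - u))\<^sup>2 \<le> \<epsilon>\<^sup>2" by (simp add: norm_Pair_square)
    have le: "r \<le> \<epsilon> \<and> r' \<le> \<epsilon>" if "r\<^sup>2 + r'\<^sup>2 \<le> \<epsilon>\<^sup>2" for r r'
    proof -
      have "r\<^sup>2 \<le> \<epsilon>\<^sup>2" "r'\<^sup>2 \<le> \<epsilon>\<^sup>2" using that zero_le_power2[of r] zero_le_power2[of r'] by linarith+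
      then show ?thesis using \<open>\<epsilon> > 0\<close> power2_le_imp_le[of r \<epsilon>] power2_le_imp_le[of r' \<epsilon>] by simp
    qed
    have "(norm (R (T x) - a'))\<^sup>2 + (norm (E x - y))\<^sup>2 \<le> \<epsilon>\<^sup>2"
      using sys_norm[OF sys_diff[OF sys_data[of x] s]] e by simp
    then have 1: "norm (R (T x) - a') \<le> \<epsilon>" "norm (E x - y) \<le> \<epsilon>"
      by (simp_all add: le)
    have "M x - J a = J (R x - a)" using a by (simp add: J_diff R_mem J_R)
    then have nMJ: "HS.nm (M x - J a) = norm (R x - a)" using a nm_J[of "R x - a"] by (simp add: X_mem R_mem)
    have "(HS.nm (M (T x) - g))\<^sup>2 + (norm (E x - w))\<^sup>2 \<le> \<epsilon>\<^sup>2"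
      using W.W_contr[OF W.W_diff[OF shift_M[of x] W]] e by (simp add: nMJ)
    then have 2: "HS.nm (M (T x) - g) \<le> \<epsilon>" "norm (E x - w) \<le> \<epsilon>"
      by (simp_all add: le)
    have "M (T x) - J a' = J (R (T x) - a')" using a by (simp add: J_diff R_mem J_R)
    then have 3: "HS.nm (M (T x) - J a') \<le> \<epsilon>" using 1 nm_J[of "R (T x) - a'"] a by (simp add: X_mem R_mem)
    have "HS.nm (g - J a') \<le> HS.nm (g - M (T x)) + HS.nm (M (T x) - J a')"
      by (rule HS.nm_triangle_diff[OF g M_mem J_mem[OF a(2)]])
    moreover have "norm (w - y) \<le> norm (E x - w) + norm (E x - y)"
      using norm_triangle_ineq4[of "E x - y" "E x - w"] by simp
    ultimately show ?thesis using 1 2 3 HS.nm_minus_commute[OF g M_mem, of "T x"] by simp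
  qed
  have "HS.nm (g - J a') \<le> 0"
    by (rule field_le_epsilon) (use bound[of "e / 2" for e] in simp)
  moreover have "norm (w - y) \<le> 0"
    by (rule field_le_epsilon) (use bound[of "e / 2" for e] in simp)
  moreover have "0 \<le> HS.nm (g - J a')" using g a by (intro HS.nm_nonneg HS.mem J_mem)
  ultimately have "HS.nm (g - J a') = 0" "w = y" by auto
  moreover have "g - J a' \<in> H" using g a by (intro HS.mem J_mem)
  ultimately have "g = J a'" "w = y" using HS.nm_eq_0[of "g - J a'"] by auto
  then show ?thesis using W by simp
qed

text \<open>The input \<open>d\<close> stands for the element \<open>(a, u)\<close> of \<Delta> that
  \<open>U\<close> sends to it, the output \<open>e\<close> for the element \<open>(b, y)\<close> of
  \<open>\<Delta>\<^sub>*\<close> that \<open>U\<close> produces from it. The relation is the shift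
  between the complements of the domain and range of V.\<close>

definition rest :: "(complex \<Rightarrow> 'y) \<Rightarrow> 'd \<Rightarrow> (complex \<Rightarrow> 'y) \<Rightarrow> 'e \<Rightarrow> bool" where
  "rest k d k' e \<longleftrightarrow> k \<in> H0 \<and> k' \<in> H0 \<and>
    (\<exists>a u b y. sys a u 0 0 0 d \<and> sys 0 0 e b y 0 \<and> shift (J a + k) u (J b + k') y)"

text \<open>Coupling \<open>U\<close> with \<open>rest\<close> recovers the shift: removing the
  \<Delta> part of the input and the \<open>\<Delta>\<^sub>*\<close> part of the output leaves a
  trajectory without \<open>e\<close> and \<open>d\<close>, where \<open>shift_J\<close>
  applies.\<close>

lemma shift_rest:
  assumes s: "sys a u e a' y d" and r: "rest k d k' e" shows "shift (J a + k) u (J a' + k') y"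
proof -
  obtain b v c w where 1: "sys b v 0 0 0 d" "sys 0 0 e c w 0" "shift (J b + k) v (J c + k') w"
    using r by (auto simp: rest_def)
  have m: "a \<in> X" "a' \<in> X" "b \<in> X" "c \<in> X" using sys_mem[OF s] sys_mem[OF 1(1)] sys_mem[OF 1(2)] by auto
  have "sys (a - b - 0) (u - v - 0) (e - 0 - e) (a' - 0 - c) (y - 0 - w) (d - d - 0)"
    by (intro sys_diff s 1)
  then have "shift (J (a - b)) (u - v) (J (a' - c)) (y - w)" by (intro shift_J) simp
  from W.W_add[OF this 1(3)] show ?thesis using m by (simp add: J_diff algebra_simps)
qed

lemma rest_lin:
  assumes "rest k d k' e" "rest l c l' f"
  shows "rest (k + z *\<^sub>C l) (d + z *\<^sub>C c) (k' + z *\<^sub>C l') (e + z *\<^sub>C f)"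
proof -
  interpret H0: hspace H0 ip by (rule H0_hspace)
  obtain a u b y where 1: "sys a u 0 0 0 d" "sys 0 0 e b y 0" "shift (J a + k) u (J b + k') y"
    using assms(1) by (auto simp: rest_def)
  obtain a' u' b' y' where 2: "sys a' u' 0 0 0 c" "sys 0 0 f b' y' 0" "shift (J a' + l) u' (J b' + l') y'"
    using assms(2) by (auto simp: rest_def)
  have m: "a \<in> X" "b \<in> X" "a' \<in> X" "b' \<in> X"
    using sys_mem[OF 1(1)] sys_mem[OF 1(2)] sys_mem[OF 2(1)] sys_mem[OF 2(2)] by auto
  have "sys (a + z *\<^sub>C a') (u + z *\<^sub>C u') 0 0 0 (d + z *\<^sub>C c)"
    using sys_add[OF 1(1) sys_scale[OF 2(1), of z]] by simp
  moreover have "sys 0 0 (e + z *\<^sub>C f) (b + z *\<^sub>C b') (y + z *\<^sub>C y') 0"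
    using sys_add[OF 1(2) sys_scale[OF 2(2), of z]] by simp
  moreover have "shift (J (a + z *\<^sub>C a') + (k + z *\<^sub>C l)) (u + z *\<^sub>C u') (J (b + z *\<^sub>C b') + (k' + z *\<^sub>C l')) (y + z *\<^sub>C y')"
    using W.W_lin[OF 1(3) 2(3), of z] m by (simp add: J_lin scaleC_add_right add_ac)
  ultimately show ?thesis using assms unfolding rest_def by (meson H0.add_mem H0.scale_mem)
qed

lemma rest_total: assumes k: "k \<in> H0" shows "\<exists>k' e. rest k d k' e"
proof -
  obtain a u where 1: "sys a u 0 0 0 d" using sys_input by blast
  have a: "a \<in> X" using sys_mem[OF 1] by blast
  have m: "J a + k \<in> H" using a k by (intro HS.mem J_mem H0_H)
  obtain g y where W: "shift (J a + k) u g y" using W.W_total[OF m] by metis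
  then have "g \<in> H" by (simp add: shift_def)
  then obtain b k' where b: "b \<in> X" "k' \<in> H0" "g = J b + k'" by (rule decomposition)
  \<comment> \<open>The input is orthogonal to the data, on which the shift is isometric; so the
    output is orthogonal to their images and lies in \<open>\<Delta>\<^sub>*\<close> up to its
    component in \<open>H0\<close>.\<close>
  have "cinner b (R (T x)) + cinner y (E x) = 0" for x
  proof -
    have "ip g (M (T x)) + cinner y (E x) = 0"
    proof (rule W.W_isometric_orthogonal[OF W shift_M[of x]])
      have "(norm (R (T x)))\<^sup>2 + (norm (E x))\<^sup>2 = (norm (R x))\<^sup>2 + (norm (N x))\<^sup>2"
        using sys_norm[OF sys_data[of x]] by simp
      then show "(HS.nm (M (T x)))\<^sup>2 + (norm (E x))\<^sup>2 = (HS.nm (M x))\<^sup>2 + (norm (N x))\<^sup>2"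
        using Gram by (simp add: HS.nm_sq M_mem cinner_self)
      have "ip (J a + k) (M x) = cinner a (R x)"
        using is_J[OF a] k by (simp add: HS.ip_algebra J_mem a H0_H M_mem is_J_def) (simp add: H0_def)
      then show "ip (J a + k) (M x) + cinner u (N x) = 0"
        using sys_cinner[OF 1 sys_data[of x]] by simp
    qed
    moreover have "ip g (M (T x)) = cinner b (R (T x))"
      using is_J[OF b(1)] b(2) by (simp add: b(3) HS.ip_algebra J_mem b(1) H0_H M_mem is_J_def) (simp add: H0_def)
    ultimately show ?thesis by simp
  qed
  then obtain e where "sys 0 0 e b y 0" using sys_output[OF b(1)] by blast
  then show ?thesis using 1 W b k unfolding rest_def by blast
qed

lemma rest_contr: assumes "rest k d k' e" shows "(HS.nm k')\<^sup>2 + (norm e)\<^sup>2 \<le> (HS.nm k)\<^sup>2 + (norm d)\<^sup>2"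
proof -
  obtain a u b y where 1: "sys a u 0 0 0 d" "sys 0 0 e b y 0" "shift (J a + k) u (J b + k') y"
    using assms by (auto simp: rest_def)
  have m: "a \<in> X" "b \<in> X" "k \<in> H0" "k' \<in> H0" using sys_mem[OF 1(1)] sys_mem[OF 1(2)] assms by (auto simp: rest_def)
  show ?thesis using W.W_contr[OF 1(3)] sys_norm[OF 1(1)] sys_norm[OF 1(2)] m by (simp add: nm_decomposition)
qed

text \<open>Since the shift is determined pointwise, it suffices to test against the kernel functions,
  whose images under the shift are known.\<close>

lemma rest_coiso:
  assumes p: "p \<in> H0" and q: "q \<in> H0"
    and hyp: "\<And>k d k' e. rest k d k' e \<Longrightarrow> ip k' q + cinner e e0 = ip k p + cinner d d0"
  shows "rest p d0 q e0"
proof -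
  obtain a0 u0 where 1: "sys a0 u0 0 0 0 d0" using sys_input by blast
  obtain b0 y0 where 2: "sys 0 0 e0 b0 y0 0" using sys_blk(3) by blast
  have m: "a0 \<in> X" "b0 \<in> X" using sys_mem[OF 1] sys_mem[OF 2] by auto
  have mH: "J a0 + p \<in> H" "J b0 + q \<in> H" using m p q by (simp_all add: HS.add_mem J_mem H0_H)
  have "z *\<^sub>C (J b0 + q) z + y0 = (J a0 + p) z + S z u0" if z: "z \<in> \<bbbD>" for z
  proof (rule cinner_extensionality_right)
    fix y
    \<comment> \<open>Splitting the kernel function splits its image under the shift into an image
      under \<open>U\<close> and one under \<open>rest\<close>; unitarity handles the first and
      \<open>hyp\<close> the second, while \<open>shift_ker\<close> gives the total.\<close>
    obtain b k where b: "b \<in> X" "k \<in> H0" "ker z y = J b + k" using decomposition[OF ker_mem[OF z]] .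
    let ?u = "cadjoint (S z) y"
    obtain b' y' d where 3: "sys b ?u 0 b' y' d" using sys_exists[OF b(1)] by metis
    obtain k' e where 4: "rest k d k' e" using rest_total[OF b(2)] by metis
    obtain c w where 5: "sys 0 0 e c w 0" using sys_blk(3) by blast
    have 6: "sys b ?u e (b' + c) (y' + w) d" using sys_add[OF 3 5] by simp
    have k': "k' \<in> H0" using 4 by (simp add: rest_def)
    have m': "b' + c \<in> X" using sys_mem[OF 6] by simp
    have "shift (ker z y) ?u (J (b' + c) + k') (y' + w)" using shift_rest[OF 6 4] by (simp add: b(3))
    note 7 = shift_unique[OF this shift_ker[OF z]]
    have swap: "ip (ker z y) f = cinner y (f z)" if "f \<in> H" for f
      using HS.ip_commute[OF that ker_mem[OF z]] ker[OF z that, of y] cinner_commute[of "f z" y] by simp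
    have "cinner y (z *\<^sub>C (J b0 + q) z + y0) = cnj z * ip (ker z y) (J b0 + q) + cinner y y0"
      by (simp only: swap[OF mH(2)] cinner_algebra)
    also have "\<dots> = ip (cnj z *\<^sub>C ker z y) (J b0 + q) + cinner y y0"
      by (simp only: HS.ip_scale_left[OF ker_mem[OF z] mH(2)])
    also have "\<dots> = ip (J (b' + c) + k') (J b0 + q) + cinner (y' + w) y0" by (simp only: 7)
    also have "\<dots> = ip k' q + cinner e e0"
      using sys_cinner[OF 6 2] by (simp add: ip_decomposition m' k' m q)
    also have "\<dots> = ip k p + cinner d d0" by (rule hyp[OF 4])
    also have "\<dots> = ip (ker z y) (J a0 + p) + cinner ?u u0"
      using sys_cinner[OF 6 1] by (simp add: b(3) ip_decomposition b(1,2) m p)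
    also have "\<dots> = cinner y ((J a0 + p) z + S z u0)"
      by (simp only: swap[OF mH(1)] S_adj'[OF z] cinner_algebra)
    finally show "cinner y (z *\<^sub>C (J b0 + q) z + y0) = cinner y ((J a0 + p) z + S z u0)" .
  qed
  then have "shift (J a0 + p) u0 (J b0 + q) y0" using mH by (simp add: shift_def)
  then show ?thesis using 1 2 p q unfolding rest_def by blast
qed

end

sublocale AIP_loading \<subseteq> C: coisometric_colligation H0 ip rest
proof (intro coisometric_colligation.intro colligation.intro colligation_axioms.intro
    coisometric_colligation_axioms.intro H0_hspace)
  show "(hspace.nm ip k')\<^sup>2 + (norm e)\<^sup>2 \<le> (hspace.nm ip k)\<^sup>2 + (norm d)\<^sup>2" if "rest k d k' e" for k d k' e
    by (rule rest_contr[OF that])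
  show "k \<in> H0 \<and> k' \<in> H0" if "rest k d k' e" for k d k' e using that by (simp add: rest_def)
  show "rest p d0 q e0" if "p \<in> H0" "q \<in> H0"
    "\<And>k d k' e. rest k d k' e \<Longrightarrow> ip k' q + cinner e e0 = ip k p + cinner d d0" for p q e0 d0
    by (rule rest_coiso[OF that])
qed (rule rest_lin rest_total; assumption)+

section \<open>Closing the loop with the constructed load\<close>

context AIP_loading
begin

lemma tf_contraction: "z \<in> \<bbbD> \<Longrightarrow> contraction (C.tf z)"
  by (rule schur_contraction[OF C.tf_schur])

text \<open>The closed loop and the loop inside \<open>tf\<close> form a shift trajectory from
  \<open>z\<close> times a function to the same function; in the shift equation at \<open>z\<close>
  this function cancels, leaving the output equal to \<open>S z u\<close>.\<close>

lemma redheffer_tf: assumes z: "z \<in> \<bbbD>" shows "redheffer U X C.tf z = S z"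
proof
  fix u
  obtain a e d where 1: "sys (z *\<^sub>C a) u e a (redheffer U X C.tf z u) d" "e = C.tf z d"
    using loop_redheffer[where \<E> = C.tf, OF z tf_contraction[OF z]] by metis
  have "shift (J (z *\<^sub>C a) + z *\<^sub>C C.state z d) u (J a + C.state z d) (redheffer U X C.tf z u)"
    by (rule shift_rest[OF 1(1)]) (use C.tf[OF z] in \<open>simp add: 1(2)\<close>)
  from shift_at[OF this z] show "redheffer U X C.tf z u = S z u"
    using sys_mem[OF 1(1)] by (simp add: J_scale scaleC_add_right)
qed

lemma Gamma_tf: assumes z: "z \<in> \<bbbD>" and p: "p \<in> X" shows "Gamma_fun U X C.tf z p = J p z"
proof -
  obtain a e d where 1: "sys (z *\<^sub>C a + p) 0 e a (Gamma_fun U X C.tf z p) d" "e = C.tf z d"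
    using loop_Gamma[where \<E> = C.tf, OF z tf_contraction[OF z] p] by metis
  have "shift (J (z *\<^sub>C a + p) + z *\<^sub>C C.state z d) 0 (J a + C.state z d) (Gamma_fun U X C.tf z p)"
    by (rule shift_rest[OF 1(1)]) (use C.tf[OF z] in \<open>simp add: 1(2)\<close>)
  from shift_at[OF this z] show ?thesis
    using z sys_mem[OF 1(1)] p by (simp add: J_scale J_add X_mem scaleC_add_right S_simps add_ac)
qed

text \<open>A source \<open>k\<close> in the second summand reaches \<open>U\<close> as the signal
  \<open>obs k z\<close> added to the load output. After the same cancellation as for
  \<open>redheffer_tf\<close>, the output is the value of the source.\<close>

lemma G_tf: assumes z: "z \<in> \<bbbD>" and k: "k \<in> H0" shows "G_fun U X C.tf z (C.obs k z) = k z"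
proof -
  obtain a e d where 1: "sys (z *\<^sub>C a) 0 e a (G_fun U X C.tf z (C.obs k z)) d" "e = C.tf z d + C.obs k z"
    using loop_G[where \<E> = C.tf, OF z tf_contraction[OF z]] by metis
  let ?k = "C.state z d + C.ostate k z"
  have "rest (z *\<^sub>C ?k + k) d ?k e"
    using C.W_add[OF C.tf[OF z, of d] C.obs[OF z k]] by (simp add: 1(2) scaleC_add_right add.assoc)
  from shift_at[OF shift_rest[OF 1(1) this] z] show ?thesis
    using z sys_mem[OF 1(1)] by (simp add: J_scale scaleC_add_right S_simps add.assoc)
qed

lemma obs_inj: assumes "k \<in> H0" "l \<in> H0" "C.obs k = C.obs l" shows "k = l"
proof (rule fun_eqI[OF H0_H H0_H])
  show "k z = l z" if "z \<in> \<bbbD>" for z using G_tf[OF that assms(1)] G_tf[OF that assms(2)] assms(3) by simp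
qed (use assms in auto)

lemma rk_adjoint_J:
  assumes "a \<in> X" "k \<in> H0" shows "rk_adjoint ip M (J a + k) = R a"
proof (rule cinner_extensionality_right)
  fix x
  have m: "J a + k \<in> H" using assms by (intro HS.mem J_mem H0_H)
  have "cinner x (rk_adjoint ip M (J a + k)) = ip (J (R x) + 0) (J a + k)"
    by (simp add: M_adjoint[OF m, symmetric] J_R)
  also have "\<dots> = cinner (R x) a" by (subst ip_decomposition) (simp_all add: assms R_mem H0_H)
  finally show "cinner x (rk_adjoint ip M (J a + k)) = cinner x (R a)" by (simp add: R_sym)
qed

end

section \<open>The solution set and the target vector\<close>

context AIP_loading
begin

lemma parametrization:
  fixes xt :: 'x and HE and ipE :: "(complex \<Rightarrow> 'e) \<Rightarrow> (complex \<Rightarrow> 'e) \<Rightarrow> complex"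
  defines "B \<equiv> {h \<in> HE. rk_norm ipE h \<le> sqrt (1 - (norm xt)\<^sup>2)}"
    and "M_G \<equiv> \<lambda>h. on_disk (\<lambda>z. G_fun U X C.tf z (h z))"
    and "f \<equiv> \<lambda>h. on_disk (\<lambda>z. Gamma_fun U X C.tf z xt + G_fun U X C.tf z (h z))"
  assumes HE: "is_rkhs (dBR_kernel C.tf) HE ipE"
    and xt: "xt \<in> X" "x = R xt" "norm xt \<le> 1"
  shows "bij_betw f B (AIP_solutions H ip S T E N x)"
    and "\<And>h. h \<in> HE \<Longrightarrow> M_G h \<in> H \<and> rk_norm ip (M_G h) = rk_norm ipE h"
    and "\<And>h. h \<in> HE \<Longrightarrow> (rk_norm ip (f h))\<^sup>2 = (norm xt)\<^sup>2 + (rk_norm ipE h)\<^sup>2"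
proof -
  note nm = nm_rk_norm[OF HS.hspace_axioms, symmetric]
  have "C.obs k \<in> HE \<and> rk_norm ipE (C.obs k) = C.nm k" if "k \<in> H0" for k
    by (rule C.rkhs_obs(1)[OF HE _ that]) (rule obs_inj)
  then have obs: "C.obs k \<in> HE" "rk_norm ipE (C.obs k) = HS.nm k" if "k \<in> H0" for k
    using that by simp_all
  have surj: "\<exists>k\<in>H0. C.obs k = h" if "h \<in> HE" for h
    by (rule C.rkhs_obs(2)[OF HE _ that]) (rule obs_inj)
  have M_G: "M_G (C.obs k) = k" if "k \<in> H0" for k
    using that off_disk[OF H0_H] by (auto simp: M_G_def on_disk_def G_tf)
  have f: "f (C.obs k) = J xt + k" if "k \<in> H0" for k
    using that off_disk[OF H0_H] off_disk[OF J_mem[OF xt(1)]]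
    by (auto simp: f_def on_disk_def G_tf Gamma_tf xt(1))
  have mem: "J xt + k \<in> H" if "k \<in> H0" for k
    by (intro HS.add_mem J_mem[OF xt(1)] H0_H[OF that])
  have x1: "(norm xt)\<^sup>2 \<le> 1" using xt(3) by (simp add: power_le_one)
  \<comment> \<open>The interpolation condition sees only the component along \<open>J\<close>, and
    \<open>R\<close> is injective on \<open>X\<close>; orthogonality turns the norm bound into one
    on \<open>k\<close>.\<close>
  have sol: "J a + k \<in> AIP_solutions H ip S T E N x \<longleftrightarrow> a = xt \<and> HS.nm k \<le> sqrt (1 - (norm xt)\<^sup>2)"
    if "a \<in> X" "k \<in> H0" for a k
  proof -
    have "R a = x \<longleftrightarrow> a = xt"
    proof
      assume "R a = x"
      then have "R (a - xt) = 0" using xt(2) bounded_clinear_simps(2)[OF R] by simp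
      then show "a = xt" using R_inj[of "a - xt"] that(1) xt(1) X_mem by simp
    qed (simp add: xt)
    moreover have "HS.nm (J xt + k) \<le> 1 \<longleftrightarrow> HS.nm k \<le> sqrt (1 - (norm xt)\<^sup>2)"
    proof -
      have "HS.nm (J xt + k) \<le> 1 \<longleftrightarrow> (HS.nm (J xt + k))\<^sup>2 \<le> 1"
        using HS.nm_nonneg[OF mem[OF that(2)]] by (simp add: abs_square_le_1)
      also have "\<dots> \<longleftrightarrow> (HS.nm k)\<^sup>2 \<le> 1 - (norm xt)\<^sup>2"
        unfolding nm_decomposition[OF xt(1) that(2)] by linarith
      also have "\<dots> \<longleftrightarrow> HS.nm k \<le> sqrt (1 - (norm xt)\<^sup>2)"
      proof
        assume "HS.nm k \<le> sqrt (1 - (norm xt)\<^sup>2)"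
        from power_mono[OF this HS.nm_nonneg[OF H0_H[OF that(2)]], of 2]
        show "(HS.nm k)\<^sup>2 \<le> 1 - (norm xt)\<^sup>2" using x1 by simp
      qed (rule real_le_rsqrt)
      finally show ?thesis .
    qed
    moreover have "J a + k \<in> H" using that by (intro HS.add_mem J_mem H0_H)
    ultimately show ?thesis
      using rk_adjoint_J[OF that] by (auto simp: AIP_solutions_def nm)
  qed
  show "M_G h \<in> H \<and> rk_norm ip (M_G h) = rk_norm ipE h" if "h \<in> HE" for h
    using surj[OF that] M_G obs H0_H by (auto simp: nm)
  show "(rk_norm ip (f h))\<^sup>2 = (norm xt)\<^sup>2 + (rk_norm ipE h)\<^sup>2" if "h \<in> HE" for h
    using surj[OF that] f obs nm_decomposition[OF xt(1)] by (auto simp: nm)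
  show "bij_betw f B (AIP_solutions H ip S T E N x)"
  proof (rule bij_betwI')
    fix h h' assume "h \<in> B" "h' \<in> B"
    then obtain k k' where "k \<in> H0" "k' \<in> H0" "h = C.obs k" "h' = C.obs k'"
      using surj unfolding B_def by blast
    then show "(f h = f h') = (h = h')" using f obs_inj[of k k'] by auto
  next
    fix h assume h: "h \<in> B"
    then obtain k where k: "k \<in> H0" "h = C.obs k" using surj unfolding B_def by blast
    then show "f h \<in> AIP_solutions H ip S T E N x"
      using h obs[OF k(1)] sol[OF xt(1) k(1)] f[OF k(1)] by (simp add: B_def)
  next
    fix g assume g: "g \<in> AIP_solutions H ip S T E N x"
    then have "g \<in> H" by (simp add: AIP_solutions_def)
    then obtain a k where ak: "a \<in> X" "k \<in> H0" "g = J a + k" by (rule decomposition)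
    then have "a = xt" "HS.nm k \<le> sqrt (1 - (norm xt)\<^sup>2)" using sol g by auto
    then show "\<exists>h\<in>B. g = f h" using ak obs f by (intro bexI[of _ "C.obs k"]) (auto simp: B_def)
  qed
qed

text \<open>Douglas' factorization: positivity bounds \<open>cinner v x\<close> by
  \<open>norm (R v)\<close>, so sending \<open>R v\<close> to \<open>cinner v x\<close> is a
  functional of norm at most 1 on the range of \<open>R\<close>, represented by a vector of
  \<open>X\<close>.\<close>

lemma target_factorization:
  assumes "positive_op (\<lambda>v. gram_op ip S T E N v - cinner v x *\<^sub>C x)"
  obtains xt where "xt \<in> X" "x = R xt" "norm xt \<le> 1"
proof -
  interpret XS: hspace X cinner by (rule HX)
  have le: "cmod (cinner v x) \<le> norm (R v)" for v
  proof -
    have "gram_op ip S T E N v = R (R v)" using fun_cong[OF R_sq, of v] by simp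
    moreover have "0 \<le> Re (cinner (gram_op ip S T E N v - cinner v x *\<^sub>C x) v)"
      using assms unfolding positive_op_def by blast
    ultimately have "0 \<le> Re (cinner (R (R v) - cinner v x *\<^sub>C x) v)" by simp
    also have "cinner (R (R v) - cinner v x *\<^sub>C x) v = of_real ((norm (R v))\<^sup>2) - of_real ((cmod (cinner v x))\<^sup>2)"
      using cinner_commute[of v x] complex_norm_square[of "cinner v x"]
      by (simp add: cinner_algebra R_sym[of "R v"] cinner_self)
    finally have "(cmod (cinner v x))\<^sup>2 \<le> (norm (R v))\<^sup>2" by simp
    then show ?thesis by (rule power2_le_imp_le) simp
  qed
  note lin = bounded_clinear_simps[OF R]
  obtain g where g: "g \<in> X" "XS.nm g \<le> 1" "\<And>q c. (q, c) \<in> range (\<lambda>v. (R v, cinner v x)) \<Longrightarrow> cinner q g = c"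
  proof (rule XS.riesz_relation[of "range (\<lambda>v. (R v, cinner v x))" 1])
    show "(0, 0) \<in> range (\<lambda>v. (R v, cinner v x))" by (rule range_eqI[of _ _ 0]) (simp add: lin)
    fix q c q' c' a assume qc: "(q, c) \<in> range (\<lambda>v. (R v, cinner v x))"
    then obtain v where v: "q = R v" "c = cinner v x" by blast
    show "(a *\<^sub>C q, a * c) \<in> range (\<lambda>v. (R v, cinner v x))"
      by (rule range_eqI[of _ _ "a *\<^sub>C v"]) (simp add: v lin cinner_algebra)
    assume "(q', c') \<in> range (\<lambda>v. (R v, cinner v x))"
    then obtain w where w: "q' = R w" "c' = cinner w x" by blast
    show "(q + q', c + c') \<in> range (\<lambda>v. (R v, cinner v x))"
      by (rule range_eqI[of _ _ "v + w"]) (simp add: v w lin cinner_algebra)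
  next
    fix q c assume "(q, c) \<in> range (\<lambda>v. (R v, cinner v x))"
    then obtain v where v: "q = R v" "c = cinner v x" by blast
    show "q \<in> X" by (simp add: v R_mem)
    show "cmod c \<le> 1 * XS.nm q" using le[of v] by (simp add: v nm_cinner)
  qed simp_all
  have "x = R g"
  proof (rule cinner_extensionality_right)
    fix v show "cinner v x = cinner v (R g)" using g(3)[of "R v" "cinner v x"] by (simp add: R_sym)
  qed
  then show ?thesis using that g by (simp add: nm_cinner)
qed

end

section \<open>From the given unitary operator to the abstract setting\<close>

lemma AIP_loadingI:
  assumes HS: "is_rkhs (dBR_kernel S) HS ipS"
    and adm: "AIP_admissible HS ipS S T E N"
    and R: "is_psqrt R (gram_op ipS S T E N)"
    and V: "is_isometry_V R T E N V"
    and i: "unitary_between (Delta R N) UNIV i"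
    and j: "unitary_between (Delta_star R T E) UNIV j"
    and U: "is_unitary_U R T E N V i j U"
  shows "AIP_loading S HS ipS T E N (X0 R) R U"
proof -
  have cl: "bounded_clinear R" "bounded_clinear T" "bounded_clinear E" "bounded_clinear N" "S \<in> schur_class"
    using R adm by (auto simp: is_psqrt_def positive_op_def AIP_admissible_def)
  have R_sym: "cinner (R a) b = cinner a (R b)" for a b
    using R positive_op_symmetric by (auto simp: is_psqrt_def)
  have X: "csubspace (X0 R)" "closed (X0 R)"
    by (simp_all add: X0_def csubspace_closure csubspace_range cl)
  have Uu: "unitary_between (X0 R \<times> UNIV) (X0 R \<times> UNIV) U"
    and U_DV: "\<And>p. p \<in> DV R N \<Longrightarrow> U (fst p, snd p, 0) = (fst (V p), snd (V p), 0)"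
    and U_i: "\<And>p. p \<in> Delta R N \<Longrightarrow> U (fst p, snd p, 0) = (0, 0, i p)"
    and U_j: "\<And>q. q \<in> Delta_star R T E \<Longrightarrow> U (0, 0, j q) = (fst q, snd q, 0)"
    using U by (auto simp: is_unitary_U_def)
  have D22: "snd (snd (U (0, 0, e))) = 0" for e
  proof -
    obtain q where "q \<in> Delta_star R T E" "j q = e" using j by (metis UNIV_I imageE unitary_between_def)
    then show ?thesis using U_j[of q] by simp
  qed
  interpret L: loading "X0 R" U by standard (fact X Uu D22)+
  have data: "L.sys (R a) (N a) 0 (R (T a)) (E a) 0" for a
  proof -
    have "(R a, N a) \<in> DV R N" unfolding DV_def by (rule subsetD[OF closure_subset]) simp
    moreover have "R a \<in> X0 R" unfolding X0_def by (rule subsetD[OF closure_subset]) simp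
    ultimately show ?thesis using U_DV[of "(R a, N a)"] V by (simp add: L.sys_def is_isometry_V_def)
  qed
  interpret IL: interpolation_loading "X0 R" U R T E N
    by standard (rule X0_def cl R_sym data)+
  have "bounded_clinear (\<lambda>x. (R x, N x))"
    using cl bounded_linear_Pair by (auto simp: bounded_clinear_def)
  then have DV: "csubspace (DV R N)" "closed (DV R N)"
    by (simp_all add: DV_def csubspace_closure csubspace_range)
  have DV_sub: "DV R N \<subseteq> X0 R \<times> UNIV"
    unfolding DV_def using IL.R_mem X(2) by (intro closure_minimal closed_Times) auto
  show ?thesis
  proof
    show "S \<in> schur_class" "is_rkhs (dBR_kernel S) HS ipS" "AIP_admissible HS ipS S T E N" by fact+
    show "R \<circ> R = gram_op ipS S T E N" using R by (simp add: is_psqrt_def)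
    show "\<exists>a u. L.sys a u 0 0 0 d" for d
    proof -
      obtain p where p: "p \<in> Delta R N" "i p = d" using i by (metis UNIV_I imageE unitary_between_def)
      then have "fst p \<in> X0 R" by (auto simp: Delta_def orth_minus_def)
      then have "L.sys (fst p) (snd p) 0 0 0 d" using U_i[OF p(1)] p(2) by (simp add: L.sys_def)
      then show ?thesis by blast
    qed
    show "(a, u) \<in> closure (range (\<lambda>x. (R x, N x)))" if s: "L.sys a u 0 a' y 0" for a u a' y
    proof -
      obtain p where p: "p \<in> DV R N" "\<And>m. m \<in> DV R N \<Longrightarrow> cinner ((a, u) - p) m = 0"
        using projection[OF DV] by blast
      \<comment> \<open>The defect of the projection onto the domain of V lies in \<Delta>, so
        \<open>U\<close> sends it to the port \<open>d\<close> alone. A trajectory with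
        \<open>d = 0\<close> is orthogonal to it, which forces \<open>r = 0\<close>.\<close>
      define r where "r = (a, u) - p"
      have "a \<in> X0 R" using L.sys_mem[OF s] by blast
      moreover have "fst p \<in> X0 R" using p(1) DV_sub by auto
      ultimately have "fst r \<in> X0 R" by (simp add: r_def L.X_mem)
      then have r: "r \<in> Delta R N" using p(2) by (auto simp: Delta_def orth_minus_def r_def mem_Times_iff)
      then have "L.sys (fst r) (snd r) 0 0 0 (i r)"
        using U_i[OF r] by (auto simp: L.sys_def Delta_def orth_minus_def)
      from L.sys_cinner[OF s this] have "cinner (a, u) r = 0" by (cases r) simp
      moreover have "cinner r p = 0" using p by (simp add: r_def)
      then have "cinner p r = 0" by (metis cinner_commute complex_cnj_zero)
      moreover have "cinner r r = cinner (a, u) r - cinner p r"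
        unfolding cinner_diff_left[symmetric] by (simp add: r_def)
      ultimately have "cinner r r = 0" by simp
      then have "(a, u) = p" by (simp add: cinner_self r_def)
      then show ?thesis using p(1) by (simp add: DV_def)
    qed
    show "\<exists>e. L.sys 0 0 e a y 0" if a: "a \<in> X0 R" "\<And>x. cinner a (R (T x)) + cinner y (E x) = 0" for a y
    proof -
      have "cinner (a, y) m = 0" if "m \<in> RV R T E" for m
        using that unfolding RV_def by (rule orthogonal_closure[rotated]) (use a(2) in auto)
      then have "(a, y) \<in> Delta_star R T E" using a(1) by (simp add: Delta_star_def orth_minus_def)
      from U_j[OF this] have "L.sys 0 0 (j (a, y)) a y 0" by (simp add: L.sys_def L.X_mem)
      then show ?thesis by blast
    qed
  qed
qed

theorem theorem5p2:
  fixes S :: "complex \<Rightarrow> 'u::chilbert_space \<Rightarrow> 'y::chilbert_space"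
    and T :: "'x::chilbert_space \<Rightarrow> 'x"
    and E :: "'x \<Rightarrow> 'y"
    and N :: "'x \<Rightarrow> 'u"
    and x :: 'x
    and HS :: "(complex \<Rightarrow> 'y) set"
    and ipS :: "(complex \<Rightarrow> 'y) \<Rightarrow> (complex \<Rightarrow> 'y) \<Rightarrow> complex"
    and R :: "'x \<Rightarrow> 'x"
    and V :: "'x \<times> 'u \<Rightarrow> 'x \<times> 'y"
    and i :: "'x \<times> 'u \<Rightarrow> 'd::chilbert_space"
    and j :: "'x \<times> 'y \<Rightarrow> 'e::chilbert_space"
    and U :: "'x \<times> 'u \<times> 'e \<Rightarrow> 'x \<times> 'y \<times> 'd"
  assumes HS: "is_rkhs (dBR_kernel S) HS ipS"
    and adm: "AIP_admissible HS ipS S T E N"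
    and P_ge: "positive_op (\<lambda>v. gram_op ipS S T E N v - cinner v x *\<^sub>C x)"
    and T_cond: "(\<Inter>k\<in>{1..}. range (cadjoint T ^^ k)) \<inter> {v. cadjoint T v = 0} = {0}"
    and R: "is_psqrt R (gram_op ipS S T E N)"
    and V: "is_isometry_V R T E N V"
    and i: "unitary_between (Delta R N) UNIV i"
    and j: "unitary_between (Delta_star R T E) UNIV j"
    and U: "is_unitary_U R T E N V i j U"
  shows "\<exists>\<E> :: complex \<Rightarrow> 'd \<Rightarrow> 'e.
    \<E> \<in> schur_class \<and>
    (\<forall>z\<in>\<bbbD>. S z = redheffer U (X0 R) \<E> z) \<and>
    (\<forall>\<E>'\<in>schur_class. (\<forall>z\<in>\<bbbD>. S z = redheffer U (X0 R) \<E>' z) \<longrightarrow> (\<forall>z\<in>\<bbbD>. \<E>' z = \<E> z)) \<and>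
    (\<exists>!xt. xt \<in> X0 R \<and> x = R xt) \<and>
    (\<forall>xt HE ipE. xt \<in> X0 R \<and> x = R xt \<and> is_rkhs (dBR_kernel \<E>) HE ipE \<longrightarrow>
      (let B = {h \<in> HE. rk_norm ipE h \<le> sqrt (1 - (norm xt)\<^sup>2)};
           M_G = (\<lambda>h. on_disk (\<lambda>z. G_fun U (X0 R) \<E> z (h z)));
           f = (\<lambda>h. on_disk (\<lambda>z. Gamma_fun U (X0 R) \<E> z xt + G_fun U (X0 R) \<E> z (h z)))
       in bij_betw f B (AIP_solutions HS ipS S T E N x) \<and>
          (\<forall>h\<in>HE. M_G h \<in> HS \<and> rk_norm ipS (M_G h) = rk_norm ipE h) \<and>
          (\<forall>h\<in>B. (rk_norm ipS (f h))\<^sup>2 = (norm xt)\<^sup>2 + (rk_norm ipE h)\<^sup>2)))"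
proof -
  interpret L: AIP_loading S HS ipS T E N "X0 R" R U
    by (rule AIP_loadingI[OF HS adm R V i j U])
  obtain xt where xt: "xt \<in> X0 R" "x = R xt" "norm xt \<le> 1"
    by (rule L.target_factorization[OF P_ge])
  have unique: "a = xt" if "a \<in> X0 R" "x = R a" for a
  proof -
    have "R (a - xt) = 0" using that xt bounded_clinear_simps(2)[OF L.R] by simp
    then show ?thesis using L.R_inj[of "a - xt"] that xt L.X_mem by simp
  qed
  show ?thesis
  proof (intro exI[of _ L.C.tf] conjI ballI allI impI)
    show "L.C.tf \<in> schur_class" by (rule L.C.tf_schur)
    show "S z = redheffer U (X0 R) L.C.tf z" if "z \<in> \<bbbD>" for z using L.redheffer_tf[OF that] by simp
    show "\<E>' z = L.C.tf z" if "\<E>' \<in> schur_class" "\<forall>z\<in>\<bbbD>. S z = redheffer U (X0 R) \<E>' z" "z \<in> \<bbbD>" for \<E>' z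
      using that by (intro L.redheffer_unique[OF that(1) L.C.tf_schur _ T_cond]) (simp_all add: L.redheffer_tf)
    show "\<exists>!xt. xt \<in> X0 R \<and> x = R xt" using xt unique by blast
  next
    fix a HE ipE assume "a \<in> X0 R \<and> x = R a \<and> is_rkhs (dBR_kernel L.C.tf) HE ipE"
    then have "a = xt" "is_rkhs (dBR_kernel L.C.tf) HE ipE" using unique by auto
    then show "let B = {h \<in> HE. rk_norm ipE h \<le> sqrt (1 - (norm a)\<^sup>2)};
           M_G = (\<lambda>h. on_disk (\<lambda>z. G_fun U (X0 R) L.C.tf z (h z)));
           f = (\<lambda>h. on_disk (\<lambda>z. Gamma_fun U (X0 R) L.C.tf z a + G_fun U (X0 R) L.C.tf z (h z)))
       in bij_betw f B (AIP_solutions HS ipS S T E N x) \<and>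
          (\<forall>h\<in>HE. M_G h \<in> HS \<and> rk_norm ipS (M_G h) = rk_norm ipE h) \<and>
          (\<forall>h\<in>B. (rk_norm ipS (f h))\<^sup>2 = (norm a)\<^sup>2 + (rk_norm ipE h)\<^sup>2)"
      using L.parametrization[of HE ipE xt x] xt by (simp add: Let_def)
  qed
qed

end
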